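(* Let $\mathfrak{J}$ be the 2-category of monoidal categories with a distinguished object and $\mathfrak{J}_{\vee}$ its full sub-2-category on those whose distinguished object has a right dual (see context). For each object $(\mathcal{C},J)\in\mathfrak{J}$, there is an equivalence $$(\mathcal{C}[J^{\vee}],J)\simeq(\mathbb{N}[1^{\vee}]+_{\mathbb{N}}\mathcal{C},1)$$ in $\mathfrak{J}_{\vee}$.
   Context: A right dual of an object $X$ in a monoidal category is an object $Y$ with morphisms $\varepsilon:X\otimes Y\to\mathbb{I}$ and $\eta:\mathbb{I}\to Y\otimes X$ such that $(\varepsilon\otimes X)(X\otimes\eta)=1_X$ and $(Y\otimes\varepsilon)(\eta\otimes Y)=1_Y$. The 2-category $\mathfrak{J}$: objects $(\mathcal{C},J)$ are monoidal categories $\mathcal{C}$ with a distinguished object $J\in\mathcal{C}$; 1-morphisms $(F,\phi):(\mathcal{C},J)\to(\mathcal{C}',J')$ are strong monoidal functors $F:\mathcal{C}\to\mathcal{C}'$ with an isomorphism $\phi:FJ\cong J'$; 2-morphisms $\sigma:(F,\phi)\Rightarrow(G,\psi)$ are monoidal natural transformations $\sigma:F\Rightarrow G$ with $\psi\circ\sigma_J=\phi$. $\mathfrak{J}_{\vee}$ is the full sub-2-category of those $(\mathcal{C},J)$ for which $J$ has a right dual. $\mathbb{N}$ is the discrete category of natural numbers with addition as tensor product (the free strict monoidal category on one generating object $1$); $(\mathbb{N},1)$ is the bicategorical initial object of $\mathfrak{J}$. $\mathbb{N}[1^{\vee}]$ denotes the construction $\mathcal{C}[J^{\vee}]$ below for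 $\mathcal{C}=\mathbb{N}$, $J=1$. For $(\mathcal{C},J),(\mathcal{D},K)\in\mathfrak{J}$, the notation $(\mathcal{C}+_{\mathbb{N}}\mathcal{D},J)$ denotes their bicategorical binary coproduct in $\mathfrak{J}$: there are coprojections $(\mathcal{C},J)\to(\mathcal{C}+_{\mathbb{N}}\mathcal{D},J)\leftarrow(\mathcal{D},K)$ in $\mathfrak{J}$, restriction along which gives equivalences $\mathfrak{J}((\mathcal{C}+_{\mathbb{N}}\mathcal{D},J),(\mathcal{X},L))\simeq\mathfrak{J}((\mathcal{C},J),(\mathcal{X},L))\times\mathfrak{J}((\mathcal{D},K),(\mathcal{X},L))$ for all $(\mathcal{X},L)$. If $J$ has a right dual in $\mathcal{C}$ or $K$ has one in $\mathcal{D}$, then the distinguished object of $\mathcal{C}+_{\mathbb{N}}\mathcal{D}$ has a right dual. Construction of $\mathcal{C}[J^{\vee}]$. Since every monoidal category is monoidally equivalent to a strict one, $\mathcal{C}$ is taken to be strict in the construction (a general $(\mathcal{C},J)$ is replaced by an equivalent strict one). Let $\mathcal{C}$ be strict monoidal with tensor $\otimes$ and unit $\mathbb{I}$, and $J\in\mathcal{C}$. Write $[m]=\{0,1,\dots,m\}$. Let $\mathcal{G}_0$ be the set of all functions $U:[m]\to \mathrm{ob}\,\mathcal{C}$ ($m\ge 0$), written $U=(U_0,\dots,U_m)$; objects of $\mathcal{C}$ are identified with functions $[0]\to\mathrm{ob}\,\mathcal{C}$. For $U:[m]\to\mathrm{ob}\,\mathcal{C}$ and $V:[n]\to\mathrm{ob}\,\mathcal{C}$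 define $U\otimes V:[m+n]\to\mathrm{ob}\,\mathcal{C}$ by $(U\otimes V)_i=U_i$ for $i<m$, $(U\otimes V)_m=U_m\otimes V_0$, $(U\otimes V)_i=V_{i-m}$ for $i>m$. This makes $\mathcal{G}_0$ a monoid with unit $\mathbb{I}$. Put $J^{\vee}=(\mathbb{I},\mathbb{I}):[1]\to\mathrm{ob}\,\mathcal{C}$; then every $U$ decomposes uniquely as $U=U_0\otimes J^{\vee}\otimes U_1\otimes J^{\vee}\otimes\dots\otimes J^{\vee}\otimes U_m$ with $U_i\in\mathcal{C}$. Let $\mathcal{G}$ be the directed graph with vertex set $\mathcal{G}_0$ and the following edges. The primitive edges are symbols $\varepsilon: J\otimes J^{\vee}\to\mathbb{I}$, $\eta:\mathbb{I}\to J^{\vee}\otimes J$, and $\bar f: C\to D$ for each morphism $f:C\to D$ of $\mathcal{C}$. The general edges are the formal whiskerings $U\otimes p\otimes V: U\otimes A\otimes V\to U\otimes B\otimes V$ with $p:A\to B$ primitive and $U,V\in\mathcal{G}_0$ (with $p$ identified with $\mathbb{I}\otimes p\otimes\mathbb{I}$); put $T\otimes(U\otimes p\otimes V)\otimes W=(T\otimes U)\otimes p\otimes(V\otimes W)$ and extend $U\otimes -\otimes V$ to paths edge by edge. Let $\mathcal{F}\mathcal{G}$ be the free category on $\mathcal{G}$, and let $\sim$ be the congruence on $\mathcal{F}\mathcal{G}$ generated by the following relations ($C,D,E,F\in\mathcal{C}$; $U,V,W,X,Y,Z\in\mathcal{G}_0$): (i) $\overline{E\otimes f\otimes F}\sim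 E\otimes\bar f\otimes F$ for $f\in\mathcal{C}(C,D)$; (ii) $\overline{1_C}\sim 1_C$, and $\overline{gf}\sim\bar g\,\bar f$ for $f\in\mathcal{C}(C,D)$, $g\in\mathcal{C}(D,E)$; (iii) $(V\otimes b)(a\otimes W)\sim(a\otimes X)(U\otimes b)$ for all edges $a:U\to V$, $b:W\to X$; (iv) $(\varepsilon\otimes J)(J\otimes\eta)\sim 1_J$; (v) $(J^{\vee}\otimes\varepsilon)(\eta\otimes J^{\vee})\sim 1_{J^{\vee}}$; (vi) if $\ell\sim\ell'$ is any of the relations (i)–(v), then $Y\otimes\ell\otimes Z\sim Y\otimes\ell'\otimes Z$. Put $\mathcal{C}[J^{\vee}]=\mathcal{F}\mathcal{G}/\sim$. It is strict monoidal: the tensor of objects $U:[m]\to\mathrm{ob}\,\mathcal{C}$ and $V:[n]\to\mathrm{ob}\,\mathcal{C}$ is the product in the monoid $\mathcal{G}_0$, i.e. the function $U\otimes V:[m+n]\to\mathrm{ob}\,\mathcal{C}$ with $(U\otimes V)_i=U_i$ for $i<m$, $(U\otimes V)_m=U_m\otimes V_0$, $(U\otimes V)_i=V_{i-m}$ for $i>m$, and for morphisms $[a]\otimes[b]$ is the class of both sides of (iii), extended to paths. In it $J\dashv J^{\vee}$ with counit $\varepsilon$ and unit $\eta$. *)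

theory Defs
  imports "HOL-Library.FuncSet"
begin

section \<open>Categories\<close>

record ('o, 'm) cat =
  Obj :: "'o set"
  Arr :: "'m set"
  Dom :: "'m \<Rightarrow> 'o"
  Cod :: "'m \<Rightarrow> 'o"
  Idt :: "'o \<Rightarrow> 'm"
  Comp :: "'m \<Rightarrow> 'm \<Rightarrow> 'm"  (infixl "\<cdot>\<index>" 55)

definition Hom :: "('o, 'm, 'z) cat_scheme \<Rightarrow> 'o \<Rightarrow> 'o \<Rightarrow> 'm set" where
  "Hom C A B = {f \<in> Arr C. Dom C f = A \<and> Cod C f = B}"

locale category =
  fixes C :: "('o, 'm, 'z) cat_scheme" (structure)
  assumes dom_obj: "f \<in> Arr C \<Longrightarrow> Dom C f \<in> Obj C"
    and cod_obj: "f \<in> Arr C \<Longrightarrow> Cod C f \<in> Obj C"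
    and idt_hom: "A \<in> Obj C \<Longrightarrow> Idt C A \<in> Hom C A A"
    and comp_hom: "\<lbrakk>f \<in> Hom C A B; g \<in> Hom C B D\<rbrakk> \<Longrightarrow> g \<cdot> f \<in> Hom C A D"
    and comp_idt: "f \<in> Hom C A B \<Longrightarrow> f \<cdot> Idt C A = f"
    and idt_comp: "f \<in> Hom C A B \<Longrightarrow> Idt C B \<cdot> f = f"
    and comp_assoc: "\<lbrakk>f \<in> Hom C A B; g \<in> Hom C B D; h \<in> Hom C D E\<rbrakk>
          \<Longrightarrow> h \<cdot> (g \<cdot> f) = (h \<cdot> g) \<cdot> f"

definition inverse_arrs :: "('o, 'm, 'z) cat_scheme \<Rightarrow> 'm \<Rightarrow> 'm \<Rightarrow> bool" where
  "inverse_arrs C f g \<longleftrightarrow> f \<in> Arr C \<and> g \<in> Hom C (Cod C f) (Dom C f) \<and>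
     g \<cdot>\<^bsub>C\<^esub> f = Idt C (Dom C f) \<and> f \<cdot>\<^bsub>C\<^esub> g = Idt C (Cod C f)"

definition is_iso :: "('o, 'm, 'z) cat_scheme \<Rightarrow> 'm \<Rightarrow> bool" where
  "is_iso C f \<longleftrightarrow> (\<exists>g. inverse_arrs C f g)"

definition inv_arr :: "('o, 'm, 'z) cat_scheme \<Rightarrow> 'm \<Rightarrow> 'm" where
  "inv_arr C f = (THE g. inverse_arrs C f g)"

definition isomorphic :: "('o, 'm, 'z) cat_scheme \<Rightarrow> 'o \<Rightarrow> 'o \<Rightarrow> bool" where
  "isomorphic C A B \<longleftrightarrow> (\<exists>f \<in> Hom C A B. is_iso C f)"

record ('o, 'm, 'p, 'q) cfun =
  ob_map :: "'o \<Rightarrow> 'p"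
  ar_map :: "'m \<Rightarrow> 'q"

locale is_functor =
  dom: category C + cod: category D
  for C :: "('o, 'm, 'y) cat_scheme" and D :: "('p, 'q, 'z) cat_scheme"
    and F :: "('o, 'm, 'p, 'q, 'w) cfun_scheme" +
  assumes ob_map_obj: "A \<in> Obj C \<Longrightarrow> ob_map F A \<in> Obj D"
    and ar_map_hom: "f \<in> Hom C A B \<Longrightarrow> ar_map F f \<in> Hom D (ob_map F A) (ob_map F B)"
    and ar_map_idt: "A \<in> Obj C \<Longrightarrow> ar_map F (Idt C A) = Idt D (ob_map F A)"
    and ar_map_comp: "\<lbrakk>f \<in> Hom C A B; g \<in> Hom C B E\<rbrakk>
          \<Longrightarrow> ar_map F (g \<cdot>\<^bsub>C\<^esub> f) = ar_map F g \<cdot>\<^bsub>D\<^esub> ar_map F f"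

definition nat_trans ::
  "('o, 'm, 'y) cat_scheme \<Rightarrow> ('p, 'q, 'z) cat_scheme \<Rightarrow> ('o, 'm, 'p, 'q, 'v) cfun_scheme \<Rightarrow>
   ('o, 'm, 'p, 'q, 'w) cfun_scheme \<Rightarrow> ('o \<Rightarrow> 'q) \<Rightarrow> bool" where
  "nat_trans C D F G s \<longleftrightarrow>
     (\<forall>A \<in> Obj C. s A \<in> Hom D (ob_map F A) (ob_map G A)) \<and>
     (\<forall>f \<in> Arr C. ar_map G f \<cdot>\<^bsub>D\<^esub> s (Dom C f) = s (Cod C f) \<cdot>\<^bsub>D\<^esub> ar_map F f)"

definition nat_iso ::
  "('o, 'm, 'y) cat_scheme \<Rightarrow> ('p, 'q, 'z) cat_scheme \<Rightarrow> ('o, 'm, 'p, 'q, 'v) cfun_scheme \<Rightarrow>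
   ('o, 'm, 'p, 'q, 'w) cfun_scheme \<Rightarrow> ('o \<Rightarrow> 'q) \<Rightarrow> bool" where
  "nat_iso C D F G s \<longleftrightarrow> nat_trans C D F G s \<and> (\<forall>A \<in> Obj C. is_iso D (s A))"

definition id_cfun :: "('o, 'm, 'o, 'm) cfun" where
  "id_cfun = \<lparr>ob_map = (\<lambda>A. A), ar_map = (\<lambda>f. f)\<rparr>"

definition comp_cfun ::
  "('p, 'q, 'r, 's, 'v) cfun_scheme \<Rightarrow> ('o, 'm, 'p, 'q, 'w) cfun_scheme \<Rightarrow> ('o, 'm, 'r, 's) cfun"
  where
  "comp_cfun G F = \<lparr>ob_map = (\<lambda>A. ob_map G (ob_map F A)), ar_map = (\<lambda>f. ar_map G (ar_map F f))\<rparr>"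

definition equivalence_functor ::
  "('o, 'm, 'y) cat_scheme \<Rightarrow> ('p, 'q, 'z) cat_scheme \<Rightarrow> ('o, 'm, 'p, 'q) cfun \<Rightarrow> bool" where
  "equivalence_functor C D F \<longleftrightarrow> is_functor C D F \<and>
     (\<exists>G :: ('p, 'q, 'o, 'm) cfun. is_functor D C G \<and>
        (\<exists>s. nat_iso C C (comp_cfun G F) id_cfun s) \<and>
        (\<exists>t. nat_iso D D (comp_cfun F G) id_cfun t))"

definition prod_cat ::
  "('o, 'm) cat \<Rightarrow> ('p, 'q) cat \<Rightarrow> ('o \<times> 'p, 'm \<times> 'q) cat" where
  "prod_cat C D =
     \<lparr>Obj = Obj C \<times> Obj D, Arr = Arr C \<times> Arr D,
      Dom = (\<lambda>(f, g). (Dom C f, Dom D g)), Cod = (\<lambda>(f, g). (Cod C f, Cod D g)),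
      Idt = (\<lambda>(A, B). (Idt C A, Idt D B)),
      Comp = (\<lambda>(f', g') (f, g). (f' \<cdot>\<^bsub>C\<^esub> f, g' \<cdot>\<^bsub>D\<^esub> g))\<rparr>"


section \<open>Monoidal categories\<close>

record ('o, 'm) moncat = "('o, 'm) cat" +
  TenO :: "'o \<Rightarrow> 'o \<Rightarrow> 'o"  (infixr "\<otimes>\<index>" 70)
  TenA :: "'m \<Rightarrow> 'm \<Rightarrow> 'm"  (infixr "\<boxtimes>\<index>" 70)
  Unit :: 'o  ("\<I>\<index>")
  Assoc :: "'o \<Rightarrow> 'o \<Rightarrow> 'o \<Rightarrow> 'm"
  LUnit :: "'o \<Rightarrow> 'm"
  RUnit :: "'o \<Rightarrow> 'm"

locale monoidal_category = category C
  for C :: "('o, 'm, 'z) moncat_scheme" (structure) +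
  assumes unit_obj: "\<I> \<in> Obj C"
    and ten_obj: "\<lbrakk>A \<in> Obj C; B \<in> Obj C\<rbrakk> \<Longrightarrow> A \<otimes> B \<in> Obj C"
    and ten_hom: "\<lbrakk>f \<in> Hom C A B; g \<in> Hom C A' B'\<rbrakk> \<Longrightarrow> f \<boxtimes> g \<in> Hom C (A \<otimes> A') (B \<otimes> B')"
    and ten_idt: "\<lbrakk>A \<in> Obj C; B \<in> Obj C\<rbrakk> \<Longrightarrow> Idt C A \<boxtimes> Idt C B = Idt C (A \<otimes> B)"
    and ten_comp: "\<lbrakk>f \<in> Hom C A B; g \<in> Hom C B D; f' \<in> Hom C A' B'; g' \<in> Hom C B' D'\<rbrakk>
          \<Longrightarrow> (g \<cdot> f) \<boxtimes> (g' \<cdot> f') = (g \<boxtimes> g') \<cdot> (f \<boxtimes> f')"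
    and assoc_hom: "\<lbrakk>A \<in> Obj C; B \<in> Obj C; D \<in> Obj C\<rbrakk>
          \<Longrightarrow> Assoc C A B D \<in> Hom C ((A \<otimes> B) \<otimes> D) (A \<otimes> (B \<otimes> D))"
    and assoc_iso: "\<lbrakk>A \<in> Obj C; B \<in> Obj C; D \<in> Obj C\<rbrakk> \<Longrightarrow> is_iso C (Assoc C A B D)"
    and assoc_nat: "\<lbrakk>f \<in> Hom C A A'; g \<in> Hom C B B'; h \<in> Hom C D D'\<rbrakk>
          \<Longrightarrow> (f \<boxtimes> (g \<boxtimes> h)) \<cdot> Assoc C A B D = Assoc C A' B' D' \<cdot> ((f \<boxtimes> g) \<boxtimes> h)"
    and lunit_hom: "A \<in> Obj C \<Longrightarrow> LUnit C A \<in> Hom C (\<I> \<otimes> A) A"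
    and lunit_iso: "A \<in> Obj C \<Longrightarrow> is_iso C (LUnit C A)"
    and lunit_nat: "f \<in> Hom C A B \<Longrightarrow> f \<cdot> LUnit C A = LUnit C B \<cdot> (Idt C \<I> \<boxtimes> f)"
    and runit_hom: "A \<in> Obj C \<Longrightarrow> RUnit C A \<in> Hom C (A \<otimes> \<I>) A"
    and runit_iso: "A \<in> Obj C \<Longrightarrow> is_iso C (RUnit C A)"
    and runit_nat: "f \<in> Hom C A B \<Longrightarrow> f \<cdot> RUnit C A = RUnit C B \<cdot> (f \<boxtimes> Idt C \<I>)"
    and pentagon: "\<lbrakk>A \<in> Obj C; B \<in> Obj C; D \<in> Obj C; E \<in> Obj C\<rbrakk>
          \<Longrightarrow> (Idt C A \<boxtimes> Assoc C B D E) \<cdot> Assoc C A (B \<otimes> D) E \<cdot> (Assoc C A B D \<boxtimes> Idt C E)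
              = Assoc C A B (D \<otimes> E) \<cdot> Assoc C (A \<otimes> B) D E"
    and triangle: "\<lbrakk>A \<in> Obj C; B \<in> Obj C\<rbrakk>
          \<Longrightarrow> (Idt C A \<boxtimes> LUnit C B) \<cdot> Assoc C A \<I> B = RUnit C A \<boxtimes> Idt C B"

locale strict_monoidal_category = monoidal_category C
  for C :: "('o, 'm, 'z) moncat_scheme" (structure) +
  assumes strict_assoc: "\<lbrakk>A \<in> Obj C; B \<in> Obj C; D \<in> Obj C\<rbrakk> \<Longrightarrow> (A \<otimes> B) \<otimes> D = A \<otimes> (B \<otimes> D)"
    and strict_lunit: "A \<in> Obj C \<Longrightarrow> \<I> \<otimes> A = A"
    and strict_runit: "A \<in> Obj C \<Longrightarrow> A \<otimes> \<I> = A"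
    and assoc_idt: "\<lbrakk>A \<in> Obj C; B \<in> Obj C; D \<in> Obj C\<rbrakk>
          \<Longrightarrow> Assoc C A B D = Idt C (A \<otimes> (B \<otimes> D))"
    and lunit_idt: "A \<in> Obj C \<Longrightarrow> LUnit C A = Idt C A"
    and runit_idt: "A \<in> Obj C \<Longrightarrow> RUnit C A = Idt C A"

definition is_right_dual ::
  "('o, 'm, 'z) moncat_scheme \<Rightarrow> 'o \<Rightarrow> 'o \<Rightarrow> 'm \<Rightarrow> 'm \<Rightarrow> bool" where
  "is_right_dual C X Y e h \<longleftrightarrow> X \<in> Obj C \<and> Y \<in> Obj C \<and>
     e \<in> Hom C (X \<otimes>\<^bsub>C\<^esub> Y) \<I>\<^bsub>C\<^esub> \<and> h \<in> Hom C \<I>\<^bsub>C\<^esub> (Y \<otimes>\<^bsub>C\<^esub> X) \<and>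
     LUnit C X \<cdot>\<^bsub>C\<^esub> (e \<boxtimes>\<^bsub>C\<^esub> Idt C X) \<cdot>\<^bsub>C\<^esub> inv_arr C (Assoc C X Y X)
       \<cdot>\<^bsub>C\<^esub> (Idt C X \<boxtimes>\<^bsub>C\<^esub> h) \<cdot>\<^bsub>C\<^esub> inv_arr C (RUnit C X) = Idt C X \<and>
     RUnit C Y \<cdot>\<^bsub>C\<^esub> (Idt C Y \<boxtimes>\<^bsub>C\<^esub> e) \<cdot>\<^bsub>C\<^esub> Assoc C Y X Y
       \<cdot>\<^bsub>C\<^esub> (h \<boxtimes>\<^bsub>C\<^esub> Idt C Y) \<cdot>\<^bsub>C\<^esub> inv_arr C (LUnit C Y) = Idt C Y"

definition has_right_dual :: "('o, 'm, 'z) moncat_scheme \<Rightarrow> 'o \<Rightarrow> bool" where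
  "has_right_dual C X \<longleftrightarrow> (\<exists>Y e h. is_right_dual C X Y e h)"

text \<open>Structure maps: \<open>mult F (A, B) : F A \<otimes> F B \<rightarrow> F (A \<otimes> B)\<close> and \<open>unit_map F : \<I> \<rightarrow> F \<I>\<close>.\<close>

record ('o, 'm, 'p, 'q) monfun = "('o, 'm, 'p, 'q) cfun" +
  mult :: "'o \<times> 'o \<Rightarrow> 'q"
  unit_map :: 'q

locale strong_monoidal_functor =
  dom: monoidal_category C + cod: monoidal_category D + is_functor C D F
  for C :: "('o, 'm) moncat" and D :: "('p, 'q) moncat" and F :: "('o, 'm, 'p, 'q) monfun" +
  assumes mult_hom: "\<lbrakk>A \<in> Obj C; B \<in> Obj C\<rbrakk>
          \<Longrightarrow> mult F (A, B) \<in> Hom D (ob_map F A \<otimes>\<^bsub>D\<^esub> ob_map F B) (ob_map F (A \<otimes>\<^bsub>C\<^esub> B))"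
    and mult_iso: "\<lbrakk>A \<in> Obj C; B \<in> Obj C\<rbrakk> \<Longrightarrow> is_iso D (mult F (A, B))"
    and mult_nat: "\<lbrakk>f \<in> Hom C A A'; g \<in> Hom C B B'\<rbrakk>
          \<Longrightarrow> ar_map F (f \<boxtimes>\<^bsub>C\<^esub> g) \<cdot>\<^bsub>D\<^esub> mult F (A, B)
              = mult F (A', B') \<cdot>\<^bsub>D\<^esub> (ar_map F f \<boxtimes>\<^bsub>D\<^esub> ar_map F g)"
    and unit_hom: "unit_map F \<in> Hom D \<I>\<^bsub>D\<^esub> (ob_map F \<I>\<^bsub>C\<^esub>)"
    and unit_iso: "is_iso D (unit_map F)"
    and mult_assoc: "\<lbrakk>A \<in> Obj C; B \<in> Obj C; E \<in> Obj C\<rbrakk>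
          \<Longrightarrow> ar_map F (Assoc C A B E) \<cdot>\<^bsub>D\<^esub> mult F (A \<otimes>\<^bsub>C\<^esub> B, E)
                \<cdot>\<^bsub>D\<^esub> (mult F (A, B) \<boxtimes>\<^bsub>D\<^esub> Idt D (ob_map F E))
              = mult F (A, B \<otimes>\<^bsub>C\<^esub> E) \<cdot>\<^bsub>D\<^esub> (Idt D (ob_map F A) \<boxtimes>\<^bsub>D\<^esub> mult F (B, E))
                \<cdot>\<^bsub>D\<^esub> Assoc D (ob_map F A) (ob_map F B) (ob_map F E)"
    and mult_lunit: "A \<in> Obj C
          \<Longrightarrow> ar_map F (LUnit C A) \<cdot>\<^bsub>D\<^esub> mult F (\<I>\<^bsub>C\<^esub>, A)
                \<cdot>\<^bsub>D\<^esub> (unit_map F \<boxtimes>\<^bsub>D\<^esub> Idt D (ob_map F A)) = LUnit D (ob_map F A)"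
    and mult_runit: "A \<in> Obj C
          \<Longrightarrow> ar_map F (RUnit C A) \<cdot>\<^bsub>D\<^esub> mult F (A, \<I>\<^bsub>C\<^esub>)
                \<cdot>\<^bsub>D\<^esub> (Idt D (ob_map F A) \<boxtimes>\<^bsub>D\<^esub> unit_map F) = RUnit D (ob_map F A)"

definition monoidal_nat_trans ::
  "('o, 'm) moncat \<Rightarrow> ('p, 'q) moncat \<Rightarrow> ('o, 'm, 'p, 'q) monfun \<Rightarrow>
   ('o, 'm, 'p, 'q) monfun \<Rightarrow> ('o \<Rightarrow> 'q) \<Rightarrow> bool" where
  "monoidal_nat_trans C D F G s \<longleftrightarrow> nat_trans C D F G s \<and>
     (\<forall>A \<in> Obj C. \<forall>B \<in> Obj C.
        s (A \<otimes>\<^bsub>C\<^esub> B) \<cdot>\<^bsub>D\<^esub> mult F (A, B) = mult G (A, B) \<cdot>\<^bsub>D\<^esub> (s A \<boxtimes>\<^bsub>D\<^esub> s B)) \<and>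
     s \<I>\<^bsub>C\<^esub> \<cdot>\<^bsub>D\<^esub> unit_map F = unit_map G"


section \<open>The 2-category of monoidal categories with a distinguished object\<close>

definition in_J :: "('o, 'm) moncat \<Rightarrow> 'o \<Rightarrow> bool" where
  "in_J C J \<longleftrightarrow> monoidal_category C \<and> J \<in> Obj C"

definition in_Jdual :: "('o, 'm) moncat \<Rightarrow> 'o \<Rightarrow> bool" where
  "in_Jdual C J \<longleftrightarrow> in_J C J \<and> has_right_dual C J"

type_synonym ('o, 'm, 'p, 'q) jmor = "('o, 'm, 'p, 'q) monfun \<times> 'q"

text \<open>HOL functions are total on their type. All data of a 1- or 2-morphism is therefore required
  to be \<^const>\<open>undefined\<close> off its domain (\<^const>\<open>extensional\<close>), so that equality of 1- and
  2-morphisms in HOL is equality of the data they carry.\<close>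

definition one_mor ::
  "('o, 'm) moncat \<Rightarrow> 'o \<Rightarrow> ('p, 'q) moncat \<Rightarrow> 'p \<Rightarrow> ('o, 'm, 'p, 'q) jmor \<Rightarrow> bool" where
  "one_mor C J D K = (\<lambda>(F, p).
     in_J C J \<and> in_J D K \<and> strong_monoidal_functor C D F \<and>
     p \<in> Hom D (ob_map F J) K \<and> is_iso D p \<and>
     ob_map F \<in> extensional (Obj C) \<and> ar_map F \<in> extensional (Arr C) \<and>
     mult F \<in> extensional (Obj C \<times> Obj C))"

definition two_mor ::
  "('o, 'm) moncat \<Rightarrow> 'o \<Rightarrow> ('p, 'q) moncat \<Rightarrow> 'p \<Rightarrow>
   ('o, 'm, 'p, 'q) jmor \<Rightarrow> ('o, 'm, 'p, 'q) jmor \<Rightarrow> ('o \<Rightarrow> 'q) \<Rightarrow> bool" where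
  "two_mor C J D K = (\<lambda>(F, p) (G, q) s.
     one_mor C J D K (F, p) \<and> one_mor C J D K (G, q) \<and>
     monoidal_nat_trans C D F G s \<and> q \<cdot>\<^bsub>D\<^esub> s J = p \<and> s \<in> extensional (Obj C))"

definition jhom ::
  "('o, 'm) moncat \<Rightarrow> 'o \<Rightarrow> ('p, 'q) moncat \<Rightarrow> 'p \<Rightarrow>
   (('o, 'm, 'p, 'q) jmor, ('o, 'm, 'p, 'q) jmor \<times> ('o, 'm, 'p, 'q) jmor \<times> ('o \<Rightarrow> 'q)) cat" where
  "jhom C J D K =
     \<lparr>Obj = {F. one_mor C J D K F},
      Arr = {(F, G, s). two_mor C J D K F G s},
      Dom = (\<lambda>(F, G, s). F),
      Cod = (\<lambda>(F, G, s). G),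
      Idt = (\<lambda>F. (F, F, \<lambda>A \<in> Obj C. Idt D (ob_map (fst F) A))),
      Comp = (\<lambda>(G', H, t) (F, G, s). (F, H, \<lambda>A \<in> Obj C. t A \<cdot>\<^bsub>D\<^esub> s A))\<rparr>"

definition jid :: "('o, 'm) moncat \<Rightarrow> 'o \<Rightarrow> ('o, 'm, 'o, 'm) jmor" where
  "jid C J =
     (\<lparr>ob_map = (\<lambda>A \<in> Obj C. A), ar_map = (\<lambda>f \<in> Arr C. f),
       mult = (\<lambda>(A, B) \<in> Obj C \<times> Obj C. Idt C (A \<otimes>\<^bsub>C\<^esub> B)), unit_map = Idt C \<I>\<^bsub>C\<^esub>\<rparr>, Idt C J)"

text \<open>\<open>jcomp B X G F\<close> is the composite of 1-morphisms \<open>G\<close> after \<open>F\<close>, where \<open>B\<close> is the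
  source of \<open>F\<close> and \<open>X\<close> the target of \<open>G\<close>.\<close>

definition jcomp ::
  "('o, 'm) moncat \<Rightarrow> ('r, 's) moncat \<Rightarrow> ('p, 'q, 'r, 's) jmor \<Rightarrow> ('o, 'm, 'p, 'q) jmor \<Rightarrow>
   ('o, 'm, 'r, 's) jmor" where
  "jcomp B X = (\<lambda>(G, q) (F, p).
     (\<lparr>ob_map = (\<lambda>A \<in> Obj B. ob_map G (ob_map F A)),
       ar_map = (\<lambda>f \<in> Arr B. ar_map G (ar_map F f)),
       mult = (\<lambda>(A, A') \<in> Obj B \<times> Obj B.
          ar_map G (mult F (A, A')) \<cdot>\<^bsub>X\<^esub> mult G (ob_map F A, ob_map F A')),
       unit_map = ar_map G (unit_map F) \<cdot>\<^bsub>X\<^esub> unit_map G\<rparr>,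
      q \<cdot>\<^bsub>X\<^esub> ar_map G p))"

definition jequiv_via ::
  "('o, 'm) moncat \<Rightarrow> 'o \<Rightarrow> ('p, 'q) moncat \<Rightarrow> 'p \<Rightarrow>
   ('o, 'm, 'p, 'q) jmor \<Rightarrow> ('p, 'q, 'o, 'm) jmor \<Rightarrow> bool" where
  "jequiv_via C J D K F G \<longleftrightarrow> one_mor C J D K F \<and> one_mor D K C J G \<and>
     isomorphic (jhom C J C J) (jcomp C C G F) (jid C J) \<and>
     isomorphic (jhom D K D K) (jcomp D D F G) (jid D K)"

definition jequiv :: "('o, 'm) moncat \<Rightarrow> 'o \<Rightarrow> ('p, 'q) moncat \<Rightarrow> 'p \<Rightarrow> bool" where
  "jequiv C J D K \<longleftrightarrow> (\<exists>F G. jequiv_via C J D K F G)"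

text \<open>The sub-2-category on the objects with a right dual is full, so an equivalence there is an
  equivalence between two of its objects in the ambient 2-category.\<close>

definition jequiv_dual :: "('o, 'm) moncat \<Rightarrow> 'o \<Rightarrow> ('p, 'q) moncat \<Rightarrow> 'p \<Rightarrow> bool" where
  "jequiv_dual C J D K \<longleftrightarrow> in_Jdual C J \<and> in_Jdual D K \<and> jequiv C J D K"


section \<open>Bicategorical binary coproducts\<close>

definition jwhisker ::
  "('o, 'm) moncat \<Rightarrow> ('r, 's) moncat \<Rightarrow> ('o, 'm, 'p, 'q) jmor \<Rightarrow>
   ('p, 'q, 'r, 's) jmor \<times> ('p, 'q, 'r, 's) jmor \<times> ('p \<Rightarrow> 's) \<Rightarrow>
   ('o, 'm, 'r, 's) jmor \<times> ('o, 'm, 'r, 's) jmor \<times> ('o \<Rightarrow> 's)" where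
  "jwhisker B X i = (\<lambda>(F, G, s).
     (jcomp B X F i, jcomp B X G i, \<lambda>A \<in> Obj B. s (ob_map (fst i) A)))"

definition jrestrict ::
  "('o, 'm) moncat \<Rightarrow> ('a, 'b) moncat \<Rightarrow> ('r, 's) moncat \<Rightarrow>
   ('o, 'm, 'p, 'q) jmor \<Rightarrow> ('a, 'b, 'p, 'q) jmor \<Rightarrow>
   (('p, 'q, 'r, 's) jmor,
    ('p, 'q, 'r, 's) jmor \<times> ('p, 'q, 'r, 's) jmor \<times> ('p \<Rightarrow> 's),
    ('o, 'm, 'r, 's) jmor \<times> ('a, 'b, 'r, 's) jmor,
    (('o, 'm, 'r, 's) jmor \<times> ('o, 'm, 'r, 's) jmor \<times> ('o \<Rightarrow> 's)) \<times>
    (('a, 'b, 'r, 's) jmor \<times> ('a, 'b, 'r, 's) jmor \<times> ('a \<Rightarrow> 's))) cfun" where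
  "jrestrict D E X i k =
     \<lparr>ob_map = (\<lambda>F. (jcomp D X F i, jcomp E X F k)),
      ar_map = (\<lambda>s. (jwhisker D X i s, jwhisker E X k s))\<rparr>"

text \<open>\<open>jcoproduct T D M E N P L i k\<close>: the object \<open>(P, L)\<close> with coprojections
  \<open>i : (D, M) \<rightarrow> (P, L)\<close> and \<open>k : (E, N) \<rightarrow> (P, L)\<close> is a bicategorical coproduct, as tested on all
  pointed monoidal categories over the types named by \<open>T\<close>. HOL formulas cannot quantify over types;
  the unrestricted notion is obtained by letting \<open>T\<close> vary in the theorems that use it.\<close>

definition jcoproduct ::
  "('r, 's) moncat itself \<Rightarrow> ('o, 'm) moncat \<Rightarrow> 'o \<Rightarrow> ('a, 'b) moncat \<Rightarrow> 'a \<Rightarrow>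
   ('p, 'q) moncat \<Rightarrow> 'p \<Rightarrow> ('o, 'm, 'p, 'q) jmor \<Rightarrow> ('a, 'b, 'p, 'q) jmor \<Rightarrow> bool" where
  "jcoproduct T D M E N P L i k \<longleftrightarrow>
     one_mor D M P L i \<and> one_mor E N P L k \<and>
     (\<forall>(X :: ('r, 's) moncat) K. in_J X K \<longrightarrow>
        equivalence_functor (jhom P L X K) (prod_cat (jhom D M X K) (jhom E N X K))
          (jrestrict D E X i k))"


section \<open>The natural numbers as a discrete monoidal category\<close>

definition nat_cat :: "(nat, nat) moncat" where
  "nat_cat =
     \<lparr>Obj = UNIV, Arr = UNIV, Dom = (\<lambda>n. n), Cod = (\<lambda>n. n), Idt = (\<lambda>n. n), Comp = (\<lambda>n m. m),
      TenO = (+), TenA = (+), Unit = 0, Assoc = (\<lambda>k m n. k + m + n),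
      LUnit = (\<lambda>n. n), RUnit = (\<lambda>n. n)\<rparr>"


section \<open>Freely adjoining a right dual\<close>

text \<open>In this section \<open>C\<close> is meant to be strict; to adjoin a dual to an arbitrary \<open>(C, J)\<close>, replace
  it first by an equivalent strict one. A function \<open>U : [m] \<rightarrow> ob C\<close> is the list
  \<open>[U\<^sub>0, \<dots>, U\<^sub>m]\<close> of length \<open>m + 1\<close>.\<close>

definition dverts :: "('o, 'm) moncat \<Rightarrow> 'o list set" where
  "dverts C = {U. U \<noteq> [] \<and> set U \<subseteq> Obj C}"

definition dten :: "('o, 'm) moncat \<Rightarrow> 'o list \<Rightarrow> 'o list \<Rightarrow> 'o list" where
  "dten C U V = butlast U @ [last U \<otimes>\<^bsub>C\<^esub> hd V] @ tl V"

definition dunit :: "('o, 'm) moncat \<Rightarrow> 'o list" where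
  "dunit C = [\<I>\<^bsub>C\<^esub>]"

definition Jdual :: "('o, 'm) moncat \<Rightarrow> 'o list" where
  "Jdual C = [\<I>\<^bsub>C\<^esub>, \<I>\<^bsub>C\<^esub>]"

datatype 'm prim = Eps | Eta | Bar 'm

fun prim_src :: "('o, 'm) moncat \<Rightarrow> 'o \<Rightarrow> 'm prim \<Rightarrow> 'o list" where
  "prim_src C J Eps = dten C [J] (Jdual C)"
| "prim_src C J Eta = dunit C"
| "prim_src C J (Bar f) = [Dom C f]"

fun prim_tgt :: "('o, 'm) moncat \<Rightarrow> 'o \<Rightarrow> 'm prim \<Rightarrow> 'o list" where
  "prim_tgt C J Eps = dunit C"
| "prim_tgt C J Eta = dten C (Jdual C) [J]"
| "prim_tgt C J (Bar f) = [Cod C f]"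

text \<open>The triple \<open>(U, p, V)\<close> is the formal whiskering \<open>U \<otimes> p \<otimes> V\<close>.\<close>

type_synonym ('o, 'm) dedge = "'o list \<times> 'm prim \<times> 'o list"

definition dedges :: "('o, 'm) moncat \<Rightarrow> ('o, 'm) dedge set" where
  "dedges C = {(U, p, V). U \<in> dverts C \<and> V \<in> dverts C \<and> (\<forall>f. p = Bar f \<longrightarrow> f \<in> Arr C)}"

definition edge_src :: "('o, 'm) moncat \<Rightarrow> 'o \<Rightarrow> ('o, 'm) dedge \<Rightarrow> 'o list" where
  "edge_src C J = (\<lambda>(U, p, V). dten C (dten C U (prim_src C J p)) V)"

definition edge_tgt :: "('o, 'm) moncat \<Rightarrow> 'o \<Rightarrow> ('o, 'm) dedge \<Rightarrow> 'o list" where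
  "edge_tgt C J = (\<lambda>(U, p, V). dten C (dten C U (prim_tgt C J p)) V)"

definition prim_edge :: "('o, 'm) moncat \<Rightarrow> 'm prim \<Rightarrow> ('o, 'm) dedge" where
  "prim_edge C p = (dunit C, p, dunit C)"

definition whisk :: "('o, 'm) moncat \<Rightarrow> 'o list \<Rightarrow> ('o, 'm) dedge \<Rightarrow> 'o list \<Rightarrow> ('o, 'm) dedge" where
  "whisk C T = (\<lambda>(U, p, V) W. (dten C T U, p, dten C V W))"

definition whisk_path ::
  "('o, 'm) moncat \<Rightarrow> 'o list \<Rightarrow> ('o, 'm) dedge list \<Rightarrow> 'o list \<Rightarrow> ('o, 'm) dedge list" where
  "whisk_path C T es W = map (\<lambda>e. whisk C T e W) es"

text \<open>A path is the list of its edges in the order in which they are traversed, so the arrow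
  \<open>b a\<close> of the free category is the list \<open>[a, b]\<close>.\<close>

fun dpath :: "('o, 'm) moncat \<Rightarrow> 'o \<Rightarrow> 'o list \<Rightarrow> ('o, 'm) dedge list \<Rightarrow> 'o list \<Rightarrow> bool" where
  "dpath C J U [] V \<longleftrightarrow> U \<in> dverts C \<and> U = V"
| "dpath C J U (e # es) V \<longleftrightarrow> e \<in> dedges C \<and> edge_src C J e = U \<and> dpath C J (edge_tgt C J e) es V"

text \<open>\<open>base_rel C J U es es' V\<close>: the paths \<open>es\<close> and \<open>es'\<close> from \<open>U\<close> to \<open>V\<close> are the two sides of one
  of the relations that generate the congruence, before closure under whiskering.\<close>

inductive base_rel ::
  "('o, 'm) moncat \<Rightarrow> 'o \<Rightarrow> 'o list \<Rightarrow> ('o, 'm) dedge list \<Rightarrow> ('o, 'm) dedge list \<Rightarrow> 'o list \<Rightarrow> bool"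
  for C :: "('o, 'm) moncat" and J :: 'o where
  bar_whisk: "\<lbrakk>E \<in> Obj C; F \<in> Obj C; f \<in> Hom C A B\<rbrakk> \<Longrightarrow>
     base_rel C J [E \<otimes>\<^bsub>C\<^esub> A \<otimes>\<^bsub>C\<^esub> F]
       [prim_edge C (Bar (Idt C E \<boxtimes>\<^bsub>C\<^esub> f \<boxtimes>\<^bsub>C\<^esub> Idt C F))]
       [whisk C [E] (prim_edge C (Bar f)) [F]]
       [E \<otimes>\<^bsub>C\<^esub> B \<otimes>\<^bsub>C\<^esub> F]"
| bar_idt: "A \<in> Obj C \<Longrightarrow> base_rel C J [A] [prim_edge C (Bar (Idt C A))] [] [A]"
| bar_comp: "\<lbrakk>f \<in> Hom C A B; g \<in> Hom C B D\<rbrakk> \<Longrightarrow>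
     base_rel C J [A] [prim_edge C (Bar (g \<cdot>\<^bsub>C\<^esub> f))]
       [prim_edge C (Bar f), prim_edge C (Bar g)] [D]"
| interchange: "\<lbrakk>a \<in> dedges C; b \<in> dedges C;
      U = edge_src C J a; V = edge_tgt C J a; W = edge_src C J b; X = edge_tgt C J b\<rbrakk> \<Longrightarrow>
     base_rel C J (dten C U W)
       [whisk C (dunit C) a W, whisk C V b (dunit C)]
       [whisk C U b (dunit C), whisk C (dunit C) a X]
       (dten C V X)"
| triangle_J: "base_rel C J [J]
       [whisk C [J] (prim_edge C Eta) (dunit C), whisk C (dunit C) (prim_edge C Eps) [J]]
       [] [J]"
| triangle_Jdual: "base_rel C J (Jdual C)
       [whisk C (dunit C) (prim_edge C Eta) (Jdual C), whisk C (Jdual C) (prim_edge C Eps) (dunit C)]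
       [] (Jdual C)"

inductive dcong ::
  "('o, 'm) moncat \<Rightarrow> 'o \<Rightarrow> 'o list \<Rightarrow> ('o, 'm) dedge list \<Rightarrow> ('o, 'm) dedge list \<Rightarrow> 'o list \<Rightarrow> bool"
  for C :: "('o, 'm) moncat" and J :: 'o where
  base: "base_rel C J U es es' V \<Longrightarrow> dcong C J U es es' V"
| whisker: "\<lbrakk>base_rel C J U es es' V; Y \<in> dverts C; Z \<in> dverts C\<rbrakk> \<Longrightarrow>
     dcong C J (dten C (dten C Y U) Z) (whisk_path C Y es Z) (whisk_path C Y es' Z)
       (dten C (dten C Y V) Z)"
| refl: "dpath C J U es V \<Longrightarrow> dcong C J U es es V"
| sym: "dcong C J U es es' V \<Longrightarrow> dcong C J U es' es V"
| trans: "\<lbrakk>dcong C J U es es' V; dcong C J U es' es'' V\<rbrakk> \<Longrightarrow> dcong C J U es es'' V"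
| append: "\<lbrakk>dcong C J U es es' V; dcong C J V fs fs' W\<rbrakk> \<Longrightarrow> dcong C J U (es @ fs) (es' @ fs') W"

text \<open>An arrow of \<open>C[J\<^sup>\<or>]\<close> is \<open>(U, V, c)\<close> with \<open>c\<close> a congruence class of paths from \<open>U\<close> to \<open>V\<close>.\<close>

type_synonym ('o, 'm) darr = "'o list \<times> 'o list \<times> ('o, 'm) dedge list set"

definition dclass ::
  "('o, 'm) moncat \<Rightarrow> 'o \<Rightarrow> 'o list \<Rightarrow> ('o, 'm) dedge list \<Rightarrow> 'o list \<Rightarrow> ('o, 'm) darr" where
  "dclass C J U es V = (U, V, {es'. dcong C J U es es' V})"

definition darr_comp ::
  "('o, 'm) moncat \<Rightarrow> 'o \<Rightarrow> ('o, 'm) darr \<Rightarrow> ('o, 'm) darr \<Rightarrow> ('o, 'm) darr" where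
  "darr_comp C J = (\<lambda>(V', W, d) (U, V, c).
     (U, W, {hs. \<exists>es \<in> c. \<exists>fs \<in> d. dcong C J U (es @ fs) hs W}))"

text \<open>The tensor of the classes of \<open>a : U \<rightarrow> V\<close> and \<open>b : W \<rightarrow> X\<close> is the class of
  \<open>(V \<otimes> b) (a \<otimes> W)\<close>.\<close>

definition darr_ten ::
  "('o, 'm) moncat \<Rightarrow> 'o \<Rightarrow> ('o, 'm) darr \<Rightarrow> ('o, 'm) darr \<Rightarrow> ('o, 'm) darr" where
  "darr_ten C J = (\<lambda>(U, V, c) (W, X, d).
     (dten C U W, dten C V X,
      {hs. \<exists>es \<in> c. \<exists>fs \<in> d. dcong C J (dten C U W)
         (whisk_path C (dunit C) es W @ whisk_path C V fs (dunit C)) hs (dten C V X)}))"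

definition adjoin_dual :: "('o, 'm) moncat \<Rightarrow> 'o \<Rightarrow> ('o list, ('o, 'm) darr) moncat" where
  "adjoin_dual C J =
     \<lparr>Obj = dverts C,
      Arr = {dclass C J U es V | U es V. dpath C J U es V},
      Dom = (\<lambda>(U, V, c). U),
      Cod = (\<lambda>(U, V, c). V),
      Idt = (\<lambda>U. dclass C J U [] U),
      Comp = darr_comp C J,
      TenO = dten C,
      TenA = darr_ten C J,
      Unit = dunit C,
      Assoc = (\<lambda>U V W. dclass C J (dten C U (dten C V W)) [] (dten C U (dten C V W))),
      LUnit = (\<lambda>U. dclass C J U [] U),
      RUnit = (\<lambda>U. dclass C J U [] U)\<rparr>"

end

theory Submission
  imports Defs
begin

text \<open>A 1-morphism out of \<open>C[J\<^sup>\<or>]\<close> is the same as one out of \<open>C\<close> whose target has a right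
  dual of the distinguished object, and 2-morphisms extend uniquely: their component at \<open>J\<^sup>\<or>\<close> has to
  be the mate of the inverse of the component at \<open>J\<close>, and the other components are tensor words in
  these. For \<open>C = \<nat>\<close> this shows that the 1-morphisms from \<open>\<nat>[1\<^sup>\<or>]\<close> to \<open>(X, K)\<close> form a contractible
  groupoid when \<open>K\<close> has a right dual, and do not exist otherwise. So \<open>C[J\<^sup>\<or>]\<close> has the universal property
  of the coproduct, and coproducts are unique up to equivalence.\<close>

section \<open>Inverses and coherence in monoidal categories\<close>

lemma in_Hom [simp]: "f \<in> Hom C A B \<longleftrightarrow> f \<in> Arr C \<and> Dom C f = A \<and> Cod C f = B"
  by (auto simp: Hom_def)

lemma inverse_arrsD:
  assumes "inverse_arrs C f g"
  shows "f \<in> Arr C" "g \<in> Arr C" "Dom C g = Cod C f" "Cod C g = Dom C f"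
    "g \<cdot>\<^bsub>C\<^esub> f = Idt C (Dom C f)" "f \<cdot>\<^bsub>C\<^esub> g = Idt C (Cod C f)"
  using assms by (auto simp: inverse_arrs_def)

lemma iso_arr: "is_iso C f \<Longrightarrow> f \<in> Arr C"
  by (auto simp: is_iso_def inverse_arrs_def)

context category
begin

lemma dom_in_obj [simp]: "f \<in> Arr C \<Longrightarrow> Dom C f \<in> Obj C"
  and cod_in_obj [simp]: "f \<in> Arr C \<Longrightarrow> Cod C f \<in> Obj C"
  by (simp_all add: dom_obj cod_obj)

lemma comp_arr [simp]:
  assumes "f \<in> Arr C" "g \<in> Arr C" "Dom C g = Cod C f"
  shows "g \<cdot> f \<in> Arr C" "Dom C (g \<cdot> f) = Dom C f" "Cod C (g \<cdot> f) = Cod C g"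
  using comp_hom[of f "Dom C f" "Cod C f" g "Cod C g"] assms by auto

lemma idt_arr [simp]:
  assumes "A \<in> Obj C"
  shows "Idt C A \<in> Arr C" "Dom C (Idt C A) = A" "Cod C (Idt C A) = A"
  using idt_hom[of A] assms by auto

lemma comp_idt_right [simp]: "\<lbrakk>f \<in> Arr C; Dom C f = A\<rbrakk> \<Longrightarrow> f \<cdot> Idt C A = f"
  and comp_idt_left [simp]: "\<lbrakk>f \<in> Arr C; Cod C f = A\<rbrakk> \<Longrightarrow> Idt C A \<cdot> f = f"
  using comp_idt[of f "Dom C f" "Cod C f"] idt_comp[of f "Dom C f" "Cod C f"] by auto

lemma comp_assoc_right [simp]:
  assumes "f \<in> Arr C" "g \<in> Arr C" "h \<in> Arr C" "Dom C g = Cod C f" "Dom C h = Cod C g"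
  shows "(h \<cdot> g) \<cdot> f = h \<cdot> (g \<cdot> f)"
  using comp_assoc[of f "Dom C f" "Cod C f" g "Cod C g" h "Cod C h"] assms by auto

lemma reassoc:
  assumes "g \<cdot> f = k" "f \<in> Arr C" "g \<in> Arr C" "z \<in> Arr C" "Dom C g = Cod C f" "Dom C f = Cod C z"
  shows "g \<cdot> (f \<cdot> z) = k \<cdot> z"
  using assms comp_assoc_right[of z f g] by simp

lemma reassoc4:
  assumes "g \<cdot> f = k \<cdot> l" "f \<in> Arr C" "g \<in> Arr C" "z \<in> Arr C" "Dom C g = Cod C f" "Dom C f = Cod C z"
    "k \<in> Arr C" "l \<in> Arr C" "Dom C k = Cod C l" "Dom C l = Cod C z"
  shows "g \<cdot> (f \<cdot> z) = k \<cdot> (l \<cdot> z)"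
  using assms comp_assoc_right[of z f g] comp_assoc_right[of z l k] by simp

lemma inverse_unique:
  assumes "inverse_arrs C f g" "inverse_arrs C f h"
  shows "g = h"
proof -
  note g = inverse_arrsD[OF assms(1)] and h = inverse_arrsD[OF assms(2)]
  have "g = g \<cdot> (f \<cdot> h)" using g h by simp
  also have "\<dots> = Idt C (Dom C f) \<cdot> h" using g h by (intro reassoc) auto
  also have "\<dots> = h" using g h by simp
  finally show ?thesis .
qed

lemma inv_arr_eq: "inverse_arrs C f g \<Longrightarrow> inv_arr C f = g"
  unfolding inv_arr_def by (rule the_equality) (auto intro: inverse_unique)

lemma inverse_arrs_inv: "is_iso C f \<Longrightarrow> inverse_arrs C f (inv_arr C f)"
  using inv_arr_eq unfolding is_iso_def by metis

lemma inv_arr [simp]: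
  assumes "is_iso C f"
  shows "inv_arr C f \<in> Arr C" "Dom C (inv_arr C f) = Cod C f" "Cod C (inv_arr C f) = Dom C f"
    "inv_arr C f \<cdot> f = Idt C (Dom C f)" "f \<cdot> inv_arr C f = Idt C (Cod C f)"
  using inverse_arrsD[OF inverse_arrs_inv[OF assms]] by auto

lemma inv_cancel [simp]:
  assumes "is_iso C f" "z \<in> Arr C"
  shows "Cod C z = Dom C f \<Longrightarrow> inv_arr C f \<cdot> (f \<cdot> z) = z"
    "Cod C z = Cod C f \<Longrightarrow> f \<cdot> (inv_arr C f \<cdot> z) = z"
  using assms iso_arr[OF assms(1)] by (simp_all flip: comp_assoc_right)

lemma inverse_arrsI:
  assumes "f \<in> Arr C" "g \<in> Arr C" "Dom C g = Cod C f" "Cod C g = Dom C f"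
    "g \<cdot> f = Idt C (Dom C f)" "f \<cdot> g = Idt C (Cod C f)"
  shows "inverse_arrs C f g"
  using assms by (simp add: inverse_arrs_def)

lemma iso_inv [simp]: "is_iso C f \<Longrightarrow> is_iso C (inv_arr C f)"
  and inv_inv [simp]: "is_iso C f \<Longrightarrow> inv_arr C (inv_arr C f) = f"
proof -
  assume f: "is_iso C f"
  have "inverse_arrs C (inv_arr C f) f"
    using f iso_arr[OF f] by (intro inverse_arrsI) auto
  then show "is_iso C (inv_arr C f)" "inv_arr C (inv_arr C f) = f"
    by (auto simp: is_iso_def inv_arr_eq)
qed

lemma iso_idt [simp]: "A \<in> Obj C \<Longrightarrow> is_iso C (Idt C A)"
  and inv_idt [simp]: "A \<in> Obj C \<Longrightarrow> inv_arr C (Idt C A) = Idt C A"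
proof -
  assume "A \<in> Obj C"
  then have "inverse_arrs C (Idt C A) (Idt C A)" by (intro inverse_arrsI) auto
  then show "is_iso C (Idt C A)" "inv_arr C (Idt C A) = Idt C A"
    by (auto simp: is_iso_def inv_arr_eq)
qed

lemma iso_comp:
  assumes "is_iso C f" "is_iso C g" "Dom C g = Cod C f"
  shows "is_iso C (g \<cdot> f)" "inv_arr C (g \<cdot> f) = inv_arr C f \<cdot> inv_arr C g"
proof -
  have "inverse_arrs C (g \<cdot> f) (inv_arr C f \<cdot> inv_arr C g)"
    using assms iso_arr[OF assms(1)] iso_arr[OF assms(2)] by (intro inverse_arrsI) auto
  then show "is_iso C (g \<cdot> f)" "inv_arr C (g \<cdot> f) = inv_arr C f \<cdot> inv_arr C g"
    by (auto simp: is_iso_def inv_arr_eq)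
qed

lemma iso_cancel_left:
  assumes "is_iso C f" "f \<cdot> x = f \<cdot> y" "x \<in> Arr C" "y \<in> Arr C" "Cod C x = Dom C f" "Cod C y = Dom C f"
  shows "x = y"
  using inv_cancel(1)[OF assms(1,3,5)] inv_cancel(1)[OF assms(1,4,6)] assms(2) by metis

lemma iso_cancel_right:
  assumes "is_iso C f" "x \<cdot> f = y \<cdot> f" "x \<in> Arr C" "y \<in> Arr C" "Cod C f = Dom C x" "Cod C f = Dom C y"
  shows "x = y"
proof -
  have "x = (x \<cdot> f) \<cdot> inv_arr C f" using assms(1,3,5) iso_arr[OF assms(1)] by simp
  also have "\<dots> = (y \<cdot> f) \<cdot> inv_arr C f" by (simp only: assms(2))
  also have "\<dots> = y" using assms(1,4,6) iso_arr[OF assms(1)] by simp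
  finally show ?thesis .
qed

lemma iso_move_left:
  assumes "is_iso C f" "f \<cdot> x = y" "x \<in> Arr C" "Cod C x = Dom C f"
  shows "x = inv_arr C f \<cdot> y"
  using assms by auto

lemma iso_move_right:
  assumes "is_iso C f" "x \<cdot> f = y" "x \<in> Arr C" "Cod C f = Dom C x"
  shows "x = y \<cdot> inv_arr C f"
  using assms iso_arr[OF assms(1)] by auto

lemma inv_square:
  assumes "is_iso C a" "is_iso C b" "y \<cdot> a = b \<cdot> x" "x \<in> Arr C" "y \<in> Arr C"
    "Dom C y = Cod C a" "Cod C x = Dom C b" "Dom C x = Dom C a" "Cod C y = Cod C b"
  shows "x \<cdot> inv_arr C a = inv_arr C b \<cdot> y"
proof -
  have "b \<cdot> (x \<cdot> inv_arr C a) = (b \<cdot> x) \<cdot> inv_arr C a"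
    using assms(1,2,4-) iso_arr[OF assms(2)] by simp
  also have "\<dots> = (y \<cdot> a) \<cdot> inv_arr C a" by (simp only: assms(3))
  also have "\<dots> = b \<cdot> (inv_arr C b \<cdot> y)"
    using assms(1,2,4-) iso_arr[OF assms(1)] iso_arr[OF assms(2)] by simp
  finally show ?thesis by (rule iso_cancel_left[OF assms(2)]) (use assms(1,2,4-) in auto)
qed

lemma isomorphicI: "\<lbrakk>is_iso C f; Dom C f = A; Cod C f = B\<rbrakk> \<Longrightarrow> isomorphic C A B"
  unfolding isomorphic_def by (rule bexI[of _ f]) (auto intro: iso_arr)

lemma isomorphicE:
  assumes "isomorphic C A B"
  obtains f where "is_iso C f" "f \<in> Arr C" "Dom C f = A" "Cod C f = B"
  using assms unfolding isomorphic_def by auto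

lemma isomorphic_sym: "isomorphic C A B \<Longrightarrow> isomorphic C B A"
  by (metis inv_arr(2,3) isomorphicI isomorphicE iso_inv)

lemma isomorphic_trans: "\<lbrakk>isomorphic C A B; isomorphic C B D\<rbrakk> \<Longrightarrow> isomorphic C A D"
  by (metis comp_arr(2,3) iso_arr iso_comp(1) isomorphicE isomorphicI)

end

context monoidal_category
begin

lemma unit_in_obj [simp]: "\<I> \<in> Obj C" by (rule unit_obj)

lemma ten_in_obj [simp]: "\<lbrakk>A \<in> Obj C; B \<in> Obj C\<rbrakk> \<Longrightarrow> A \<otimes> B \<in> Obj C" by (rule ten_obj)

lemma ten_arr [simp]:
  assumes "f \<in> Arr C" "g \<in> Arr C"
  shows "f \<boxtimes> g \<in> Arr C" "Dom C (f \<boxtimes> g) = Dom C f \<otimes> Dom C g" "Cod C (f \<boxtimes> g) = Cod C f \<otimes> Cod C g"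
  using ten_hom[of f "Dom C f" "Cod C f" g "Dom C g" "Cod C g"] assms by auto

lemma assoc_arr [simp]:
  assumes "A \<in> Obj C" "B \<in> Obj C" "D \<in> Obj C"
  shows "Assoc C A B D \<in> Arr C" "Dom C (Assoc C A B D) = (A \<otimes> B) \<otimes> D"
    "Cod C (Assoc C A B D) = A \<otimes> (B \<otimes> D)" "is_iso C (Assoc C A B D)"
  using assoc_hom assoc_iso assms by auto

lemma lunit_arr [simp]:
  assumes "A \<in> Obj C"
  shows "LUnit C A \<in> Arr C" "Dom C (LUnit C A) = \<I> \<otimes> A" "Cod C (LUnit C A) = A" "is_iso C (LUnit C A)"
  using lunit_hom lunit_iso assms by auto

lemma runit_arr [simp]:
  assumes "A \<in> Obj C"
  shows "RUnit C A \<in> Arr C" "Dom C (RUnit C A) = A \<otimes> \<I>" "Cod C (RUnit C A) = A" "is_iso C (RUnit C A)"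
  using runit_hom runit_iso assms by auto

lemma ten_idt_idt [simp]: "\<lbrakk>A \<in> Obj C; B \<in> Obj C\<rbrakk> \<Longrightarrow> Idt C A \<boxtimes> Idt C B = Idt C (A \<otimes> B)"
  by (rule ten_idt)

lemma ten_merge:
  assumes "f \<in> Arr C" "g \<in> Arr C" "f' \<in> Arr C" "g' \<in> Arr C" "Dom C g = Cod C f" "Dom C g' = Cod C f'"
  shows "(g \<boxtimes> g') \<cdot> (f \<boxtimes> f') = (g \<cdot> f) \<boxtimes> (g' \<cdot> f')"
  using ten_comp[of f "Dom C f" "Cod C f" g "Cod C g" f' "Dom C f'" "Cod C f'" g' "Cod C g'"] assms
  by simp

lemma ten_merge_assoc:
  assumes "f \<in> Arr C" "g \<in> Arr C" "f' \<in> Arr C" "g' \<in> Arr C" "Dom C g = Cod C f" "Dom C g' = Cod C f'"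
    "z \<in> Arr C" "Cod C z = Dom C f \<otimes> Dom C f'"
  shows "(g \<boxtimes> g') \<cdot> ((f \<boxtimes> f') \<cdot> z) = ((g \<cdot> f) \<boxtimes> (g' \<cdot> f')) \<cdot> z"
  using assms ten_merge[OF assms(1-6)] by (simp flip: comp_assoc_right)

lemmas merge = ten_merge ten_merge_assoc

lemma iso_ten:
  assumes "is_iso C f" "is_iso C g"
  shows "is_iso C (f \<boxtimes> g)" "inv_arr C (f \<boxtimes> g) = inv_arr C f \<boxtimes> inv_arr C g"
proof -
  have "inverse_arrs C (f \<boxtimes> g) (inv_arr C f \<boxtimes> inv_arr C g)"
    using assms iso_arr[OF assms(1)] iso_arr[OF assms(2)] by (intro inverse_arrsI) (auto simp: merge)
  then show "is_iso C (f \<boxtimes> g)" "inv_arr C (f \<boxtimes> g) = inv_arr C f \<boxtimes> inv_arr C g"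
    by (auto simp: is_iso_def inv_arr_eq)
qed

lemma assoc_natural:
  assumes "f \<in> Arr C" "g \<in> Arr C" "h \<in> Arr C" "Dom C f = A" "Dom C g = B" "Dom C h = D"
  shows "(f \<boxtimes> (g \<boxtimes> h)) \<cdot> Assoc C A B D = Assoc C (Cod C f) (Cod C g) (Cod C h) \<cdot> ((f \<boxtimes> g) \<boxtimes> h)"
  using assoc_nat[of f A "Cod C f" g B "Cod C g" h D "Cod C h"] assms by simp

lemma assoc_inv_natural:
  assumes "f \<in> Arr C" "g \<in> Arr C" "h \<in> Arr C" "Dom C f = A" "Dom C g = B" "Dom C h = D"
  shows "((f \<boxtimes> g) \<boxtimes> h) \<cdot> inv_arr C (Assoc C A B D)
    = inv_arr C (Assoc C (Cod C f) (Cod C g) (Cod C h)) \<cdot> (f \<boxtimes> (g \<boxtimes> h))"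
  using assms by (intro inv_square assoc_natural) auto

lemma lunit_natural:
  assumes "f \<in> Arr C" "Dom C f = A"
  shows "f \<cdot> LUnit C A = LUnit C (Cod C f) \<cdot> (Idt C \<I> \<boxtimes> f)"
  using lunit_nat[of f A "Cod C f"] assms by simp

lemma runit_natural:
  assumes "f \<in> Arr C" "Dom C f = A"
  shows "f \<cdot> RUnit C A = RUnit C (Cod C f) \<cdot> (f \<boxtimes> Idt C \<I>)"
  using runit_nat[of f A "Cod C f"] assms by simp

lemma lunit_inv_natural:
  assumes "f \<in> Arr C" "Dom C f = A"
  shows "(Idt C \<I> \<boxtimes> f) \<cdot> inv_arr C (LUnit C A) = inv_arr C (LUnit C (Cod C f)) \<cdot> f"
  using assms by (intro inv_square lunit_natural) auto

lemma runit_inv_natural: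
  assumes "f \<in> Arr C" "Dom C f = A"
  shows "(f \<boxtimes> Idt C \<I>) \<cdot> inv_arr C (RUnit C A) = inv_arr C (RUnit C (Cod C f)) \<cdot> f"
  using assms by (intro inv_square runit_natural) auto

lemma assoc_natural_rev:
  assumes "f \<in> Arr C" "g \<in> Arr C" "h \<in> Arr C" "Cod C f = A" "Cod C g = B" "Cod C h = D"
  shows "Assoc C A B D \<cdot> ((f \<boxtimes> g) \<boxtimes> h) = (f \<boxtimes> (g \<boxtimes> h)) \<cdot> Assoc C (Dom C f) (Dom C g) (Dom C h)"
  using assoc_natural[OF assms(1-3) HOL.refl HOL.refl HOL.refl] assms by simp

lemma assoc_inv_natural_rev:
  assumes "f \<in> Arr C" "g \<in> Arr C" "h \<in> Arr C" "Cod C f = A" "Cod C g = B" "Cod C h = D"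
  shows "inv_arr C (Assoc C A B D) \<cdot> (f \<boxtimes> (g \<boxtimes> h))
    = ((f \<boxtimes> g) \<boxtimes> h) \<cdot> inv_arr C (Assoc C (Dom C f) (Dom C g) (Dom C h))"
  using assoc_inv_natural[OF assms(1-3) HOL.refl HOL.refl HOL.refl] assms by simp

lemma lunit_natural_rev:
  assumes "f \<in> Arr C" "Cod C f = A"
  shows "LUnit C A \<cdot> (Idt C \<I> \<boxtimes> f) = f \<cdot> LUnit C (Dom C f)"
  using lunit_natural[OF assms(1) HOL.refl] assms(2) by simp

lemma runit_natural_rev:
  assumes "f \<in> Arr C" "Cod C f = A"
  shows "RUnit C A \<cdot> (f \<boxtimes> Idt C \<I>) = f \<cdot> RUnit C (Dom C f)"
  using runit_natural[OF assms(1) HOL.refl] assms(2) by simp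

lemma unit_ten_faithful:
  assumes "Idt C \<I> \<boxtimes> f = Idt C \<I> \<boxtimes> g" "f \<in> Arr C" "g \<in> Arr C" "Dom C f = Dom C g" "Cod C f = Cod C g"
  shows "f = g"
proof -
  have "f \<cdot> LUnit C (Dom C f) = g \<cdot> LUnit C (Dom C f)"
    using lunit_natural[of f] lunit_natural[of g] assms by simp
  then show ?thesis using assms by (intro iso_cancel_right[of "LUnit C (Dom C f)" f g]) auto
qed

lemma ten_unit_faithful:
  assumes "f \<boxtimes> Idt C \<I> = g \<boxtimes> Idt C \<I>" "f \<in> Arr C" "g \<in> Arr C" "Dom C f = Dom C g" "Cod C f = Cod C g"
  shows "f = g"
proof -
  have "f \<cdot> RUnit C (Dom C f) = g \<cdot> RUnit C (Dom C f)"
    using runit_natural[of f] runit_natural[of g] assms by simp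
  then show ?thesis using assms by (intro iso_cancel_right[of "RUnit C (Dom C f)" f g]) auto
qed

lemma lunit_ten:
  assumes A: "A \<in> Obj C" and B: "B \<in> Obj C"
  shows "LUnit C (A \<otimes> B) \<cdot> Assoc C \<I> A B = LUnit C A \<boxtimes> Idt C B"
proof -
  let ?w = "Assoc C \<I> (\<I> \<otimes> A) B \<cdot> (Assoc C \<I> \<I> A \<boxtimes> Idt C B)"
  have "(Idt C \<I> \<boxtimes> (LUnit C (A \<otimes> B) \<cdot> Assoc C \<I> A B)) \<cdot> ?w
    = (Idt C \<I> \<boxtimes> LUnit C (A \<otimes> B)) \<cdot> ((Idt C \<I> \<boxtimes> Assoc C \<I> A B) \<cdot> ?w)"
    using A B by (simp add: merge)
  also have "\<dots> = (Idt C \<I> \<boxtimes> LUnit C (A \<otimes> B)) \<cdot> (Assoc C \<I> \<I> (A \<otimes> B) \<cdot> Assoc C (\<I> \<otimes> \<I>) A B)"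
    using A B pentagon[of \<I> \<I> A B] by simp
  also have "\<dots> = (RUnit C \<I> \<boxtimes> (Idt C A \<boxtimes> Idt C B)) \<cdot> Assoc C (\<I> \<otimes> \<I>) A B"
    using A B triangle[of \<I> "A \<otimes> B"] by (simp flip: comp_assoc_right)
  also have "\<dots> = Assoc C \<I> A B \<cdot> ((RUnit C \<I> \<boxtimes> Idt C A) \<boxtimes> Idt C B)"
    using A B by (subst assoc_natural) auto
  also have "\<dots> = Assoc C \<I> A B \<cdot> (((Idt C \<I> \<boxtimes> LUnit C A) \<boxtimes> Idt C B) \<cdot> (Assoc C \<I> \<I> A \<boxtimes> Idt C B))"
    using A B triangle[of \<I> A] by (simp add: merge)
  also have "\<dots> = (Idt C \<I> \<boxtimes> (LUnit C A \<boxtimes> Idt C B)) \<cdot> ?w"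
    using A B by (simp add: reassoc4[OF assoc_natural])
  finally have "Idt C \<I> \<boxtimes> (LUnit C (A \<otimes> B) \<cdot> Assoc C \<I> A B) = Idt C \<I> \<boxtimes> (LUnit C A \<boxtimes> Idt C B)"
    by (rule iso_cancel_right[rotated]) (use A B in \<open>auto simp: iso_comp iso_ten\<close>)
  then show ?thesis by (rule unit_ten_faithful) (use A B in auto)
qed

lemma runit_ten:
  assumes A: "A \<in> Obj C" and B: "B \<in> Obj C"
  shows "(Idt C A \<boxtimes> RUnit C B) \<cdot> Assoc C A B \<I> = RUnit C (A \<otimes> B)"
proof -
  have "Assoc C A B \<I> \<cdot> (((Idt C A \<boxtimes> RUnit C B) \<cdot> Assoc C A B \<I>) \<boxtimes> Idt C \<I>)
    = Assoc C A B \<I> \<cdot> (((Idt C A \<boxtimes> RUnit C B) \<boxtimes> Idt C \<I>) \<cdot> (Assoc C A B \<I> \<boxtimes> Idt C \<I>))"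
    using A B by (simp add: merge)
  also have "\<dots> = (Idt C A \<boxtimes> (RUnit C B \<boxtimes> Idt C \<I>)) \<cdot> (Assoc C A (B \<otimes> \<I>) \<I> \<cdot> (Assoc C A B \<I> \<boxtimes> Idt C \<I>))"
    using A B by (simp add: reassoc4[OF assoc_natural])
  also have "\<dots> = (Idt C A \<boxtimes> (Idt C B \<boxtimes> LUnit C \<I>)) \<cdot> ((Idt C A \<boxtimes> Assoc C B \<I> \<I>)
      \<cdot> (Assoc C A (B \<otimes> \<I>) \<I> \<cdot> (Assoc C A B \<I> \<boxtimes> Idt C \<I>)))"
    using A B triangle[of B \<I>] by (simp add: merge)
  also have "\<dots> = (Idt C A \<boxtimes> (Idt C B \<boxtimes> LUnit C \<I>)) \<cdot> (Assoc C A B (\<I> \<otimes> \<I>) \<cdot> Assoc C (A \<otimes> B) \<I> \<I>)"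
    using A B pentagon[of A B \<I> \<I>] by simp
  also have "\<dots> = Assoc C A B \<I> \<cdot> (((Idt C A \<boxtimes> Idt C B) \<boxtimes> LUnit C \<I>) \<cdot> Assoc C (A \<otimes> B) \<I> \<I>)"
    using A B by (subst reassoc4[OF assoc_natural]) auto
  also have "\<dots> = Assoc C A B \<I> \<cdot> (RUnit C (A \<otimes> B) \<boxtimes> Idt C \<I>)"
    using A B triangle[of "A \<otimes> B" \<I>] by simp
  finally have "((Idt C A \<boxtimes> RUnit C B) \<cdot> Assoc C A B \<I>) \<boxtimes> Idt C \<I> = RUnit C (A \<otimes> B) \<boxtimes> Idt C \<I>"
    by (rule iso_cancel_left[rotated]) (use A B in auto)
  then show ?thesis by (rule ten_unit_faithful) (use A B in auto)
qed

lemma lunit_unit: "LUnit C \<I> = RUnit C \<I>"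
proof -
  have "LUnit C (\<I> \<otimes> \<I>) = Idt C \<I> \<boxtimes> LUnit C \<I>"
    by (rule iso_cancel_left[of "LUnit C \<I>"]) (auto simp: lunit_natural)
  then have "LUnit C \<I> \<boxtimes> Idt C \<I> = RUnit C \<I> \<boxtimes> Idt C \<I>"
    using lunit_ten[of \<I> \<I>] triangle[of \<I> \<I>] by simp
  then show ?thesis by (rule ten_unit_faithful) auto
qed

end

context is_functor
begin

lemma functor_obj [simp]: "A \<in> Obj C \<Longrightarrow> ob_map F A \<in> Obj D"
  by (rule ob_map_obj)

lemma functor_arr [simp]:
  assumes "f \<in> Arr C"
  shows "ar_map F f \<in> Arr D" "Dom D (ar_map F f) = ob_map F (Dom C f)" "Cod D (ar_map F f) = ob_map F (Cod C f)"
  using ar_map_hom[of f "Dom C f" "Cod C f"] assms by auto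

lemma functor_comp [simp]:
  "\<lbrakk>f \<in> Arr C; g \<in> Arr C; Dom C g = Cod C f\<rbrakk> \<Longrightarrow> ar_map F (g \<cdot>\<^bsub>C\<^esub> f) = ar_map F g \<cdot>\<^bsub>D\<^esub> ar_map F f"
  using ar_map_comp[of f "Dom C f" "Cod C f" g "Cod C g"] by simp

lemma functor_idt [simp]: "A \<in> Obj C \<Longrightarrow> ar_map F (Idt C A) = Idt D (ob_map F A)"
  by (rule ar_map_idt)

lemma functor_iso:
  assumes "is_iso C f"
  shows "is_iso D (ar_map F f)" "inv_arr D (ar_map F f) = ar_map F (inv_arr C f)"
proof -
  have "inverse_arrs D (ar_map F f) (ar_map F (inv_arr C f))"
    using assms iso_arr[OF assms] by (intro cod.inverse_arrsI) (simp_all flip: functor_comp)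
  then show "is_iso D (ar_map F f)" "inv_arr D (ar_map F f) = ar_map F (inv_arr C f)"
    by (auto simp: is_iso_def cod.inv_arr_eq)
qed

lemma functor_isomorphic: "isomorphic C A B \<Longrightarrow> isomorphic D (ob_map F A) (ob_map F B)"
  by (metis cod.isomorphicI dom.isomorphicE functor_arr(2,3) functor_iso(1))

end

context strong_monoidal_functor
begin

lemma mult_arr [simp]:
  assumes "A \<in> Obj C" "B \<in> Obj C"
  shows "mult F (A, B) \<in> Arr D" "Dom D (mult F (A, B)) = ob_map F A \<otimes>\<^bsub>D\<^esub> ob_map F B"
    "Cod D (mult F (A, B)) = ob_map F (A \<otimes>\<^bsub>C\<^esub> B)" "is_iso D (mult F (A, B))"
  using mult_hom mult_iso assms by auto

lemma unit_arr [simp]: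
  "unit_map F \<in> Arr D" "Dom D (unit_map F) = \<I>\<^bsub>D\<^esub>" "Cod D (unit_map F) = ob_map F \<I>\<^bsub>C\<^esub>" "is_iso D (unit_map F)"
  using unit_hom unit_iso by auto

lemma mult_natural:
  assumes "f \<in> Arr C" "g \<in> Arr C" "Dom C f = A" "Dom C g = B"
  shows "ar_map F (f \<boxtimes>\<^bsub>C\<^esub> g) \<cdot>\<^bsub>D\<^esub> mult F (A, B) = mult F (Cod C f, Cod C g) \<cdot>\<^bsub>D\<^esub> (ar_map F f \<boxtimes>\<^bsub>D\<^esub> ar_map F g)"
  using mult_nat[of f A "Cod C f" g B "Cod C g"] assms by simp

lemma mult_natural_rev:
  assumes "f \<in> Arr C" "g \<in> Arr C" "Cod C f = A" "Cod C g = B"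
  shows "mult F (A, B) \<cdot>\<^bsub>D\<^esub> (ar_map F f \<boxtimes>\<^bsub>D\<^esub> ar_map F g) = ar_map F (f \<boxtimes>\<^bsub>C\<^esub> g) \<cdot>\<^bsub>D\<^esub> mult F (Dom C f, Dom C g)"
  using mult_natural[OF assms(1,2) HOL.refl HOL.refl] assms(3,4) by simp

lemma mult_assoc_right:
  "\<lbrakk>A \<in> Obj C; B \<in> Obj C; E \<in> Obj C\<rbrakk>
    \<Longrightarrow> ar_map F (Assoc C A B E) \<cdot>\<^bsub>D\<^esub> (mult F (A \<otimes>\<^bsub>C\<^esub> B, E) \<cdot>\<^bsub>D\<^esub> (mult F (A, B) \<boxtimes>\<^bsub>D\<^esub> Idt D (ob_map F E)))
      = mult F (A, B \<otimes>\<^bsub>C\<^esub> E) \<cdot>\<^bsub>D\<^esub> ((Idt D (ob_map F A) \<boxtimes>\<^bsub>D\<^esub> mult F (B, E))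
          \<cdot>\<^bsub>D\<^esub> Assoc D (ob_map F A) (ob_map F B) (ob_map F E))"
  and mult_lunit_right:
  "A \<in> Obj C \<Longrightarrow> ar_map F (LUnit C A) \<cdot>\<^bsub>D\<^esub> (mult F (\<I>\<^bsub>C\<^esub>, A) \<cdot>\<^bsub>D\<^esub> (unit_map F \<boxtimes>\<^bsub>D\<^esub> Idt D (ob_map F A)))
      = LUnit D (ob_map F A)"
  and mult_runit_right:
  "A \<in> Obj C \<Longrightarrow> ar_map F (RUnit C A) \<cdot>\<^bsub>D\<^esub> (mult F (A, \<I>\<^bsub>C\<^esub>) \<cdot>\<^bsub>D\<^esub> (Idt D (ob_map F A) \<boxtimes>\<^bsub>D\<^esub> unit_map F))
      = RUnit D (ob_map F A)"
  using mult_assoc[of A B E] mult_lunit[of A] mult_runit[of A] by simp_all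

end

section \<open>Right duals and mates\<close>

context monoidal_category
begin

lemma is_right_dual_arr:
  assumes "is_right_dual C P Y e h"
  shows "P \<in> Obj C" "Y \<in> Obj C" "e \<in> Arr C" "Dom C e = P \<otimes> Y" "Cod C e = \<I>"
    "h \<in> Arr C" "Dom C h = \<I>" "Cod C h = Y \<otimes> P"
  using assms by (auto simp: is_right_dual_def)

lemma triangle_left:
  assumes d: "is_right_dual C P Y e h"
  shows "LUnit C P \<cdot> ((e \<boxtimes> Idt C P) \<cdot> (inv_arr C (Assoc C P Y P) \<cdot> (Idt C P \<boxtimes> h))) = RUnit C P"
proof -
  note [simp] = is_right_dual_arr[OF d]
  have "(LUnit C P \<cdot> ((e \<boxtimes> Idt C P) \<cdot> (inv_arr C (Assoc C P Y P) \<cdot> (Idt C P \<boxtimes> h))))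
      \<cdot> inv_arr C (RUnit C P) = RUnit C P \<cdot> inv_arr C (RUnit C P)"
    using d by (simp add: is_right_dual_def)
  then show ?thesis by (rule iso_cancel_right[rotated]) auto
qed

lemma triangle_right:
  assumes d: "is_right_dual C P Y e h"
  shows "RUnit C Y \<cdot> ((Idt C Y \<boxtimes> e) \<cdot> (Assoc C Y P Y \<cdot> (h \<boxtimes> Idt C Y))) = LUnit C Y"
proof -
  note [simp] = is_right_dual_arr[OF d]
  have "(RUnit C Y \<cdot> ((Idt C Y \<boxtimes> e) \<cdot> (Assoc C Y P Y \<cdot> (h \<boxtimes> Idt C Y))))
      \<cdot> inv_arr C (LUnit C Y) = LUnit C Y \<cdot> inv_arr C (LUnit C Y)"
    using d by (simp add: is_right_dual_def)
  then show ?thesis by (rule iso_cancel_right[rotated]) auto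
qed

lemma is_right_dualI:
  assumes [simp]: "P \<in> Obj C" "Y \<in> Obj C" "e \<in> Arr C" "Dom C e = P \<otimes> Y" "Cod C e = \<I>"
    "h \<in> Arr C" "Dom C h = \<I>" "Cod C h = Y \<otimes> P"
    and left: "LUnit C P \<cdot> ((e \<boxtimes> Idt C P) \<cdot> (inv_arr C (Assoc C P Y P) \<cdot> (Idt C P \<boxtimes> h))) = RUnit C P"
    and right: "RUnit C Y \<cdot> ((Idt C Y \<boxtimes> e) \<cdot> (Assoc C Y P Y \<cdot> (h \<boxtimes> Idt C Y))) = LUnit C Y"
  shows "is_right_dual C P Y e h"
proof -
  have "(LUnit C P \<cdot> ((e \<boxtimes> Idt C P) \<cdot> (inv_arr C (Assoc C P Y P) \<cdot> (Idt C P \<boxtimes> h))))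
      \<cdot> inv_arr C (RUnit C P) = Idt C P"
    unfolding left by simp
  moreover have "(RUnit C Y \<cdot> ((Idt C Y \<boxtimes> e) \<cdot> (Assoc C Y P Y \<cdot> (h \<boxtimes> Idt C Y))))
      \<cdot> inv_arr C (LUnit C Y) = Idt C Y"
    unfolding right by simp
  ultimately show ?thesis by (simp add: is_right_dual_def)
qed

lemma is_right_dual_transport:
  assumes d: "is_right_dual C P Y e h"
    and a: "is_iso C a" "Dom C a = P'" "Cod C a = P"
    and b: "is_iso C b" "Dom C b = Y'" "Cod C b = Y"
  shows "is_right_dual C P' Y' (e \<cdot> (a \<boxtimes> b)) ((inv_arr C b \<boxtimes> inv_arr C a) \<cdot> h)"
proof -
  note [simp] = is_right_dual_arr[OF d] a b iso_arr[OF a(1)] iso_arr[OF b(1)]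
  have [simp]: "P' \<in> Obj C" "Y' \<in> Obj C"
    using dom_in_obj[OF iso_arr[OF a(1)]] dom_in_obj[OF iso_arr[OF b(1)]] by simp_all
  let ?a = "inv_arr C a" and ?b = "inv_arr C b"
  have left: "LUnit C P' \<cdot> (((e \<cdot> (a \<boxtimes> b)) \<boxtimes> Idt C P') \<cdot> (inv_arr C (Assoc C P' Y' P')
        \<cdot> (Idt C P' \<boxtimes> ((?b \<boxtimes> ?a) \<cdot> h)))) = RUnit C P'"
  proof -
    have "LUnit C P' \<cdot> (((e \<cdot> (a \<boxtimes> b)) \<boxtimes> Idt C P') \<cdot> (inv_arr C (Assoc C P' Y' P')
        \<cdot> (Idt C P' \<boxtimes> ((?b \<boxtimes> ?a) \<cdot> h))))
      = LUnit C P' \<cdot> (((e \<cdot> (a \<boxtimes> b)) \<boxtimes> Idt C P') \<cdot> (inv_arr C (Assoc C P' Y' P')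
        \<cdot> ((Idt C P' \<boxtimes> (?b \<boxtimes> ?a)) \<cdot> (Idt C P' \<boxtimes> h))))"
      by (simp add: merge)
    also have "\<dots> = LUnit C P' \<cdot> (((e \<cdot> (a \<boxtimes> b)) \<boxtimes> Idt C P') \<cdot> (((Idt C P' \<boxtimes> ?b) \<boxtimes> ?a)
        \<cdot> (inv_arr C (Assoc C P' Y P) \<cdot> (Idt C P' \<boxtimes> h))))"
      by (simp add: reassoc4[OF assoc_inv_natural])
    also have "\<dots> = LUnit C P' \<cdot> ((Idt C \<I> \<boxtimes> ?a) \<cdot> ((e \<boxtimes> Idt C P) \<cdot> (((a \<boxtimes> Idt C Y) \<boxtimes> Idt C P)
        \<cdot> (inv_arr C (Assoc C P' Y P) \<cdot> (Idt C P' \<boxtimes> h)))))"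
      by (simp add: merge)
    also have "\<dots> = ?a \<cdot> (LUnit C P \<cdot> ((e \<boxtimes> Idt C P) \<cdot> (inv_arr C (Assoc C P Y P)
        \<cdot> ((a \<boxtimes> (Idt C Y \<boxtimes> Idt C P)) \<cdot> (Idt C P' \<boxtimes> h)))))"
      by (simp add: reassoc4[OF lunit_natural_rev] reassoc4[OF assoc_inv_natural] del: ten_idt_idt)
    also have "\<dots> = ?a \<cdot> ((LUnit C P \<cdot> ((e \<boxtimes> Idt C P) \<cdot> (inv_arr C (Assoc C P Y P)
        \<cdot> (Idt C P \<boxtimes> h)))) \<cdot> (a \<boxtimes> Idt C \<I>))"
      by (simp add: merge)
    also have "\<dots> = RUnit C P'"
      unfolding triangle_left[OF d] by (simp add: runit_natural_rev)
    finally show ?thesis .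
  qed
  have right: "RUnit C Y' \<cdot> ((Idt C Y' \<boxtimes> (e \<cdot> (a \<boxtimes> b))) \<cdot> (Assoc C Y' P' Y'
        \<cdot> (((?b \<boxtimes> ?a) \<cdot> h) \<boxtimes> Idt C Y'))) = LUnit C Y'"
  proof -
    have "RUnit C Y' \<cdot> ((Idt C Y' \<boxtimes> (e \<cdot> (a \<boxtimes> b))) \<cdot> (Assoc C Y' P' Y'
        \<cdot> (((?b \<boxtimes> ?a) \<cdot> h) \<boxtimes> Idt C Y')))
      = RUnit C Y' \<cdot> ((Idt C Y' \<boxtimes> (e \<cdot> (a \<boxtimes> b))) \<cdot> (Assoc C Y' P' Y'
        \<cdot> (((?b \<boxtimes> ?a) \<boxtimes> Idt C Y') \<cdot> (h \<boxtimes> Idt C Y'))))"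
      by (simp add: merge)
    also have "\<dots> = RUnit C Y' \<cdot> ((Idt C Y' \<boxtimes> (e \<cdot> (a \<boxtimes> b))) \<cdot> ((?b \<boxtimes> (?a \<boxtimes> Idt C Y'))
        \<cdot> (Assoc C Y P Y' \<cdot> (h \<boxtimes> Idt C Y'))))"
      by (simp add: reassoc4[OF assoc_natural_rev])
    also have "\<dots> = RUnit C Y' \<cdot> ((?b \<boxtimes> Idt C \<I>) \<cdot> ((Idt C Y \<boxtimes> e) \<cdot> ((Idt C Y \<boxtimes> (Idt C P \<boxtimes> b))
        \<cdot> (Assoc C Y P Y' \<cdot> (h \<boxtimes> Idt C Y')))))"
      by (simp add: merge)
    also have "\<dots> = ?b \<cdot> (RUnit C Y \<cdot> ((Idt C Y \<boxtimes> e) \<cdot> (Assoc C Y P Y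
        \<cdot> (((Idt C Y \<boxtimes> Idt C P) \<boxtimes> b) \<cdot> (h \<boxtimes> Idt C Y')))))"
      by (simp add: reassoc4[OF runit_natural_rev] reassoc4[OF assoc_natural] del: ten_idt_idt)
    also have "\<dots> = ?b \<cdot> ((RUnit C Y \<cdot> ((Idt C Y \<boxtimes> e) \<cdot> (Assoc C Y P Y
        \<cdot> (h \<boxtimes> Idt C Y)))) \<cdot> (Idt C \<I> \<boxtimes> b))"
      by (simp add: merge)
    also have "\<dots> = LUnit C Y'"
      unfolding triangle_right[OF d] by (simp add: lunit_natural_rev)
    finally show ?thesis .
  qed
  show ?thesis by (rule is_right_dualI[OF _ _ _ _ _ _ _ _ left right]) simp_all
qed

definition uncurry_dual :: "'o \<Rightarrow> 'o \<Rightarrow> 'm \<Rightarrow> 'o \<Rightarrow> 'm \<Rightarrow> 'm" where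
  "uncurry_dual P Y e W f =
     LUnit C W \<cdot> ((e \<boxtimes> Idt C W) \<cdot> (inv_arr C (Assoc C P Y W) \<cdot> (Idt C P \<boxtimes> f)))"

definition curry_dual :: "'o \<Rightarrow> 'o \<Rightarrow> 'm \<Rightarrow> 'o \<Rightarrow> 'm \<Rightarrow> 'm" where
  "curry_dual P Y h Z g =
     (Idt C Y \<boxtimes> g) \<cdot> (Assoc C Y P Z \<cdot> ((h \<boxtimes> Idt C Z) \<cdot> inv_arr C (LUnit C Z)))"

lemma uncurry_curry_dual:
  assumes d: "is_right_dual C P Y e h" and g: "g \<in> Arr C" "Dom C g = P \<otimes> Z" "Cod C g = W" "Z \<in> Obj C"
  shows "uncurry_dual P Y e W (curry_dual P Y h Z g) = g"
proof -
  note [simp] = is_right_dual_arr[OF d] g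
  have [simp]: "W \<in> Obj C" using cod_in_obj[OF g(1)] g(3) by simp
  have pent: "inv_arr C (Assoc C P Y (P \<otimes> Z)) \<cdot> (Idt C P \<boxtimes> Assoc C Y P Z)
    = Assoc C (P \<otimes> Y) P Z \<cdot> ((inv_arr C (Assoc C P Y P) \<boxtimes> Idt C Z) \<cdot> inv_arr C (Assoc C P (Y \<otimes> P) Z))"
  proof -
    have "(Idt C P \<boxtimes> Assoc C Y P Z) \<cdot> (Assoc C P (Y \<otimes> P) Z \<cdot> (Assoc C P Y P \<boxtimes> Idt C Z))
        = Assoc C P Y (P \<otimes> Z) \<cdot> Assoc C (P \<otimes> Y) P Z"
      using pentagon[of P Y P Z] by simp
    then have "(Idt C P \<boxtimes> Assoc C Y P Z) = (Assoc C P Y (P \<otimes> Z) \<cdot> Assoc C (P \<otimes> Y) P Z)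
        \<cdot> inv_arr C (Assoc C P (Y \<otimes> P) Z \<cdot> (Assoc C P Y P \<boxtimes> Idt C Z))"
      by (rule iso_move_right[rotated]) (auto simp: iso_comp iso_ten)
    then show ?thesis by (simp add: iso_comp iso_ten)
  qed
  have un: "inv_arr C (Assoc C P \<I> Z) \<cdot> (Idt C P \<boxtimes> inv_arr C (LUnit C Z)) = inv_arr C (RUnit C P) \<boxtimes> Idt C Z"
  proof -
    have "inv_arr C ((Idt C P \<boxtimes> LUnit C Z) \<cdot> Assoc C P \<I> Z) = inv_arr C (RUnit C P \<boxtimes> Idt C Z)"
      by (simp add: triangle)
    then show ?thesis by (simp add: iso_comp iso_ten)
  qed
  have "uncurry_dual P Y e W (curry_dual P Y h Z g) = LUnit C W \<cdot> ((e \<boxtimes> Idt C W)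
      \<cdot> (inv_arr C (Assoc C P Y W) \<cdot> ((Idt C P \<boxtimes> (Idt C Y \<boxtimes> g)) \<cdot> ((Idt C P \<boxtimes> Assoc C Y P Z)
      \<cdot> ((Idt C P \<boxtimes> (h \<boxtimes> Idt C Z)) \<cdot> (Idt C P \<boxtimes> inv_arr C (LUnit C Z)))))))"
    by (simp add: uncurry_dual_def curry_dual_def merge)
  also have "\<dots> = LUnit C W \<cdot> ((e \<boxtimes> Idt C W) \<cdot> (((Idt C P \<boxtimes> Idt C Y) \<boxtimes> g)
      \<cdot> (inv_arr C (Assoc C P Y (P \<otimes> Z)) \<cdot> ((Idt C P \<boxtimes> Assoc C Y P Z)
      \<cdot> ((Idt C P \<boxtimes> (h \<boxtimes> Idt C Z)) \<cdot> (Idt C P \<boxtimes> inv_arr C (LUnit C Z)))))))"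
    by (simp add: reassoc4[OF assoc_inv_natural] del: ten_idt_idt)
  also have "\<dots> = LUnit C W \<cdot> ((Idt C \<I> \<boxtimes> g) \<cdot> ((e \<boxtimes> Idt C (P \<otimes> Z))
      \<cdot> (inv_arr C (Assoc C P Y (P \<otimes> Z)) \<cdot> ((Idt C P \<boxtimes> Assoc C Y P Z)
      \<cdot> ((Idt C P \<boxtimes> (h \<boxtimes> Idt C Z)) \<cdot> (Idt C P \<boxtimes> inv_arr C (LUnit C Z)))))))"
    by (simp add: merge)
  also have "\<dots> = g \<cdot> (LUnit C (P \<otimes> Z) \<cdot> ((e \<boxtimes> (Idt C P \<boxtimes> Idt C Z)) \<cdot> (Assoc C (P \<otimes> Y) P Z
      \<cdot> ((inv_arr C (Assoc C P Y P) \<boxtimes> Idt C Z) \<cdot> (inv_arr C (Assoc C P (Y \<otimes> P) Z)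
      \<cdot> ((Idt C P \<boxtimes> (h \<boxtimes> Idt C Z)) \<cdot> (Idt C P \<boxtimes> inv_arr C (LUnit C Z))))))))"
    by (simp add: reassoc4[OF lunit_natural_rev] reassoc[OF pent])
  also have "\<dots> = g \<cdot> (LUnit C (P \<otimes> Z) \<cdot> (Assoc C \<I> P Z \<cdot> (((e \<boxtimes> Idt C P) \<boxtimes> Idt C Z)
      \<cdot> ((inv_arr C (Assoc C P Y P) \<boxtimes> Idt C Z) \<cdot> (((Idt C P \<boxtimes> h) \<boxtimes> Idt C Z)
      \<cdot> (inv_arr C (Assoc C P \<I> Z) \<cdot> (Idt C P \<boxtimes> inv_arr C (LUnit C Z))))))))"
    by (simp add: reassoc4[OF assoc_natural] reassoc4[OF assoc_inv_natural] del: ten_idt_idt)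
  also have "\<dots> = g \<cdot> (((LUnit C P \<cdot> ((e \<boxtimes> Idt C P) \<cdot> (inv_arr C (Assoc C P Y P) \<cdot> (Idt C P \<boxtimes> h))))
      \<cdot> inv_arr C (RUnit C P)) \<boxtimes> Idt C Z)"
    by (simp add: un reassoc[OF lunit_ten] merge)
  also have "\<dots> = g" unfolding triangle_left[OF d] by simp
  finally show ?thesis .
qed

lemma curry_uncurry_dual:
  assumes d: "is_right_dual C P Y e h" and f: "f \<in> Arr C" "Dom C f = Z" "Cod C f = Y \<otimes> W" "W \<in> Obj C"
  shows "curry_dual P Y h Z (uncurry_dual P Y e W f) = f"
proof -
  note [simp] = is_right_dual_arr[OF d] f
  have [simp]: "Z \<in> Obj C" using dom_in_obj[OF f(1)] f(2) by simp
  have pent: "(Idt C Y \<boxtimes> inv_arr C (Assoc C P Y W)) \<cdot> Assoc C Y P (Y \<otimes> W)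
    = Assoc C Y (P \<otimes> Y) W \<cdot> ((Assoc C Y P Y \<boxtimes> Idt C W) \<cdot> inv_arr C (Assoc C (Y \<otimes> P) Y W))"
  proof -
    have "Assoc C Y P (Y \<otimes> W) \<cdot> Assoc C (Y \<otimes> P) Y W
        = (Idt C Y \<boxtimes> Assoc C P Y W) \<cdot> (Assoc C Y (P \<otimes> Y) W \<cdot> (Assoc C Y P Y \<boxtimes> Idt C W))"
      using pentagon[of Y P Y W] by simp
    then have "Assoc C Y P (Y \<otimes> W) = ((Idt C Y \<boxtimes> Assoc C P Y W)
        \<cdot> (Assoc C Y (P \<otimes> Y) W \<cdot> (Assoc C Y P Y \<boxtimes> Idt C W))) \<cdot> inv_arr C (Assoc C (Y \<otimes> P) Y W)"
      by (rule iso_move_right[rotated]) auto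
    then show ?thesis by (simp add: merge)
  qed
  have un: "inv_arr C (Assoc C \<I> Y W) \<cdot> inv_arr C (LUnit C (Y \<otimes> W)) = inv_arr C (LUnit C Y) \<boxtimes> Idt C W"
  proof -
    have "inv_arr C (LUnit C (Y \<otimes> W) \<cdot> Assoc C \<I> Y W) = inv_arr C (LUnit C Y \<boxtimes> Idt C W)"
      by (simp add: lunit_ten)
    then show ?thesis by (simp add: iso_comp iso_ten)
  qed
  have "curry_dual P Y h Z (uncurry_dual P Y e W f) = (Idt C Y \<boxtimes> LUnit C W)
      \<cdot> ((Idt C Y \<boxtimes> (e \<boxtimes> Idt C W)) \<cdot> ((Idt C Y \<boxtimes> inv_arr C (Assoc C P Y W))
      \<cdot> ((Idt C Y \<boxtimes> (Idt C P \<boxtimes> f)) \<cdot> (Assoc C Y P Z \<cdot> ((h \<boxtimes> Idt C Z) \<cdot> inv_arr C (LUnit C Z))))))"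
    by (simp add: uncurry_dual_def curry_dual_def merge)
  also have "\<dots> = (Idt C Y \<boxtimes> LUnit C W)
      \<cdot> ((Idt C Y \<boxtimes> (e \<boxtimes> Idt C W)) \<cdot> ((Idt C Y \<boxtimes> inv_arr C (Assoc C P Y W))
      \<cdot> (Assoc C Y P (Y \<otimes> W) \<cdot> (((Idt C Y \<boxtimes> Idt C P) \<boxtimes> f) \<cdot> ((h \<boxtimes> Idt C Z) \<cdot> inv_arr C (LUnit C Z))))))"
    by (simp add: reassoc4[OF assoc_natural] del: ten_idt_idt)
  also have "\<dots> = (Idt C Y \<boxtimes> LUnit C W)
      \<cdot> ((Idt C Y \<boxtimes> (e \<boxtimes> Idt C W)) \<cdot> ((Idt C Y \<boxtimes> inv_arr C (Assoc C P Y W))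
      \<cdot> (Assoc C Y P (Y \<otimes> W) \<cdot> ((h \<boxtimes> Idt C (Y \<otimes> W)) \<cdot> ((Idt C \<I> \<boxtimes> f) \<cdot> inv_arr C (LUnit C Z))))))"
    by (simp add: merge)
  also have "\<dots> = (Idt C Y \<boxtimes> LUnit C W) \<cdot> ((Idt C Y \<boxtimes> (e \<boxtimes> Idt C W)) \<cdot> (Assoc C Y (P \<otimes> Y) W
      \<cdot> ((Assoc C Y P Y \<boxtimes> Idt C W) \<cdot> (inv_arr C (Assoc C (Y \<otimes> P) Y W)
      \<cdot> ((h \<boxtimes> (Idt C Y \<boxtimes> Idt C W)) \<cdot> (inv_arr C (LUnit C (Y \<otimes> W)) \<cdot> f))))))"
    by (simp add: lunit_inv_natural reassoc[OF pent])
  also have "\<dots> = (Idt C Y \<boxtimes> LUnit C W) \<cdot> (Assoc C Y \<I> W \<cdot> (((Idt C Y \<boxtimes> e) \<boxtimes> Idt C W)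
      \<cdot> ((Assoc C Y P Y \<boxtimes> Idt C W) \<cdot> (((h \<boxtimes> Idt C Y) \<boxtimes> Idt C W)
      \<cdot> (inv_arr C (Assoc C \<I> Y W) \<cdot> (inv_arr C (LUnit C (Y \<otimes> W)) \<cdot> f))))))"
    by (simp add: reassoc4[OF assoc_natural] reassoc4[OF assoc_inv_natural_rev] del: ten_idt_idt)
  also have "\<dots> = (((RUnit C Y \<cdot> ((Idt C Y \<boxtimes> e) \<cdot> (Assoc C Y P Y \<cdot> (h \<boxtimes> Idt C Y))))
      \<cdot> inv_arr C (LUnit C Y)) \<boxtimes> Idt C W) \<cdot> f"
    by (simp add: reassoc[OF un] reassoc[OF triangle] merge)
  also have "\<dots> = f" unfolding triangle_right[OF d] by simp
  finally show ?thesis .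
qed

lemma uncurry_dual_runit:
  assumes d: "is_right_dual C P Y e h" and f: "f \<in> Arr C" "Cod C f = Y"
  shows "uncurry_dual P Y e \<I> (inv_arr C (RUnit C Y) \<cdot> f) = e \<cdot> (Idt C P \<boxtimes> f)"
proof -
  note [simp] = is_right_dual_arr[OF d] f
  have un: "inv_arr C (Assoc C P Y \<I>) \<cdot> (Idt C P \<boxtimes> inv_arr C (RUnit C Y)) = inv_arr C (RUnit C (P \<otimes> Y))"
  proof -
    have "inv_arr C ((Idt C P \<boxtimes> RUnit C Y) \<cdot> Assoc C P Y \<I>) = inv_arr C (RUnit C (P \<otimes> Y))"
      by (simp add: runit_ten)
    then show ?thesis by (simp add: iso_comp iso_ten)
  qed
  have "uncurry_dual P Y e \<I> (inv_arr C (RUnit C Y) \<cdot> f) = LUnit C \<I> \<cdot> ((e \<boxtimes> Idt C \<I>)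
      \<cdot> (inv_arr C (Assoc C P Y \<I>) \<cdot> ((Idt C P \<boxtimes> inv_arr C (RUnit C Y)) \<cdot> (Idt C P \<boxtimes> f))))"
    by (simp add: uncurry_dual_def merge)
  also have "\<dots> = e \<cdot> (Idt C P \<boxtimes> f)"
    by (simp add: reassoc[OF un] reassoc4[OF runit_inv_natural] lunit_unit)
  finally show ?thesis .
qed

lemma mate_unique:
  assumes d: "is_right_dual C P' Y' e' h'" and t: "is_iso C t" "Dom C t = P" "Cod C t = P'"
    and a: "a \<in> Hom C Y Y'" and b: "b \<in> Hom C Y Y'" and eq: "e' \<cdot> (t \<boxtimes> a) = e' \<cdot> (t \<boxtimes> b)"
  shows "a = b"
proof -
  note [simp] = is_right_dual_arr[OF d] t iso_arr[OF t(1)]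
  have [simp]: "a \<in> Arr C" "Dom C a = Y" "Cod C a = Y'" "b \<in> Arr C" "Dom C b = Y" "Cod C b = Y'"
    using a b by auto
  have [simp]: "Y \<in> Obj C" using dom_in_obj[of a] by simp
  have [simp]: "P \<in> Obj C" using dom_in_obj[of t] by simp
  have *: "e' \<cdot> (Idt C P' \<boxtimes> x) = (e' \<cdot> (t \<boxtimes> x)) \<cdot> (inv_arr C t \<boxtimes> Idt C Y)"
    if "x \<in> Arr C" "Dom C x = Y" "Cod C x = Y'" for x
    using that by (simp add: merge)
  have "uncurry_dual P' Y' e' \<I> (inv_arr C (RUnit C Y') \<cdot> a)
      = uncurry_dual P' Y' e' \<I> (inv_arr C (RUnit C Y') \<cdot> b)"
    using *[of a] *[of b] eq by (simp add: uncurry_dual_runit[OF d])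
  then have "curry_dual P' Y' h' Y (uncurry_dual P' Y' e' \<I> (inv_arr C (RUnit C Y') \<cdot> a))
      = curry_dual P' Y' h' Y (uncurry_dual P' Y' e' \<I> (inv_arr C (RUnit C Y') \<cdot> b))" by simp
  then have "inv_arr C (RUnit C Y') \<cdot> a = inv_arr C (RUnit C Y') \<cdot> b"
    by (simp add: curry_uncurry_dual[OF d])
  then show ?thesis by (rule iso_cancel_left[rotated]) auto
qed

lemma mate_exists:
  assumes d: "is_right_dual C P Y e h" and d': "is_right_dual C P' Y' e' h'"
    and t: "is_iso C t" "Dom C t = P" "Cod C t = P'"
  obtains m where "m \<in> Hom C Y Y'" "e' \<cdot> (t \<boxtimes> m) = e" "(m \<boxtimes> t) \<cdot> h = h'"
proof -
  note [simp] = is_right_dual_arr[OF d] is_right_dual_arr[OF d'] t iso_arr[OF t(1)]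
  let ?t = "inv_arr C t"
  let ?g = "e \<cdot> (?t \<boxtimes> Idt C Y)"
  define m where "m = RUnit C Y' \<cdot> curry_dual P' Y' h' Y ?g"
  have cur [simp]: "curry_dual P' Y' h' Y ?g \<in> Arr C" "Dom C (curry_dual P' Y' h' Y ?g) = Y"
    "Cod C (curry_dual P' Y' h' Y ?g) = Y' \<otimes> \<I>"
    by (simp_all add: curry_dual_def)
  have m [simp]: "m \<in> Arr C" "Dom C m = Y" "Cod C m = Y'"
    by (simp_all add: m_def)
  have em: "e' \<cdot> (Idt C P' \<boxtimes> m) = ?g"
    using uncurry_dual_runit[OF d', of m] uncurry_curry_dual[OF d', of ?g Y \<I>]
    by (simp add: m_def)
  have 1: "e' \<cdot> (t \<boxtimes> m) = e"
  proof -
    have "e' \<cdot> (t \<boxtimes> m) = (e' \<cdot> (Idt C P' \<boxtimes> m)) \<cdot> (t \<boxtimes> Idt C Y)" by (simp add: merge)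
    also have "\<dots> = e" unfolding em by (simp add: merge)
    finally show ?thesis .
  qed
  have "uncurry_dual P' Y' e' P' ((m \<boxtimes> t) \<cdot> h) = LUnit C P' \<cdot> ((e' \<boxtimes> Idt C P')
      \<cdot> (inv_arr C (Assoc C P' Y' P') \<cdot> ((Idt C P' \<boxtimes> (m \<boxtimes> t)) \<cdot> (Idt C P' \<boxtimes> h))))"
    by (simp add: uncurry_dual_def merge)
  also have "\<dots> = LUnit C P' \<cdot> ((e' \<boxtimes> Idt C P') \<cdot> (((Idt C P' \<boxtimes> m) \<boxtimes> t)
      \<cdot> (inv_arr C (Assoc C P' Y P) \<cdot> (Idt C P' \<boxtimes> h))))"
    by (simp add: reassoc4[OF assoc_inv_natural])
  also have "\<dots> = LUnit C P' \<cdot> ((?g \<boxtimes> t) \<cdot> (inv_arr C (Assoc C P' Y P) \<cdot> (Idt C P' \<boxtimes> h)))"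
    using em by (simp add: merge)
  also have "\<dots> = LUnit C P' \<cdot> ((Idt C \<I> \<boxtimes> t) \<cdot> ((e \<boxtimes> Idt C P) \<cdot> (((?t \<boxtimes> Idt C Y) \<boxtimes> Idt C P)
      \<cdot> (inv_arr C (Assoc C P' Y P) \<cdot> (Idt C P' \<boxtimes> h)))))"
    by (simp add: merge)
  also have "\<dots> = t \<cdot> (LUnit C P \<cdot> ((e \<boxtimes> Idt C P) \<cdot> (inv_arr C (Assoc C P Y P)
      \<cdot> ((?t \<boxtimes> (Idt C Y \<boxtimes> Idt C P)) \<cdot> (Idt C P' \<boxtimes> h)))))"
    by (simp add: reassoc4[OF lunit_natural_rev] reassoc4[OF assoc_inv_natural] del: ten_idt_idt)
  also have "\<dots> = t \<cdot> ((LUnit C P \<cdot> ((e \<boxtimes> Idt C P) \<cdot> (inv_arr C (Assoc C P Y P) \<cdot> (Idt C P \<boxtimes> h))))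
      \<cdot> (?t \<boxtimes> Idt C \<I>))"
    by (simp add: merge)
  also have "\<dots> = RUnit C P'"
    unfolding triangle_left[OF d] by (simp add: runit_natural_rev)
  also have "\<dots> = uncurry_dual P' Y' e' P' h'"
    by (simp add: uncurry_dual_def triangle_left[OF d'])
  finally have "curry_dual P' Y' h' \<I> (uncurry_dual P' Y' e' P' ((m \<boxtimes> t) \<cdot> h))
    = curry_dual P' Y' h' \<I> (uncurry_dual P' Y' e' P' h')" by simp
  then have 2: "(m \<boxtimes> t) \<cdot> h = h'"
    by (simp add: curry_uncurry_dual[OF d'])
  show ?thesis by (rule that[OF _ 1 2]) simp
qed

end

section \<open>Strong monoidal functors on discrete monoidal categories\<close>

context strict_monoidal_category
begin

lemmas strict_simps [simp] = strict_assoc strict_lunit strict_runit assoc_idt lunit_idt runit_idt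

lemma strict_lunit_arr [simp]: "f \<in> Arr C \<Longrightarrow> Idt C \<I> \<boxtimes> f = f"
  using lunit_natural[of f "Dom C f"] by simp

lemma strict_runit_arr [simp]: "f \<in> Arr C \<Longrightarrow> f \<boxtimes> Idt C \<I> = f"
  using runit_natural[of f "Dom C f"] by simp

lemma is_right_dual_strict:
  "is_right_dual C P Y e h \<longleftrightarrow> P \<in> Obj C \<and> Y \<in> Obj C \<and> e \<in> Hom C (P \<otimes> Y) \<I> \<and> h \<in> Hom C \<I> (Y \<otimes> P) \<and>
     (e \<boxtimes> Idt C P) \<cdot> (Idt C P \<boxtimes> h) = Idt C P \<and> (Idt C Y \<boxtimes> e) \<cdot> (h \<boxtimes> Idt C Y) = Idt C Y"
  by (auto simp: is_right_dual_def)

end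

text \<open>A strong monoidal functor to \<open>X\<close> from a monoid \<open>M\<close> regarded as a discrete monoidal category.\<close>

locale monoid_rep = monoidal_category X for X :: "('p, 'q) moncat" (structure) +
  fixes M :: "'o set" and mul :: "'o \<Rightarrow> 'o \<Rightarrow> 'o" and e :: 'o
    and F :: "'o \<Rightarrow> 'p" and mu :: "'o \<Rightarrow> 'o \<Rightarrow> 'q" and u :: 'q
  assumes mul_closed [simp]: "\<lbrakk>a \<in> M; b \<in> M\<rbrakk> \<Longrightarrow> mul a b \<in> M"
    and mul_assoc [simp]: "\<lbrakk>a \<in> M; b \<in> M; c \<in> M\<rbrakk> \<Longrightarrow> mul (mul a b) c = mul a (mul b c)"
    and e_closed [simp]: "e \<in> M"
    and mul_e_left [simp]: "a \<in> M \<Longrightarrow> mul e a = a"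
    and mul_e_right [simp]: "a \<in> M \<Longrightarrow> mul a e = a"
    and F_obj [simp]: "a \<in> M \<Longrightarrow> F a \<in> Obj X"
    and mu_arr [simp]: "\<lbrakk>a \<in> M; b \<in> M\<rbrakk> \<Longrightarrow> mu a b \<in> Arr X"
      "\<lbrakk>a \<in> M; b \<in> M\<rbrakk> \<Longrightarrow> Dom X (mu a b) = F a \<otimes> F b"
      "\<lbrakk>a \<in> M; b \<in> M\<rbrakk> \<Longrightarrow> Cod X (mu a b) = F (mul a b)"
    and mu_iso [simp]: "\<lbrakk>a \<in> M; b \<in> M\<rbrakk> \<Longrightarrow> is_iso X (mu a b)"
    and u_arr [simp]: "u \<in> Arr X" "Dom X u = \<I>" "Cod X u = F e"
    and u_iso [simp]: "is_iso X u"
    and mu_assoc: "\<lbrakk>a \<in> M; b \<in> M; c \<in> M\<rbrakk> \<Longrightarrow> mu (mul a b) c \<cdot> (mu a b \<boxtimes> Idt X (F c))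
      = mu a (mul b c) \<cdot> ((Idt X (F a) \<boxtimes> mu b c) \<cdot> Assoc X (F a) (F b) (F c))"
    and mu_lunit: "a \<in> M \<Longrightarrow> mu e a \<cdot> (u \<boxtimes> Idt X (F a)) = LUnit X (F a)"
    and mu_runit: "a \<in> M \<Longrightarrow> mu a e \<cdot> (Idt X (F a) \<boxtimes> u) = RUnit X (F a)"

text \<open>The tensor of \<open>x : F a \<rightarrow> F' a'\<close> and \<open>y : F b \<rightarrow> F' b'\<close>, conjugated by the structure maps to an
  arrow \<open>F (a b) \<rightarrow> F' (a' b')\<close>; unlike \<open>\<boxtimes>\<close> it is strictly associative.\<close>

definition star :: "('p, 'q) moncat \<Rightarrow> ('o \<Rightarrow> 'o \<Rightarrow> 'q) \<Rightarrow> ('o \<Rightarrow> 'o \<Rightarrow> 'q) \<Rightarrow>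
    'o \<Rightarrow> 'o \<Rightarrow> 'q \<Rightarrow> 'o \<Rightarrow> 'o \<Rightarrow> 'q \<Rightarrow> 'q" where
  "star X mu mu' a a' x b b' y = mu' a' b' \<cdot>\<^bsub>X\<^esub> ((x \<boxtimes>\<^bsub>X\<^esub> y) \<cdot>\<^bsub>X\<^esub> inv_arr X (mu a b))"

locale monoid_rep2 = R: monoid_rep X M mul e F mu u + R': monoid_rep X M mul e F' mu' u'
  for X :: "('p, 'q) moncat" (structure) and M :: "'o set" and mul e F mu u F' mu' u'
begin

lemma star_arr [simp]:
  assumes "a \<in> M" "a' \<in> M" "b \<in> M" "b' \<in> M" "x \<in> Arr X" "Dom X x = F a" "Cod X x = F' a'"
    "y \<in> Arr X" "Dom X y = F b" "Cod X y = F' b'"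
  shows "star X mu mu' a a' x b b' y \<in> Arr X"
    "Dom X (star X mu mu' a a' x b b' y) = F (mul a b)"
    "Cod X (star X mu mu' a a' x b b' y) = F' (mul a' b')"
  using assms by (simp_all add: star_def)

lemma star_mu:
  assumes "a \<in> M" "a' \<in> M" "b \<in> M" "b' \<in> M" "x \<in> Arr X" "Dom X x = F a" "Cod X x = F' a'"
    "y \<in> Arr X" "Dom X y = F b" "Cod X y = F' b'"
  shows "star X mu mu' a a' x b b' y \<cdot> mu a b = mu' a' b' \<cdot> (x \<boxtimes> y)"
  using assms by (simp add: star_def)

lemma star_eqI:
  assumes "a \<in> M" "a' \<in> M" "b \<in> M" "b' \<in> M" "x \<in> Arr X" "Dom X x = F a" "Cod X x = F' a'"
    "y \<in> Arr X" "Dom X y = F b" "Cod X y = F' b'"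
    and "z \<cdot> mu a b = mu' a' b' \<cdot> (x \<boxtimes> y)" "z \<in> Arr X" "Dom X z = F (mul a b)"
  shows "z = star X mu mu' a a' x b b' y"
proof -
  have "z = (mu' a' b' \<cdot> (x \<boxtimes> y)) \<cdot> inv_arr X (mu a b)"
    by (rule R.iso_move_right[OF _ assms(11)]) (use assms(1-10,12-) in auto)
  then show ?thesis using assms(1-10) by (simp add: star_def)
qed

lemma star_assoc:
  assumes [simp]: "a \<in> M" "a' \<in> M" "b \<in> M" "b' \<in> M" "c \<in> M" "c' \<in> M"
    "x \<in> Arr X" "Dom X x = F a" "Cod X x = F' a'" "y \<in> Arr X" "Dom X y = F b" "Cod X y = F' b'"
    "z \<in> Arr X" "Dom X z = F c" "Cod X z = F' c'"
  shows "star X mu mu' (mul a b) (mul a' b') (star X mu mu' a a' x b b' y) c c' z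
    = star X mu mu' a a' x (mul b c) (mul b' c') (star X mu mu' b b' y c c' z)" (is "?L = ?R")
proof -
  have "?L \<cdot> (mu (mul a b) c \<cdot> (mu a b \<boxtimes> Idt X (F c)))
      = mu' (mul a' b') c' \<cdot> ((star X mu mu' a a' x b b' y \<boxtimes> z) \<cdot> (mu a b \<boxtimes> Idt X (F c)))"
    by (simp add: R.reassoc4[OF star_mu])
  also have "\<dots> = mu' (mul a' b') c' \<cdot> ((mu' a' b' \<boxtimes> Idt X (F' c')) \<cdot> ((x \<boxtimes> y) \<boxtimes> z))"
    by (simp add: R.merge star_mu)
  also have "\<dots> = mu' a' (mul b' c') \<cdot> ((Idt X (F' a') \<boxtimes> mu' b' c')
      \<cdot> (Assoc X (F' a') (F' b') (F' c') \<cdot> ((x \<boxtimes> y) \<boxtimes> z)))"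
    by (simp add: R.reassoc[OF R'.mu_assoc])
  also have "\<dots> = mu' a' (mul b' c') \<cdot> ((Idt X (F' a') \<boxtimes> mu' b' c')
      \<cdot> ((x \<boxtimes> (y \<boxtimes> z)) \<cdot> Assoc X (F a) (F b) (F c)))"
    by (simp add: R.assoc_natural_rev)
  also have "\<dots> = mu' a' (mul b' c') \<cdot> ((x \<boxtimes> star X mu mu' b b' y c c' z)
      \<cdot> ((Idt X (F a) \<boxtimes> mu b c) \<cdot> Assoc X (F a) (F b) (F c)))"
    by (simp add: R.merge star_mu)
  also have "\<dots> = ?R \<cdot> (mu a (mul b c) \<cdot> ((Idt X (F a) \<boxtimes> mu b c) \<cdot> Assoc X (F a) (F b) (F c)))"
    by (simp add: R.reassoc4[OF star_mu])
  also have "\<dots> = ?R \<cdot> (mu (mul a b) c \<cdot> (mu a b \<boxtimes> Idt X (F c)))"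
    by (simp add: R.mu_assoc)
  finally show ?thesis
    by (rule R.iso_cancel_right[rotated]) (auto simp: R.iso_comp R.iso_ten)
qed

lemma star_unit_left:
  assumes [simp]: "a \<in> M" "a' \<in> M" "x \<in> Arr X" "Dom X x = F a" "Cod X x = F' a'"
  shows "star X mu mu' e e (u' \<cdot> inv_arr X u) a a' x = x" (is "?L = _")
proof -
  have "?L \<cdot> (mu e a \<cdot> (u \<boxtimes> Idt X (F a))) = mu' e a' \<cdot> ((u' \<boxtimes> Idt X (F' a')) \<cdot> (Idt X \<I> \<boxtimes> x))"
    by (simp add: R.reassoc4[OF star_mu] R.merge)
  also have "\<dots> = LUnit X (F' a') \<cdot> (Idt X \<I> \<boxtimes> x)"
    by (simp add: R.reassoc[OF R'.mu_lunit])
  also have "\<dots> = x \<cdot> (mu e a \<cdot> (u \<boxtimes> Idt X (F a)))"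
    by (simp add: R.mu_lunit R.lunit_natural_rev)
  finally show ?thesis
    by (rule R.iso_cancel_right[rotated]) (auto simp: R.iso_comp R.iso_ten)
qed

lemma star_unit_right:
  assumes [simp]: "a \<in> M" "a' \<in> M" "x \<in> Arr X" "Dom X x = F a" "Cod X x = F' a'"
  shows "star X mu mu' a a' x e e (u' \<cdot> inv_arr X u) = x" (is "?L = _")
proof -
  have "?L \<cdot> (mu a e \<cdot> (Idt X (F a) \<boxtimes> u)) = mu' a' e \<cdot> ((Idt X (F' a') \<boxtimes> u') \<cdot> (x \<boxtimes> Idt X \<I>))"
    by (simp add: R.reassoc4[OF star_mu] R.merge)
  also have "\<dots> = RUnit X (F' a') \<cdot> (x \<boxtimes> Idt X \<I>)"
    by (simp add: R.reassoc[OF R'.mu_runit])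
  also have "\<dots> = x \<cdot> (mu a e \<cdot> (Idt X (F a) \<boxtimes> u))"
    by (simp add: R.mu_runit R.runit_natural_rev)
  finally show ?thesis
    by (rule R.iso_cancel_right[rotated]) (auto simp: R.iso_comp R.iso_ten)
qed

end

lemma monoid_rep2I:
  "monoid_rep X M mul e F mu u \<Longrightarrow> monoid_rep X M mul e F' mu' u' \<Longrightarrow> monoid_rep2 X M mul e F mu u F' mu' u'"
  by (simp add: monoid_rep2_def)

lemma star_comp:
  fixes X (structure)
  assumes F: "monoid_rep X M mul e F mu u" and F': "monoid_rep X M mul e F' mu' u'"
    and F'': "monoid_rep X M mul e F'' mu'' u''"
    and [simp]: "a \<in> M" "a' \<in> M" "a'' \<in> M" "b \<in> M" "b' \<in> M" "b'' \<in> M"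
      "x \<in> Arr X" "Dom X x = F a" "Cod X x = F' a'" "y \<in> Arr X" "Dom X y = F b" "Cod X y = F' b'"
      "x' \<in> Arr X" "Dom X x' = F' a'" "Cod X x' = F'' a''"
      "y' \<in> Arr X" "Dom X y' = F' b'" "Cod X y' = F'' b''"
  shows "star X mu' mu'' a' a'' x' b' b'' y' \<cdot> star X mu mu' a a' x b b' y
    = star X mu mu'' a a'' (x' \<cdot> x) b b'' (y' \<cdot> y)"
proof -
  interpret F: monoid_rep X M mul e F mu u by fact
  interpret F': monoid_rep X M mul e F' mu' u' by fact
  interpret F'': monoid_rep X M mul e F'' mu'' u'' by fact
  show ?thesis by (simp add: star_def F.merge)
qed

context monoid_rep
begin

sublocale self: monoid_rep2 X M mul e F mu u F mu u
  by unfold_locales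

lemma star_idt [simp]: "\<lbrakk>a \<in> M; b \<in> M\<rbrakk> \<Longrightarrow> star X mu mu a a (Idt X (F a)) b b (Idt X (F b)) = Idt X (F (mul a b))"
  by (simp add: star_def)

lemma star_idt_left [simp]:
  "\<lbrakk>a \<in> M; a' \<in> M; x \<in> Arr X; Dom X x = F a; Cod X x = F a'\<rbrakk> \<Longrightarrow> star X mu mu e e (Idt X (F e)) a a' x = x"
  using self.star_unit_left[of a a' x] by simp

lemma star_idt_right [simp]:
  "\<lbrakk>a \<in> M; a' \<in> M; x \<in> Arr X; Dom X x = F a; Cod X x = F a'\<rbrakk> \<Longrightarrow> star X mu mu a a' x e e (Idt X (F e)) = x"
  using self.star_unit_right[of a a' x] by simp

lemma is_right_dual_star:
  assumes [simp]: "P \<in> M" "Y \<in> M" "x \<in> Arr X" "Dom X x = F (mul P Y)" "Cod X x = F e"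
    "y \<in> Arr X" "Dom X y = F e" "Cod X y = F (mul Y P)"
  shows "is_right_dual X (F P) (F Y) (inv_arr X u \<cdot> (x \<cdot> mu P Y)) (inv_arr X (mu Y P) \<cdot> (y \<cdot> u)) \<longleftrightarrow>
     star X mu mu (mul P Y) e x P P (Idt X (F P)) \<cdot> star X mu mu P P (Idt X (F P)) e (mul Y P) y = Idt X (F P) \<and>
     star X mu mu Y Y (Idt X (F Y)) (mul P Y) e x \<cdot> star X mu mu e (mul Y P) y Y Y (Idt X (F Y)) = Idt X (F Y)"
    (is "is_right_dual X _ _ ?x ?y \<longleftrightarrow> ?S = _ \<and> ?T = _")
proof -
  have ar [simp]: "?S \<in> Arr X" "Dom X ?S = F P" "Cod X ?S = F P" "?T \<in> Arr X" "Dom X ?T = F Y" "Cod X ?T = F Y"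
    by simp_all
  have a1: "(mu P Y \<boxtimes> Idt X (F P)) \<cdot> inv_arr X (Assoc X (F P) (F Y) (F P))
      = inv_arr X (mu (mul P Y) P) \<cdot> (mu P (mul Y P) \<cdot> (Idt X (F P) \<boxtimes> mu Y P))"
  proof -
    have "mu P Y \<boxtimes> Idt X (F P) = inv_arr X (mu (mul P Y) P)
        \<cdot> (mu P (mul Y P) \<cdot> ((Idt X (F P) \<boxtimes> mu Y P) \<cdot> Assoc X (F P) (F Y) (F P)))"
      by (rule iso_move_left) (auto simp: mu_assoc)
    then show ?thesis by simp
  qed
  have a2: "(Idt X (F Y) \<boxtimes> mu P Y) \<cdot> Assoc X (F Y) (F P) (F Y)
      = inv_arr X (mu Y (mul P Y)) \<cdot> (mu (mul Y P) Y \<cdot> (mu Y P \<boxtimes> Idt X (F Y)))"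
    by (rule iso_move_left) (auto simp: mu_assoc)
  have 1: "LUnit X (F P) \<cdot> ((?x \<boxtimes> Idt X (F P)) \<cdot> (inv_arr X (Assoc X (F P) (F Y) (F P)) \<cdot> (Idt X (F P) \<boxtimes> ?y)))
      = ?S \<cdot> RUnit X (F P)"
  proof -
    have "LUnit X (F P) \<cdot> ((?x \<boxtimes> Idt X (F P)) \<cdot> (inv_arr X (Assoc X (F P) (F Y) (F P)) \<cdot> (Idt X (F P) \<boxtimes> ?y)))
      = mu e P \<cdot> ((u \<boxtimes> Idt X (F P)) \<cdot> ((?x \<boxtimes> Idt X (F P))
        \<cdot> (inv_arr X (Assoc X (F P) (F Y) (F P)) \<cdot> (Idt X (F P) \<boxtimes> ?y))))"
      by (simp add: reassoc[OF mu_lunit])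
    also have "\<dots> = mu e P \<cdot> ((x \<boxtimes> Idt X (F P)) \<cdot> ((mu P Y \<boxtimes> Idt X (F P))
        \<cdot> (inv_arr X (Assoc X (F P) (F Y) (F P)) \<cdot> (Idt X (F P) \<boxtimes> ?y))))"
      by (simp add: merge)
    also have "\<dots> = mu e P \<cdot> ((x \<boxtimes> Idt X (F P)) \<cdot> (inv_arr X (mu (mul P Y) P) \<cdot> (mu P (mul Y P)
        \<cdot> ((Idt X (F P) \<boxtimes> mu Y P) \<cdot> (Idt X (F P) \<boxtimes> ?y)))))"
      by (simp add: reassoc[OF a1])
    also have "\<dots> = mu e P \<cdot> ((x \<boxtimes> Idt X (F P)) \<cdot> (inv_arr X (mu (mul P Y) P) \<cdot> (mu P (mul Y P)
        \<cdot> ((Idt X (F P) \<boxtimes> y) \<cdot> (Idt X (F P) \<boxtimes> u)))))"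
      by (simp add: merge)
    also have "\<dots> = ?S \<cdot> RUnit X (F P)"
      by (simp add: star_def mu_runit[symmetric])
    finally show ?thesis .
  qed
  have 2: "RUnit X (F Y) \<cdot> ((Idt X (F Y) \<boxtimes> ?x) \<cdot> (Assoc X (F Y) (F P) (F Y) \<cdot> (?y \<boxtimes> Idt X (F Y))))
      = ?T \<cdot> LUnit X (F Y)"
  proof -
    have "RUnit X (F Y) \<cdot> ((Idt X (F Y) \<boxtimes> ?x) \<cdot> (Assoc X (F Y) (F P) (F Y) \<cdot> (?y \<boxtimes> Idt X (F Y))))
      = mu Y e \<cdot> ((Idt X (F Y) \<boxtimes> u) \<cdot> ((Idt X (F Y) \<boxtimes> ?x)
        \<cdot> (Assoc X (F Y) (F P) (F Y) \<cdot> (?y \<boxtimes> Idt X (F Y)))))"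
      by (simp add: reassoc[OF mu_runit])
    also have "\<dots> = mu Y e \<cdot> ((Idt X (F Y) \<boxtimes> x) \<cdot> ((Idt X (F Y) \<boxtimes> mu P Y)
        \<cdot> (Assoc X (F Y) (F P) (F Y) \<cdot> (?y \<boxtimes> Idt X (F Y)))))"
      by (simp add: merge)
    also have "\<dots> = mu Y e \<cdot> ((Idt X (F Y) \<boxtimes> x) \<cdot> (inv_arr X (mu Y (mul P Y)) \<cdot> (mu (mul Y P) Y
        \<cdot> ((mu Y P \<boxtimes> Idt X (F Y)) \<cdot> (?y \<boxtimes> Idt X (F Y))))))"
      by (simp add: reassoc[OF a2])
    also have "\<dots> = mu Y e \<cdot> ((Idt X (F Y) \<boxtimes> x) \<cdot> (inv_arr X (mu Y (mul P Y)) \<cdot> (mu (mul Y P) Y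
        \<cdot> ((y \<boxtimes> Idt X (F Y)) \<cdot> (u \<boxtimes> Idt X (F Y))))))"
      by (simp add: merge)
    also have "\<dots> = ?T \<cdot> LUnit X (F Y)"
      by (simp add: star_def mu_lunit[symmetric])
    finally show ?thesis .
  qed
  show ?thesis
  proof
    assume d: "is_right_dual X (F P) (F Y) ?x ?y"
    have "?S \<cdot> RUnit X (F P) = Idt X (F P) \<cdot> RUnit X (F P)"
      using triangle_left[OF d] unfolding 1 by simp
    then have S: "?S = Idt X (F P)" by (rule iso_cancel_right[rotated]) (simp_all del: comp_assoc_right)
    have "?T \<cdot> LUnit X (F Y) = Idt X (F Y) \<cdot> LUnit X (F Y)"
      using triangle_right[OF d] unfolding 2 by simp
    then have "?T = Idt X (F Y)" by (rule iso_cancel_right[rotated]) (simp_all del: comp_assoc_right)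
    with S show "?S = Idt X (F P) \<and> ?T = Idt X (F Y)" by blast
  next
    assume ST: "?S = Idt X (F P) \<and> ?T = Idt X (F Y)"
    show "is_right_dual X (F P) (F Y) ?x ?y"
      by (rule is_right_dualI) (simp_all only: 1 2 ST, simp_all)
  qed
qed

end

locale strict_source = strong_monoidal_functor D X F + strict: strict_monoidal_category D
  for D :: "('o, 'm) moncat" and X :: "('p, 'q) moncat" and F :: "('o, 'm, 'p, 'q) monfun"
begin

sublocale rep: monoid_rep X "Obj D" "TenO D" "\<I>\<^bsub>D\<^esub>" "ob_map F" "\<lambda>A B. mult F (A, B)" "unit_map F"
proof
  fix a b c assume [simp]: "a \<in> Obj D" "b \<in> Obj D" "c \<in> Obj D"
  show "mult F (a \<otimes>\<^bsub>D\<^esub> b, c) \<cdot>\<^bsub>X\<^esub> (mult F (a, b) \<boxtimes>\<^bsub>X\<^esub> Idt X (ob_map F c))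
    = mult F (a, b \<otimes>\<^bsub>D\<^esub> c) \<cdot>\<^bsub>X\<^esub> ((Idt X (ob_map F a) \<boxtimes>\<^bsub>X\<^esub> mult F (b, c))
       \<cdot>\<^bsub>X\<^esub> Assoc X (ob_map F a) (ob_map F b) (ob_map F c))"
    using mult_assoc_right[of a b c] by simp
  show "mult F (\<I>\<^bsub>D\<^esub>, a) \<cdot>\<^bsub>X\<^esub> (unit_map F \<boxtimes>\<^bsub>X\<^esub> Idt X (ob_map F a)) = LUnit X (ob_map F a)"
    using mult_lunit_right[of a] by simp
  show "mult F (a, \<I>\<^bsub>D\<^esub>) \<cdot>\<^bsub>X\<^esub> (Idt X (ob_map F a) \<boxtimes>\<^bsub>X\<^esub> unit_map F) = RUnit X (ob_map F a)"
    using mult_runit_right[of a] by simp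
qed simp_all

abbreviation mu :: "'o \<Rightarrow> 'o \<Rightarrow> 'q" where "mu \<equiv> \<lambda>A B. mult F (A, B)"

lemma functor_ten:
  assumes [simp]: "f \<in> Arr D" "g \<in> Arr D"
  shows "ar_map F (f \<boxtimes>\<^bsub>D\<^esub> g) = star X mu mu (Dom D f) (Cod D f) (ar_map F f) (Dom D g) (Cod D g) (ar_map F g)"
  by (rule rep.self.star_eqI)
     (use mult_nat[of f "Dom D f" "Cod D f" g "Dom D g" "Cod D g"] in auto)

lemma preserves_dual:
  assumes d: "is_right_dual D P Y e h"
  shows "is_right_dual X (ob_map F P) (ob_map F Y)
    (inv_arr X (unit_map F) \<cdot>\<^bsub>X\<^esub> (ar_map F e \<cdot>\<^bsub>X\<^esub> mu P Y)) (inv_arr X (mu Y P) \<cdot>\<^bsub>X\<^esub> (ar_map F h \<cdot>\<^bsub>X\<^esub> unit_map F))"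
proof -
  note [simp] = dom.is_right_dual_arr[OF d]
  have "ar_map F ((e \<boxtimes>\<^bsub>D\<^esub> Idt D P) \<cdot>\<^bsub>D\<^esub> (Idt D P \<boxtimes>\<^bsub>D\<^esub> h)) = Idt X (ob_map F P)"
    "ar_map F ((Idt D Y \<boxtimes>\<^bsub>D\<^esub> e) \<cdot>\<^bsub>D\<^esub> (h \<boxtimes>\<^bsub>D\<^esub> Idt D Y)) = Idt X (ob_map F Y)"
    using d by (simp_all add: strict.is_right_dual_strict del: functor_comp)
  then show ?thesis
    by (subst rep.is_right_dual_star) (simp_all add: functor_ten)
qed

end

section \<open>The strict monoidal category obtained by adjoining a dual\<close>

lemma strict_monoidal_categoryI:
  fixes C :: "('o, 'm, 'z) moncat_scheme" (structure)
  assumes "category C"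
    and [simp]: "\<I> \<in> Obj C" "\<And>A B. \<lbrakk>A \<in> Obj C; B \<in> Obj C\<rbrakk> \<Longrightarrow> A \<otimes> B \<in> Obj C"
    and ten_arr [simp]: "\<And>f g. \<lbrakk>f \<in> Arr C; g \<in> Arr C\<rbrakk> \<Longrightarrow> f \<boxtimes> g \<in> Arr C"
      "\<And>f g. \<lbrakk>f \<in> Arr C; g \<in> Arr C\<rbrakk> \<Longrightarrow> Dom C (f \<boxtimes> g) = Dom C f \<otimes> Dom C g"
      "\<And>f g. \<lbrakk>f \<in> Arr C; g \<in> Arr C\<rbrakk> \<Longrightarrow> Cod C (f \<boxtimes> g) = Cod C f \<otimes> Cod C g"
    and [simp]: "\<And>A B. \<lbrakk>A \<in> Obj C; B \<in> Obj C\<rbrakk> \<Longrightarrow> Idt C A \<boxtimes> Idt C B = Idt C (A \<otimes> B)"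
    and ten_comp: "\<And>f g f' g'. \<lbrakk>f \<in> Arr C; g \<in> Arr C; f' \<in> Arr C; g' \<in> Arr C; Dom C g = Cod C f; Dom C g' = Cod C f'\<rbrakk>
          \<Longrightarrow> (g \<cdot> f) \<boxtimes> (g' \<cdot> f') = (g \<boxtimes> g') \<cdot> (f \<boxtimes> f')"
    and [simp]: "\<And>A B D. \<lbrakk>A \<in> Obj C; B \<in> Obj C; D \<in> Obj C\<rbrakk> \<Longrightarrow> (A \<otimes> B) \<otimes> D = A \<otimes> (B \<otimes> D)"
      "\<And>A. A \<in> Obj C \<Longrightarrow> \<I> \<otimes> A = A" "\<And>A. A \<in> Obj C \<Longrightarrow> A \<otimes> \<I> = A"
      "\<And>f g h. \<lbrakk>f \<in> Arr C; g \<in> Arr C; h \<in> Arr C\<rbrakk> \<Longrightarrow> (f \<boxtimes> g) \<boxtimes> h = f \<boxtimes> (g \<boxtimes> h)"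
      "\<And>f. f \<in> Arr C \<Longrightarrow> Idt C \<I> \<boxtimes> f = f" "\<And>f. f \<in> Arr C \<Longrightarrow> f \<boxtimes> Idt C \<I> = f"
      "\<And>A B D. \<lbrakk>A \<in> Obj C; B \<in> Obj C; D \<in> Obj C\<rbrakk> \<Longrightarrow> Assoc C A B D = Idt C (A \<otimes> (B \<otimes> D))"
      "\<And>A. A \<in> Obj C \<Longrightarrow> LUnit C A = Idt C A" "\<And>A. A \<in> Obj C \<Longrightarrow> RUnit C A = Idt C A"
  shows "strict_monoidal_category C"
proof -
  interpret category C by fact
  show ?thesis
    by unfold_locales (auto simp: ten_comp)
qed

locale dual_adjunction = strict_monoidal_category C for C :: "('o, 'm) moncat" (structure) +
  fixes J :: 'o
  assumes J_obj [simp]: "J \<in> Obj C"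
begin

abbreviation vten :: "'o list \<Rightarrow> 'o list \<Rightarrow> 'o list"  (infixr "\<star>" 70) where
  "U \<star> V \<equiv> dten C U V"

lemma dten_singleton [simp]: "[a] \<star> (b # V) = (a \<otimes> b) # V"
  and dten_Cons [simp]: "U \<noteq> [] \<Longrightarrow> (a # U) \<star> V = a # (U \<star> V)"
  by (simp_all add: dten_def)

lemma dten_nonempty [simp]: "U \<star> V \<noteq> []"
  by (simp add: dten_def)

lemma Cons_in_dverts [simp]: "a # U \<in> dverts C \<longleftrightarrow> a \<in> Obj C \<and> (U = [] \<or> U \<in> dverts C)"
  by (auto simp: dverts_def)

lemma Nil_notin_dverts [simp]: "[] \<notin> dverts C"
  by (simp add: dverts_def)

lemma dverts_induct [consumes 1, case_names single Cons]:
  assumes "U \<in> dverts C" "\<And>a. a \<in> Obj C \<Longrightarrow> P [a]"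
    "\<And>a U. \<lbrakk>a \<in> Obj C; U \<in> dverts C; P U\<rbrakk> \<Longrightarrow> P (a # U)"
  shows "P U"
  using assms(1)
proof (induction U)
  case (Cons a U)
  then show ?case using assms(2,3) by (cases "U = []") auto
qed simp

lemma dverts_cases [consumes 1, case_names single Cons]:
  assumes "U \<in> dverts C"
  obtains a where "U = [a]" "a \<in> Obj C" | a V where "U = a # V" "a \<in> Obj C" "V \<in> dverts C"
  using assms by (cases U) auto

lemma dten_in [simp]: "\<lbrakk>U \<in> dverts C; V \<in> dverts C\<rbrakk> \<Longrightarrow> U \<star> V \<in> dverts C"
proof (induction U rule: dverts_induct)
  case (single a)
  then show ?case by (cases V) auto
next
  case (Cons a U)
  moreover have "U \<noteq> []" using Cons by auto
  ultimately show ?case by simp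
qed

lemma dten_assoc [simp]:
  assumes "U \<in> dverts C" "V \<in> dverts C" "W \<in> dverts C"
  shows "(U \<star> V) \<star> W = U \<star> (V \<star> W)"
  using assms(1)
proof (induction U rule: dverts_induct)
  case (single a)
  show ?case using assms(2)
  proof (cases rule: dverts_cases)
    case (single b)
    then show ?thesis using \<open>a \<in> Obj C\<close> assms(3) by (cases W) auto
  next
    case (Cons b V')
    moreover have "V' \<noteq> []" using Cons by auto
    ultimately show ?thesis by simp
  qed
next
  case (Cons a U)
  moreover have "U \<noteq> []" using Cons by auto
  ultimately show ?case by simp
qed

lemma dunit_in [simp]: "dunit C \<in> dverts C" and Jdual_in [simp]: "Jdual C \<in> dverts C"
  by (simp_all add: dunit_def Jdual_def)

lemma dten_dunit_left [simp]: "U \<in> dverts C \<Longrightarrow> dunit C \<star> U = U"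
  by (cases U) (auto simp: dunit_def)

lemma dten_dunit_right [simp]: "U \<in> dverts C \<Longrightarrow> U \<star> dunit C = U"
  by (induction U rule: dverts_induct) (auto simp: dunit_def dten_def)

lemma Cons_eq_dten:
  assumes "a \<in> Obj C" "U \<in> dverts C"
  shows "a # U = [a] \<star> (Jdual C \<star> U)"
proof -
  obtain b V where "U = b # V" using assms(2) by (cases U) auto
  then show ?thesis using assms by (simp add: Jdual_def)
qed

lemma prim_in [simp]:
  assumes "set_prim p \<subseteq> Arr C"
  shows "prim_src C J p \<in> dverts C" "prim_tgt C J p \<in> dverts C"
  using assms by (cases p; simp)+

lemma dedges_iff: "(U, p, V) \<in> dedges C \<longleftrightarrow> U \<in> dverts C \<and> V \<in> dverts C \<and> set_prim p \<subseteq> Arr C"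
  by (cases p) (auto simp: dedges_def)

lemma edge_in [simp]:
  assumes "a \<in> dedges C"
  shows "edge_src C J a \<in> dverts C" "edge_tgt C J a \<in> dverts C"
  using assms by (cases a; simp add: dedges_iff edge_src_def edge_tgt_def)+

lemma whisk_edge [simp]:
  assumes "a \<in> dedges C" "T \<in> dverts C" "W \<in> dverts C"
  shows "whisk C T a W \<in> dedges C"
    "edge_src C J (whisk C T a W) = T \<star> edge_src C J a \<star> W"
    "edge_tgt C J (whisk C T a W) = T \<star> edge_tgt C J a \<star> W"
  using assms by (cases a; simp add: dedges_iff edge_src_def edge_tgt_def whisk_def)+

lemma whisk_whisk [simp]:
  assumes "a \<in> dedges C" "T \<in> dverts C" "W \<in> dverts C" "T' \<in> dverts C" "W' \<in> dverts C"
  shows "whisk C T' (whisk C T a W) W' = whisk C (T' \<star> T) a (W \<star> W')"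
  using assms by (cases a) (simp add: dedges_iff whisk_def)

lemma whisk_dunit [simp]: "a \<in> dedges C \<Longrightarrow> whisk C (dunit C) a (dunit C) = a"
  by (cases a) (simp add: dedges_iff whisk_def)

lemma prim_edge [simp]:
  assumes "set_prim p \<subseteq> Arr C"
  shows "prim_edge C p \<in> dedges C" "edge_src C J (prim_edge C p) = prim_src C J p"
    "edge_tgt C J (prim_edge C p) = prim_tgt C J p"
  using assms by (auto simp: prim_edge_def dedges_iff edge_src_def edge_tgt_def)

lemma dpath_in:
  "dpath C J U es V \<Longrightarrow> U \<in> dverts C \<and> V \<in> dverts C \<and> set es \<subseteq> dedges C"
  by (induction es arbitrary: U) auto

lemma dpath_append: "dpath C J U (es @ fs) W \<longleftrightarrow> (\<exists>V. dpath C J U es V \<and> dpath C J V fs W)"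
  by (induction es arbitrary: U) (auto dest: dpath_in)

lemma dpath_whisk:
  assumes "T \<in> dverts C" "W \<in> dverts C"
  shows "dpath C J U es V \<Longrightarrow> dpath C J (T \<star> U \<star> W) (whisk_path C T es W) (T \<star> V \<star> W)"
  using assms by (induction es arbitrary: U) (auto simp: whisk_path_def)

lemma dpath_whisk_left:
  assumes "T \<in> dverts C" "dpath C J U es V"
  shows "dpath C J (T \<star> U) (whisk_path C T es (dunit C)) (T \<star> V)"
  using dpath_whisk[of T "dunit C" U es V] assms dpath_in[OF assms(2)] by simp

lemma dpath_whisk_right:
  assumes "T \<in> dverts C" "dpath C J U es V"
  shows "dpath C J (U \<star> T) (whisk_path C (dunit C) es T) (V \<star> T)"
  using dpath_whisk[of "dunit C" T U es V] assms dpath_in[OF assms(2)] by simp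

lemma whisk_path_simps [simp]:
  "whisk_path C T [] W = []"
  "whisk_path C T (a # es) W = whisk C T a W # whisk_path C T es W"
  "whisk_path C T (es @ fs) W = whisk_path C T es W @ whisk_path C T fs W"
  by (simp_all add: whisk_path_def)

lemma whisk_path_whisk_path [simp]:
  assumes "set es \<subseteq> dedges C" "T \<in> dverts C" "W \<in> dverts C" "T' \<in> dverts C" "W' \<in> dverts C"
  shows "whisk_path C T' (whisk_path C T es W) W' = whisk_path C (T' \<star> T) es (W \<star> W')"
  using assms by (induction es) auto

lemma whisk_path_dunit [simp]: "set es \<subseteq> dedges C \<Longrightarrow> whisk_path C (dunit C) es (dunit C) = es"
  by (induction es) auto

lemma base_rel_dpath: "base_rel C J U es es' V \<Longrightarrow> dpath C J U es V \<and> dpath C J U es' V"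
proof (induction rule: base_rel.induct)
  case (interchange a b U V W X)
  then show ?case by simp
qed (auto simp: Jdual_def dunit_def)

lemma dcong_dpath: "dcong C J U es es' V \<Longrightarrow> dpath C J U es V \<and> dpath C J U es' V"
proof (induction rule: dcong.induct)
  case (whisker U es es' V Y Z)
  have "dpath C J U es V" "dpath C J U es' V" using base_rel_dpath[OF whisker(1)] by auto
  then have "dpath C J (Y \<star> U \<star> Z) (whisk_path C Y es Z) (Y \<star> V \<star> Z)"
    "dpath C J (Y \<star> U \<star> Z) (whisk_path C Y es' Z) (Y \<star> V \<star> Z)" "U \<in> dverts C" "V \<in> dverts C"
    using dpath_whisk[OF whisker(2,3)] dpath_in by auto
  then show ?case using whisker(2,3) by simp
next
  case (append U es es' V fs fs' W)
  then show ?case unfolding dpath_append by blast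
qed (auto simp: base_rel_dpath)

lemma dcong_whisk:
  assumes "T \<in> dverts C" "W \<in> dverts C"
  shows "dcong C J U es es' V \<Longrightarrow>
    dcong C J (T \<star> U \<star> W) (whisk_path C T es W) (whisk_path C T es' W) (T \<star> V \<star> W)"
proof (induction rule: dcong.induct)
  case (base U es es' V)
  then show ?case
    using dcong.whisker[OF base assms] base_rel_dpath[OF base] dpath_in assms by auto
next
  case (whisker U es es' V Y Z)
  have *: "U \<in> dverts C" "V \<in> dverts C" "set es \<subseteq> dedges C" "set es' \<subseteq> dedges C"
    using base_rel_dpath[OF whisker(1)] dpath_in by blast+
  show ?case
    using dcong.whisker[OF whisker(1), of "T \<star> Y" "Z \<star> W"] * whisker(2,3) assms by simp
next
  case (refl U es V)
  then show ?case using assms by (intro dcong.refl dpath_whisk)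
next
  case (sym U es es' V)
  then show ?case by (metis dcong.sym)
next
  case (trans U es es' V es'')
  then show ?case by (blast intro: dcong.trans)
next
  case (append U es es' V fs fs' W)
  then show ?case by (simp add: dcong.append)
qed

lemma dcong_whisk_left:
  assumes "T \<in> dverts C" "dcong C J U es es' V"
  shows "dcong C J (T \<star> U) (whisk_path C T es (dunit C)) (whisk_path C T es' (dunit C)) (T \<star> V)"
  using dcong_whisk[of T "dunit C" U es es' V] assms dcong_dpath[OF assms(2)] dpath_in by auto

lemma dcong_whisk_right:
  assumes "T \<in> dverts C" "dcong C J U es es' V"
  shows "dcong C J (U \<star> T) (whisk_path C (dunit C) es T) (whisk_path C (dunit C) es' T) (V \<star> T)"
  using dcong_whisk[of "dunit C" T U es es' V] assms dcong_dpath[OF assms(2)] dpath_in by auto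

lemma edge_path_interchange:
  assumes a: "a \<in> dedges C" "edge_src C J a = U" "edge_tgt C J a = V"
  shows "dpath C J W fs X \<Longrightarrow> dcong C J (U \<star> W)
    (whisk C (dunit C) a W # whisk_path C V fs (dunit C)) (whisk_path C U fs (dunit C) @ [whisk C (dunit C) a X])
    (V \<star> X)"
proof (induction fs arbitrary: W)
  case Nil
  then show ?case using a by (auto intro!: dcong.refl)
next
  case (Cons b fs)
  let ?W = "edge_tgt C J b"
  have b: "b \<in> dedges C" "edge_src C J b = W" "dpath C J ?W fs X" using Cons.prems by auto
  have UV: "U \<in> dverts C" "V \<in> dverts C" using a by auto
  have "dcong C J (U \<star> W) [whisk C (dunit C) a W, whisk C V b (dunit C)]
      [whisk C U b (dunit C), whisk C (dunit C) a ?W] (V \<star> ?W)"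
    using a b by (intro dcong.base base_rel.interchange) auto
  then have 1: "dcong C J (U \<star> W) ([whisk C (dunit C) a W, whisk C V b (dunit C)] @ whisk_path C V fs (dunit C))
      ([whisk C U b (dunit C), whisk C (dunit C) a ?W] @ whisk_path C V fs (dunit C)) (V \<star> X)"
    using b UV by (intro dcong.append[OF _ dcong.refl[OF dpath_whisk_left]]) auto
  have "dcong C J (U \<star> W) [whisk C U b (dunit C)] [whisk C U b (dunit C)] (U \<star> ?W)"
    using b UV by (intro dcong.refl) auto
  then have 2: "dcong C J (U \<star> W) ([whisk C U b (dunit C)] @ (whisk C (dunit C) a ?W # whisk_path C V fs (dunit C)))
      ([whisk C U b (dunit C)] @ (whisk_path C U fs (dunit C) @ [whisk C (dunit C) a X])) (V \<star> X)"
    by (rule dcong.append) (rule Cons.IH[OF b(3)])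
  show ?case using dcong.trans[OF 1] 2 by simp
qed

lemma path_interchange:
  assumes fs: "dpath C J W fs X"
  shows "dpath C J U es V \<Longrightarrow> dcong C J (U \<star> W)
    (whisk_path C (dunit C) es W @ whisk_path C V fs (dunit C))
    (whisk_path C U fs (dunit C) @ whisk_path C (dunit C) es X) (V \<star> X)"
proof (induction es arbitrary: U)
  case Nil
  then show ?case using fs by (auto intro!: dcong.refl dpath_whisk_left)
next
  case (Cons a es)
  let ?V = "edge_tgt C J a"
  have a: "a \<in> dedges C" "edge_src C J a = U" "dpath C J ?V es V" using Cons.prems by auto
  have W: "W \<in> dverts C" "X \<in> dverts C" using dpath_in[OF fs] by auto
  have "dcong C J (U \<star> W) [whisk C (dunit C) a W] [whisk C (dunit C) a W] (?V \<star> W)"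
    using a W by (intro dcong.refl) auto
  then have 1: "dcong C J (U \<star> W) ([whisk C (dunit C) a W] @ (whisk_path C (dunit C) es W @ whisk_path C V fs (dunit C)))
      ([whisk C (dunit C) a W] @ (whisk_path C ?V fs (dunit C) @ whisk_path C (dunit C) es X)) (V \<star> X)"
    by (rule dcong.append) (rule Cons.IH[OF a(3)])
  have 2: "dcong C J (U \<star> W) ((whisk C (dunit C) a W # whisk_path C ?V fs (dunit C)) @ whisk_path C (dunit C) es X)
      ((whisk_path C U fs (dunit C) @ [whisk C (dunit C) a X]) @ whisk_path C (dunit C) es X) (V \<star> X)"
    using a W fs by (intro dcong.append[OF edge_path_interchange dcong.refl[OF dpath_whisk_right]]) auto
  show ?case using dcong.trans[OF 1] 2 by simp
qed

lemma dclass_eqI: "dcong C J U es es' V \<Longrightarrow> dclass C J U es V = dclass C J U es' V"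
  unfolding dclass_def by (auto intro: dcong.trans dcong.sym)

lemma dclass_comp:
  assumes "dpath C J U es V" "dpath C J V fs W"
  shows "darr_comp C J (dclass C J V fs W) (dclass C J U es V) = dclass C J U (es @ fs) W"
  using assms unfolding darr_comp_def dclass_def
  by (auto intro: dcong.trans dcong.append dcong.refl)

lemma dclass_ten:
  assumes es: "dpath C J U es V" and fs: "dpath C J W fs X"
  shows "darr_ten C J (dclass C J U es V) (dclass C J W fs X)
    = dclass C J (U \<star> W) (whisk_path C (dunit C) es W @ whisk_path C V fs (dunit C)) (V \<star> X)"
proof -
  have W: "W \<in> dverts C" and V: "V \<in> dverts C" using dpath_in es fs by auto
  have "dcong C J (U \<star> W) (whisk_path C (dunit C) es W @ whisk_path C V fs (dunit C))
     (whisk_path C (dunit C) es' W @ whisk_path C V fs' (dunit C)) (V \<star> X)"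
    if "dcong C J U es es' V" "dcong C J W fs fs' X" for es' fs'
    using that V W by (intro dcong.append[OF dcong_whisk_right dcong_whisk_left])
  then show ?thesis
    unfolding darr_ten_def dclass_def using es fs
    by (auto intro: dcong.trans dcong.refl)
qed

abbreviation (input) A :: "('o list, ('o, 'm) darr) moncat" where "A \<equiv> adjoin_dual C J"

lemma adjoin_dual_simps [simp]:
  "Obj A = dverts C" "Idt A U = dclass C J U [] U" "Comp A = darr_comp C J" "TenO A = dten C"
  "TenA A = darr_ten C J" "Unit A = dunit C"
  "Assoc A U V W = dclass C J (U \<star> V \<star> W) [] (U \<star> V \<star> W)"
  "LUnit A U = dclass C J U [] U" "RUnit A U = dclass C J U [] U"
  "Dom A (dclass C J U es V) = U" "Cod A (dclass C J U es V) = V"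
  by (simp_all add: adjoin_dual_def dclass_def)

lemma dclass_arr [simp]: "dpath C J U es V \<Longrightarrow> dclass C J U es V \<in> Arr A"
  by (auto simp: adjoin_dual_def)

lemma adjoin_dual_arrE:
  assumes "f \<in> Arr A"
  obtains U es V where "f = dclass C J U es V" "dpath C J U es V" "U \<in> dverts C" "V \<in> dverts C" "set es \<subseteq> dedges C"
  using assms dpath_in by (auto simp: adjoin_dual_def)

lemma category_adjoin_dual: "category A"
proof
  fix f g B D E
  assume "f \<in> Hom A B D" "g \<in> Hom A D E"
  then obtain es fs where "f = dclass C J B es D" "dpath C J B es D" "g = dclass C J D fs E" "dpath C J D fs E"
    by (auto elim!: adjoin_dual_arrE)
  then show "g \<cdot>\<^bsub>A\<^esub> f \<in> Hom A B E"
    by (auto simp: dclass_comp dpath_append intro!: dclass_arr)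
next
  fix f g h B D E G
  assume "f \<in> Hom A B D" "g \<in> Hom A D E" "h \<in> Hom A E G"
  then obtain es fs gs where *: "f = dclass C J B es D" "dpath C J B es D" "g = dclass C J D fs E" "dpath C J D fs E"
    "h = dclass C J E gs G" "dpath C J E gs G"
    by (auto elim!: adjoin_dual_arrE)
  then have "dpath C J B (es @ fs) E" "dpath C J D (fs @ gs) G" by (auto simp: dpath_append)
  with * show "h \<cdot>\<^bsub>A\<^esub> (g \<cdot>\<^bsub>A\<^esub> f) = (h \<cdot>\<^bsub>A\<^esub> g) \<cdot>\<^bsub>A\<^esub> f"
    by (simp add: dclass_comp)
qed (auto elim!: adjoin_dual_arrE simp: dclass_comp intro!: dclass_arr)

lemma strict_monoidal_adjoin_dual: "strict_monoidal_category A"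
proof (rule strict_monoidal_categoryI)
  show "category A" by (rule category_adjoin_dual)
next
  fix f g assume "f \<in> Arr A" "g \<in> Arr A"
  then obtain U es V W fs X where "f = dclass C J U es V" "dpath C J U es V" "g = dclass C J W fs X" "dpath C J W fs X"
    "W \<in> dverts C" "V \<in> dverts C"
    by (auto elim!: adjoin_dual_arrE)
  moreover from this have "dpath C J (U \<star> W) (whisk_path C (dunit C) es W @ whisk_path C V fs (dunit C)) (V \<star> X)"
    unfolding dpath_append by (blast intro: dpath_whisk_left dpath_whisk_right)
  ultimately show "f \<boxtimes>\<^bsub>A\<^esub> g \<in> Arr A" "Dom A (f \<boxtimes>\<^bsub>A\<^esub> g) = Dom A f \<otimes>\<^bsub>A\<^esub> Dom A g"
    "Cod A (f \<boxtimes>\<^bsub>A\<^esub> g) = Cod A f \<otimes>\<^bsub>A\<^esub> Cod A g"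
    by (simp_all add: dclass_ten)
next
  fix f g f' g' assume "f \<in> Arr A" "g \<in> Arr A" "f' \<in> Arr A" "g' \<in> Arr A" "Dom A g = Cod A f" "Dom A g' = Cod A f'"
  then obtain U es V fs W U' es' V' fs' W' where *:
    "f = dclass C J U es V" "dpath C J U es V" "g = dclass C J V fs W" "dpath C J V fs W"
    "f' = dclass C J U' es' V'" "dpath C J U' es' V'" "g' = dclass C J V' fs' W'" "dpath C J V' fs' W'"
    by (auto elim!: adjoin_dual_arrE)
  have V: "U' \<in> dverts C" "V' \<in> dverts C" "W' \<in> dverts C" "V \<in> dverts C" "W \<in> dverts C" using * dpath_in by blast+
  note p = dpath_whisk_left[OF V(4) *(6)] dpath_whisk_left[OF V(5) *(6)] dpath_whisk_left[OF V(5) *(8)]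
    dpath_whisk_right[OF V(1) *(2)] dpath_whisk_right[OF V(1) *(4)] dpath_whisk_right[OF V(2) *(4)]
  have "dcong C J (V \<star> U') (whisk_path C (dunit C) fs U' @ whisk_path C W es' (dunit C))
      (whisk_path C V es' (dunit C) @ whisk_path C (dunit C) fs V') (W \<star> V')"
    by (rule path_interchange[OF *(6,4)])
  from dcong.append[OF dcong.refl[OF p(4)] dcong.append[OF this dcong.refl[OF p(3)]]]
  have "dclass C J (U \<star> U') (whisk_path C (dunit C) (es @ fs) U' @ whisk_path C W (es' @ fs') (dunit C)) (W \<star> W')
    = dclass C J (U \<star> U') ((whisk_path C (dunit C) es U' @ whisk_path C V es' (dunit C))
        @ (whisk_path C (dunit C) fs V' @ whisk_path C W fs' (dunit C))) (W \<star> W')"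
    by (intro dclass_eqI) simp
  moreover have "dpath C J U (es @ fs) W" "dpath C J U' (es' @ fs') W'"
    "dpath C J (U \<star> U') (whisk_path C (dunit C) es U' @ whisk_path C V es' (dunit C)) (V \<star> V')"
    "dpath C J (V \<star> V') (whisk_path C (dunit C) fs V' @ whisk_path C W fs' (dunit C)) (W \<star> W')"
    unfolding dpath_append using * p by blast+
  ultimately show "(g \<cdot>\<^bsub>A\<^esub> f) \<boxtimes>\<^bsub>A\<^esub> (g' \<cdot>\<^bsub>A\<^esub> f') = (g \<boxtimes>\<^bsub>A\<^esub> g') \<cdot>\<^bsub>A\<^esub> (f \<boxtimes>\<^bsub>A\<^esub> f')"
    using * by (simp add: dclass_comp dclass_ten del: append_assoc whisk_path_simps(3))
next
  fix f g h assume "f \<in> Arr A" "g \<in> Arr A" "h \<in> Arr A"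
  then obtain U es V W fs X Y gs Z where *:
    "f = dclass C J U es V" "dpath C J U es V" "g = dclass C J W fs X" "dpath C J W fs X"
    "h = dclass C J Y gs Z" "dpath C J Y gs Z"
    by (auto elim!: adjoin_dual_arrE)
  note d = dpath_in[OF *(2)] dpath_in[OF *(4)] dpath_in[OF *(6)]
  have "dpath C J (U \<star> W) (whisk_path C (dunit C) es W @ whisk_path C V fs (dunit C)) (V \<star> X)"
    "dpath C J (W \<star> Y) (whisk_path C (dunit C) fs Y @ whisk_path C X gs (dunit C)) (X \<star> Z)"
    unfolding dpath_append using * d dpath_whisk_left dpath_whisk_right by blast+
  then show "(f \<boxtimes>\<^bsub>A\<^esub> g) \<boxtimes>\<^bsub>A\<^esub> h = f \<boxtimes>\<^bsub>A\<^esub> (g \<boxtimes>\<^bsub>A\<^esub> h)"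
    using * d by (simp add: dclass_ten)
next
  fix f assume "f \<in> Arr A"
  then obtain U es V where "f = dclass C J U es V" "dpath C J U es V" "U \<in> dverts C" "V \<in> dverts C" "set es \<subseteq> dedges C"
    by (auto elim!: adjoin_dual_arrE)
  then show "Idt A \<I>\<^bsub>A\<^esub> \<boxtimes>\<^bsub>A\<^esub> f = f" "f \<boxtimes>\<^bsub>A\<^esub> Idt A \<I>\<^bsub>A\<^esub> = f"
    by (simp_all add: dclass_ten)
qed (simp_all add: dclass_ten)

definition eps :: "('o, 'm) darr" where
  "eps = dclass C J ([J] \<star> Jdual C) [prim_edge C Eps] (dunit C)"

definition eta :: "('o, 'm) darr" where
  "eta = dclass C J (dunit C) [prim_edge C Eta] (Jdual C \<star> [J])"

lemma dpath_eps_eta [simp]: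
  "dpath C J ([J] \<star> Jdual C) [prim_edge C Eps] (dunit C)"
  "dpath C J (dunit C) [prim_edge C Eta] (Jdual C \<star> [J])"
  by simp_all

lemma is_right_dual_adjoin_dual: "is_right_dual A [J] (Jdual C) eps eta"
proof -
  interpret A: strict_monoidal_category A by (rule strict_monoidal_adjoin_dual)
  have J: "[J] \<in> dverts C" "dpath C J [J] [] [J]" "dpath C J (Jdual C) [] (Jdual C)" by simp_all
  have p: "dpath C J ([J] \<star> Jdual C \<star> [J]) (whisk_path C (dunit C) [prim_edge C Eps] [J]) [J]"
    "dpath C J [J] (whisk_path C [J] [prim_edge C Eta] (dunit C)) ([J] \<star> Jdual C \<star> [J])"
    "dpath C J (Jdual C \<star> [J] \<star> Jdual C) (whisk_path C (Jdual C) [prim_edge C Eps] (dunit C)) (Jdual C)"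
    "dpath C J (Jdual C) (whisk_path C (dunit C) [prim_edge C Eta] (Jdual C)) (Jdual C \<star> [J] \<star> Jdual C)"
    using dpath_whisk_right[OF J(1) dpath_eps_eta(1)] dpath_whisk_left[OF J(1) dpath_eps_eta(2)]
      dpath_whisk_left[OF Jdual_in dpath_eps_eta(1)] dpath_whisk_right[OF Jdual_in dpath_eps_eta(2)] J(1)
    by (simp_all only: dten_assoc Jdual_in dunit_in dten_in dten_dunit_left dten_dunit_right)
  have t: "eps \<boxtimes>\<^bsub>A\<^esub> Idt A [J] = dclass C J ([J] \<star> Jdual C \<star> [J]) (whisk_path C (dunit C) [prim_edge C Eps] [J]) [J]"
    "Idt A [J] \<boxtimes>\<^bsub>A\<^esub> eta = dclass C J [J] (whisk_path C [J] [prim_edge C Eta] (dunit C)) ([J] \<star> Jdual C \<star> [J])"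
    "Idt A (Jdual C) \<boxtimes>\<^bsub>A\<^esub> eps = dclass C J (Jdual C \<star> [J] \<star> Jdual C) (whisk_path C (Jdual C) [prim_edge C Eps] (dunit C)) (Jdual C)"
    "eta \<boxtimes>\<^bsub>A\<^esub> Idt A (Jdual C) = dclass C J (Jdual C) (whisk_path C (dunit C) [prim_edge C Eta] (Jdual C)) (Jdual C \<star> [J] \<star> Jdual C)"
    unfolding eps_def eta_def adjoin_dual_simps
    by (subst dclass_ten[OF dpath_eps_eta(1) J(2)] dclass_ten[OF J(2) dpath_eps_eta(2)]
        dclass_ten[OF J(3) dpath_eps_eta(1)] dclass_ten[OF dpath_eps_eta(2) J(3)];
      simp only: dten_assoc Jdual_in dunit_in dten_in dten_dunit_left dten_dunit_right J(1)
        whisk_path_simps(1) append_Nil append_Nil2)+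
  have "(eps \<boxtimes>\<^bsub>A\<^esub> Idt A [J]) \<cdot>\<^bsub>A\<^esub> (Idt A [J] \<boxtimes>\<^bsub>A\<^esub> eta) = Idt A [J]"
    "(Idt A (Jdual C) \<boxtimes>\<^bsub>A\<^esub> eps) \<cdot>\<^bsub>A\<^esub> (eta \<boxtimes>\<^bsub>A\<^esub> Idt A (Jdual C)) = Idt A (Jdual C)"
    unfolding t unfolding adjoin_dual_simps dclass_comp[OF p(2,1)] dclass_comp[OF p(4,3)]
    using dcong.base[OF base_rel.triangle_J[of C J]] dcong.base[OF base_rel.triangle_Jdual[of C J]]
    by (auto intro!: dclass_eqI)
  then show ?thesis
    unfolding A.is_right_dual_strict
    by (simp add: dclass_arr eps_def eta_def del: dpath.simps)
qed

end

lemma strong_monoidal_functorI: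
  assumes "monoidal_category C" "monoidal_category D"
    and "\<And>A. A \<in> Obj C \<Longrightarrow> ob_map F A \<in> Obj D"
    and "\<And>f. f \<in> Arr C \<Longrightarrow> ar_map F f \<in> Hom D (ob_map F (Dom C f)) (ob_map F (Cod C f))"
    and "\<And>A. A \<in> Obj C \<Longrightarrow> ar_map F (Idt C A) = Idt D (ob_map F A)"
    and "\<And>f g. \<lbrakk>f \<in> Arr C; g \<in> Arr C; Dom C g = Cod C f\<rbrakk>
          \<Longrightarrow> ar_map F (g \<cdot>\<^bsub>C\<^esub> f) = ar_map F g \<cdot>\<^bsub>D\<^esub> ar_map F f"
    and m: "\<And>A B. \<lbrakk>A \<in> Obj C; B \<in> Obj C\<rbrakk>
          \<Longrightarrow> mult F (A, B) \<in> Hom D (ob_map F A \<otimes>\<^bsub>D\<^esub> ob_map F B) (ob_map F (A \<otimes>\<^bsub>C\<^esub> B))"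
      "\<And>A B. \<lbrakk>A \<in> Obj C; B \<in> Obj C\<rbrakk> \<Longrightarrow> is_iso D (mult F (A, B))"
    and mn: "\<And>f g. \<lbrakk>f \<in> Arr C; g \<in> Arr C\<rbrakk>
          \<Longrightarrow> ar_map F (f \<boxtimes>\<^bsub>C\<^esub> g) \<cdot>\<^bsub>D\<^esub> mult F (Dom C f, Dom C g)
              = mult F (Cod C f, Cod C g) \<cdot>\<^bsub>D\<^esub> (ar_map F f \<boxtimes>\<^bsub>D\<^esub> ar_map F g)"
    and u: "unit_map F \<in> Hom D \<I>\<^bsub>D\<^esub> (ob_map F \<I>\<^bsub>C\<^esub>)" "is_iso D (unit_map F)"
    and c: "\<And>A B E. \<lbrakk>A \<in> Obj C; B \<in> Obj C; E \<in> Obj C\<rbrakk>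
      \<Longrightarrow> ar_map F (Assoc C A B E) \<cdot>\<^bsub>D\<^esub> (mult F (A \<otimes>\<^bsub>C\<^esub> B, E) \<cdot>\<^bsub>D\<^esub> (mult F (A, B) \<boxtimes>\<^bsub>D\<^esub> Idt D (ob_map F E)))
        = mult F (A, B \<otimes>\<^bsub>C\<^esub> E) \<cdot>\<^bsub>D\<^esub> ((Idt D (ob_map F A) \<boxtimes>\<^bsub>D\<^esub> mult F (B, E))
            \<cdot>\<^bsub>D\<^esub> Assoc D (ob_map F A) (ob_map F B) (ob_map F E))"
      "\<And>A. A \<in> Obj C \<Longrightarrow> ar_map F (LUnit C A) \<cdot>\<^bsub>D\<^esub> (mult F (\<I>\<^bsub>C\<^esub>, A) \<cdot>\<^bsub>D\<^esub> (unit_map F \<boxtimes>\<^bsub>D\<^esub> Idt D (ob_map F A)))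
        = LUnit D (ob_map F A)"
      "\<And>A. A \<in> Obj C \<Longrightarrow> ar_map F (RUnit C A) \<cdot>\<^bsub>D\<^esub> (mult F (A, \<I>\<^bsub>C\<^esub>) \<cdot>\<^bsub>D\<^esub> (Idt D (ob_map F A) \<boxtimes>\<^bsub>D\<^esub> unit_map F))
        = RUnit D (ob_map F A)"
  shows "strong_monoidal_functor C D F"
proof -
  interpret C: monoidal_category C by fact
  interpret D: monoidal_category D by fact
  interpret is_functor C D F using assms(3-6) by unfold_locales auto
  have [simp]: "mult F (A, B) \<in> Arr D" "Dom D (mult F (A, B)) = ob_map F A \<otimes>\<^bsub>D\<^esub> ob_map F B"
    "Cod D (mult F (A, B)) = ob_map F (A \<otimes>\<^bsub>C\<^esub> B)" if "A \<in> Obj C" "B \<in> Obj C" for A B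
    using m[OF that] by auto
  have [simp]: "unit_map F \<in> Arr D" "Dom D (unit_map F) = \<I>\<^bsub>D\<^esub>" "Cod D (unit_map F) = ob_map F \<I>\<^bsub>C\<^esub>"
    using u by auto
  show ?thesis
    by unfold_locales (use mn c in \<open>auto simp: m u\<close>)
qed

locale pointed_functor = strong_monoidal_functor C D F
  for C :: "('o, 'm) moncat" and J :: 'o and D :: "('p, 'q) moncat" and K :: 'p
    and F :: "('o, 'm, 'p, 'q) monfun" and p :: 'q +
  assumes J_in [simp]: "J \<in> Obj C" and K_in [simp]: "K \<in> Obj D"
    and p_arr [simp]: "p \<in> Arr D" "Dom D p = ob_map F J" "Cod D p = K" "is_iso D p"
    and ext: "ob_map F \<in> extensional (Obj C)" "ar_map F \<in> extensional (Arr C)"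
      "mult F \<in> extensional (Obj C \<times> Obj C)"

lemma one_mor_iff: "one_mor C J D K (F, p) \<longleftrightarrow> pointed_functor C J D K F p"
  by (auto simp: one_mor_def pointed_functor_def pointed_functor_axioms_def in_J_def
      strong_monoidal_functor_def)

locale pointed_transformation =
  F: pointed_functor C J D K F p + G: pointed_functor C J D K G q
  for C :: "('o, 'm) moncat" and J :: 'o and D :: "('p, 'q) moncat" and K :: 'p
    and F :: "('o, 'm, 'p, 'q) monfun" and p :: 'q and G :: "('o, 'm, 'p, 'q) monfun" and q :: 'q +
  fixes s :: "'o \<Rightarrow> 'q"
  assumes component [simp]: "A \<in> Obj C \<Longrightarrow> s A \<in> Arr D" "A \<in> Obj C \<Longrightarrow> Dom D (s A) = ob_map F A"
      "A \<in> Obj C \<Longrightarrow> Cod D (s A) = ob_map G A"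
    and natural: "\<lbrakk>f \<in> Arr C; Dom C f = A\<rbrakk> \<Longrightarrow> ar_map G f \<cdot>\<^bsub>D\<^esub> s A = s (Cod C f) \<cdot>\<^bsub>D\<^esub> ar_map F f"
    and monoidal: "\<lbrakk>A \<in> Obj C; B \<in> Obj C\<rbrakk>
        \<Longrightarrow> s (A \<otimes>\<^bsub>C\<^esub> B) \<cdot>\<^bsub>D\<^esub> mult F (A, B) = mult G (A, B) \<cdot>\<^bsub>D\<^esub> (s A \<boxtimes>\<^bsub>D\<^esub> s B)"
    and unital: "s \<I>\<^bsub>C\<^esub> \<cdot>\<^bsub>D\<^esub> unit_map F = unit_map G"
    and pointed: "q \<cdot>\<^bsub>D\<^esub> s J = p"
    and s_ext: "s \<in> extensional (Obj C)"

lemma two_mor_iff: "two_mor C J D K (F, p) (G, q) s \<longleftrightarrow> pointed_transformation C J D K F p G q s"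
  by (auto simp: two_mor_def one_mor_iff pointed_transformation_def pointed_transformation_axioms_def
      monoidal_nat_trans_def nat_trans_def)

context pointed_transformation
begin

lemma natural_rev: "\<lbrakk>f \<in> Arr C; Cod C f = B\<rbrakk> \<Longrightarrow> s B \<cdot>\<^bsub>D\<^esub> ar_map F f = ar_map G f \<cdot>\<^bsub>D\<^esub> s (Dom C f)"
  using natural[of f] by simp

lemma J_iso: "is_iso D (s J)"
proof -
  have "s J = inv_arr D q \<cdot>\<^bsub>D\<^esub> p"
    using pointed by (intro F.cod.iso_move_left) auto
  then show ?thesis by (auto intro!: F.cod.iso_comp)
qed

end

section \<open>The 2-category structure\<close>

lemma jhom_simps [simp]:
  "Obj (jhom C J D K) = {F. one_mor C J D K F}"
  "Arr (jhom C J D K) = {(F, G, s). two_mor C J D K F G s}"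
  "Dom (jhom C J D K) (F, G, s) = F" "Cod (jhom C J D K) (F, G, s) = G"
  "Idt (jhom C J D K) F = (F, F, \<lambda>A \<in> Obj C. Idt D (ob_map (fst F) A))"
  "Comp (jhom C J D K) (G', H, t) (F, G, s) = (F, H, \<lambda>A \<in> Obj C. t A \<cdot>\<^bsub>D\<^esub> s A)"
  by (simp_all add: jhom_def)

lemma two_mor_one_mor: "two_mor C J D K F G s \<Longrightarrow> one_mor C J D K F \<and> one_mor C J D K G"
  by (cases F; cases G) (simp add: two_mor_def)

lemma two_mor_ext:
  assumes "two_mor C J D K F G s" "two_mor C J D K F' G' t" "\<And>A. A \<in> Obj C \<Longrightarrow> s A = t A"
  shows "s = t"
proof (rule extensionalityI)
  show "s \<in> extensional (Obj C)" "t \<in> extensional (Obj C)"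
    using assms(1,2) by (cases F; cases G; cases F'; cases G'; simp add: two_mor_def)+
qed (rule assms(3))

lemma two_mor_idt:
  assumes "one_mor C J D K F"
  shows "two_mor C J D K F F (\<lambda>A \<in> Obj C. Idt D (ob_map (fst F) A))"
proof (cases F)
  case (Pair F p)
  then interpret pointed_functor C J D K F p using assms by (simp add: one_mor_iff)
  show ?thesis unfolding Pair two_mor_iff by unfold_locales auto
qed

lemma two_mor_comp:
  assumes s: "two_mor C J D K F G s" and t: "two_mor C J D K G H t"
  shows "two_mor C J D K F H (\<lambda>A \<in> Obj C. t A \<cdot>\<^bsub>D\<^esub> s A)"
proof -
  obtain F' p G' q H' r where eq: "F = (F', p)" "G = (G', q)" "H = (H', r)" by (metis surj_pair)
  interpret s: pointed_transformation C J D K F' p G' q s using s by (simp add: eq two_mor_iff)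
  interpret t: pointed_transformation C J D K G' q H' r t using t by (simp add: eq two_mor_iff)
  have "two_mor C J D K (F', p) (H', r) (\<lambda>A \<in> Obj C. t A \<cdot>\<^bsub>D\<^esub> s A)" unfolding two_mor_iff
  proof
    fix f A assume [simp]: "f \<in> Arr C" "Dom C f = A"
    have [simp]: "A \<in> Obj C" using s.F.dom.dom_in_obj[of f] by simp
    show "ar_map H' f \<cdot>\<^bsub>D\<^esub> (\<lambda>A \<in> Obj C. t A \<cdot>\<^bsub>D\<^esub> s A) A = (\<lambda>A \<in> Obj C. t A \<cdot>\<^bsub>D\<^esub> s A) (Cod C f) \<cdot>\<^bsub>D\<^esub> ar_map F' f"
      by (simp add: s.F.cod.reassoc4[OF t.natural] s.natural)
  next
    fix A B assume [simp]: "A \<in> Obj C" "B \<in> Obj C"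
    show "(\<lambda>A \<in> Obj C. t A \<cdot>\<^bsub>D\<^esub> s A) (A \<otimes>\<^bsub>C\<^esub> B) \<cdot>\<^bsub>D\<^esub> mult F' (A, B)
      = mult H' (A, B) \<cdot>\<^bsub>D\<^esub> ((\<lambda>A \<in> Obj C. t A \<cdot>\<^bsub>D\<^esub> s A) A \<boxtimes>\<^bsub>D\<^esub> (\<lambda>A \<in> Obj C. t A \<cdot>\<^bsub>D\<^esub> s A) B)"
      by (simp add: s.monoidal s.F.cod.reassoc4[OF t.monoidal] s.F.cod.merge)
  qed (auto simp: s.unital t.unital s.F.cod.reassoc[OF t.pointed] s.pointed)
  then show ?thesis by (simp add: eq)
qed

lemma two_mor_categories: "two_mor C J D K F G s \<Longrightarrow> category C \<and> category D"
  by (cases F; cases G) (auto simp: two_mor_iff pointed_transformation_def pointed_functor_def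
      strong_monoidal_functor_def monoidal_category_def)

lemma two_mor_component:
  assumes "two_mor C J D K F G s" "A \<in> Obj C"
  shows "s A \<in> Arr D" "Dom D (s A) = ob_map (fst F) A" "Cod D (s A) = ob_map (fst G) A"
proof -
  obtain F' p G' q where eq: "F = (F', p)" "G = (G', q)" by (metis surj_pair)
  interpret s: pointed_transformation C J D K F' p G' q s using assms(1) by (simp add: eq two_mor_iff)
  show "s A \<in> Arr D" "Dom D (s A) = ob_map (fst F) A" "Cod D (s A) = ob_map (fst G) A"
    using assms(2) by (simp_all add: eq)
qed

lemma category_jhom: "category (jhom C J D K)"
proof
  fix f g A B E assume "f \<in> Hom (jhom C J D K) A B" "g \<in> Hom (jhom C J D K) B E"
  then show "g \<cdot>\<^bsub>jhom C J D K\<^esub> f \<in> Hom (jhom C J D K) A E"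
    by (auto intro: two_mor_comp)
next
  fix f A B assume "f \<in> Hom (jhom C J D K) A B"
  then obtain s where f: "f = (A, B, s)" and s: "two_mor C J D K A B s" by auto
  interpret D: category D using two_mor_categories[OF s] by simp
  note o = two_mor_one_mor[OF s]
  have "(\<lambda>c \<in> Obj C. s c \<cdot>\<^bsub>D\<^esub> (\<lambda>A' \<in> Obj C. Idt D (ob_map (fst A) A')) c) = s"
    by (rule two_mor_ext[OF two_mor_comp[OF two_mor_idt s] s]) (use o two_mor_component[OF s] in auto)
  then show "f \<cdot>\<^bsub>jhom C J D K\<^esub> Idt (jhom C J D K) A = f" by (simp add: f)
  have "(\<lambda>c \<in> Obj C. (\<lambda>A' \<in> Obj C. Idt D (ob_map (fst B) A')) c \<cdot>\<^bsub>D\<^esub> s c) = s"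
    by (rule two_mor_ext[OF two_mor_comp[OF s two_mor_idt] s]) (use o two_mor_component[OF s] in auto)
  then show "Idt (jhom C J D K) B \<cdot>\<^bsub>jhom C J D K\<^esub> f = f" by (simp add: f)
next
  fix f g h A B E G
  assume "f \<in> Hom (jhom C J D K) A B" "g \<in> Hom (jhom C J D K) B E" "h \<in> Hom (jhom C J D K) E G"
  then obtain s t r where f: "f = (A, B, s)" "g = (B, E, t)" "h = (E, G, r)" and
    s: "two_mor C J D K A B s" and t: "two_mor C J D K B E t" and r: "two_mor C J D K E G r" by auto
  interpret D: category D using two_mor_categories[OF s] by simp
  show "h \<cdot>\<^bsub>jhom C J D K\<^esub> (g \<cdot>\<^bsub>jhom C J D K\<^esub> f) = h \<cdot>\<^bsub>jhom C J D K\<^esub> g \<cdot>\<^bsub>jhom C J D K\<^esub> f"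
    using two_mor_component[OF s] two_mor_component[OF t] two_mor_component[OF r]
    by (auto simp: f intro!: restrict_ext)
qed (auto dest: two_mor_one_mor intro: two_mor_idt)

lemma two_mor_iso_inverse:
  assumes s: "two_mor C J D K F G s" and iso: "\<And>A. A \<in> Obj C \<Longrightarrow> is_iso D (s A)"
  shows "two_mor C J D K G F (\<lambda>A \<in> Obj C. inv_arr D (s A))"
proof -
  obtain F' p G' q where eq: "F = (F', p)" "G = (G', q)" by (metis surj_pair)
  interpret s: pointed_transformation C J D K F' p G' q s using s by (simp add: eq two_mor_iff)
  note [simp] = iso
  have "two_mor C J D K (G', q) (F', p) (\<lambda>A \<in> Obj C. inv_arr D (s A))" unfolding two_mor_iff
  proof
    fix f A assume [simp]: "f \<in> Arr C" "Dom C f = A"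
    have [simp]: "A \<in> Obj C" using s.F.dom.dom_in_obj[of f] by simp
    show "ar_map F' f \<cdot>\<^bsub>D\<^esub> (\<lambda>A \<in> Obj C. inv_arr D (s A)) A = (\<lambda>A \<in> Obj C. inv_arr D (s A)) (Cod C f) \<cdot>\<^bsub>D\<^esub> ar_map G' f"
      using s.F.cod.inv_square[of "s A" "s (Cod C f)" "ar_map G' f" "ar_map F' f"] s.natural[of f A] by simp
  next
    fix A B assume [simp]: "A \<in> Obj C" "B \<in> Obj C"
    show "(\<lambda>A \<in> Obj C. inv_arr D (s A)) (A \<otimes>\<^bsub>C\<^esub> B) \<cdot>\<^bsub>D\<^esub> mult G' (A, B)
      = mult F' (A, B) \<cdot>\<^bsub>D\<^esub> ((\<lambda>A \<in> Obj C. inv_arr D (s A)) A \<boxtimes>\<^bsub>D\<^esub> (\<lambda>A \<in> Obj C. inv_arr D (s A)) B)"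
      using s.F.cod.inv_square[of "s A \<boxtimes>\<^bsub>D\<^esub> s B" "s (A \<otimes>\<^bsub>C\<^esub> B)" "mult G' (A, B)" "mult F' (A, B)"] s.monoidal[of A B]
      by (simp add: s.F.cod.iso_ten)
  next
    have "unit_map F' = inv_arr D (s \<I>\<^bsub>C\<^esub>) \<cdot>\<^bsub>D\<^esub> unit_map G'"
      by (rule s.F.cod.iso_move_left) (auto simp: s.unital)
    then show "(\<lambda>A \<in> Obj C. inv_arr D (s A)) \<I>\<^bsub>C\<^esub> \<cdot>\<^bsub>D\<^esub> unit_map G' = unit_map F'" by simp
  next
    have "q = p \<cdot>\<^bsub>D\<^esub> inv_arr D (s J)"
      by (rule s.F.cod.iso_move_right) (auto simp: s.pointed)
    then show "p \<cdot>\<^bsub>D\<^esub> (\<lambda>A \<in> Obj C. inv_arr D (s A)) J = q" by simp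
  qed auto
  then show ?thesis by (simp add: eq)
qed

lemma is_iso_jhom:
  assumes s: "two_mor C J D K F G s" and iso: "\<And>A. A \<in> Obj C \<Longrightarrow> is_iso D (s A)"
  shows "is_iso (jhom C J D K) (F, G, s)"
proof -
  interpret D: category D using two_mor_categories[OF s] by simp
  note [simp] = two_mor_component[OF s] iso
  have "inverse_arrs (jhom C J D K) (F, G, s) (G, F, \<lambda>A \<in> Obj C. inv_arr D (s A))"
    using s two_mor_iso_inverse[OF s iso] by (auto simp: inverse_arrs_def intro!: restrict_ext)
  then show ?thesis unfolding is_iso_def ..
qed

lemma isomorphic_jhomI:
  assumes "two_mor C J D K F G s" "\<And>A. A \<in> Obj C \<Longrightarrow> is_iso D (s A)"
  shows "isomorphic (jhom C J D K) F G"
  using category.isomorphicI[OF category_jhom is_iso_jhom[OF assms]] by simp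

lemma isomorphic_jhomE:
  assumes "isomorphic (jhom C J D K) F G"
  obtains s where "two_mor C J D K F G s" "\<And>A. A \<in> Obj C \<Longrightarrow> is_iso D (s A)"
proof -
  obtain f where f: "is_iso (jhom C J D K) f" "f \<in> Hom (jhom C J D K) F G"
    using assms by (auto simp: isomorphic_def)
  then obtain s where fs: "f = (F, G, s)" and s: "two_mor C J D K F G s" by auto
  from f(1) fs obtain t where t: "two_mor C J D K G F t"
    "(\<lambda>A \<in> Obj C. t A \<cdot>\<^bsub>D\<^esub> s A) = (\<lambda>A \<in> Obj C. Idt D (ob_map (fst F) A))"
    "(\<lambda>A \<in> Obj C. s A \<cdot>\<^bsub>D\<^esub> t A) = (\<lambda>A \<in> Obj C. Idt D (ob_map (fst G) A))"
    by (auto simp: is_iso_def inverse_arrs_def)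
  interpret D: category D using two_mor_categories[OF s] by simp
  have "is_iso D (s A)" if A: "A \<in> Obj C" for A
  proof -
    have "inverse_arrs D (s A) (t A)"
      using fun_cong[OF t(2), of A] fun_cong[OF t(3), of A] A
        two_mor_component[OF s A] two_mor_component[OF t(1) A] by (intro D.inverse_arrsI) auto
    then show ?thesis by (auto simp: is_iso_def)
  qed
  with s show ?thesis by (rule that)
qed

lemma jcomp_Pair:
  "jcomp B X (G, q) (F, p) =
     (\<lparr>ob_map = (\<lambda>A \<in> Obj B. ob_map G (ob_map F A)),
       ar_map = (\<lambda>f \<in> Arr B. ar_map G (ar_map F f)),
       mult = (\<lambda>(A, A') \<in> Obj B \<times> Obj B.
          ar_map G (mult F (A, A')) \<cdot>\<^bsub>X\<^esub> mult G (ob_map F A, ob_map F A')),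
       unit_map = ar_map G (unit_map F) \<cdot>\<^bsub>X\<^esub> unit_map G\<rparr>,
      q \<cdot>\<^bsub>X\<^esub> ar_map G p)"
  by (simp add: jcomp_def)

lemma ob_map_jcomp [simp]: "A \<in> Obj B \<Longrightarrow> ob_map (fst (jcomp B X G F)) A = ob_map (fst G) (ob_map (fst F) A)"
  by (cases F; cases G) (simp add: jcomp_Pair)

lemma one_mor_jcomp:
  fixes X (structure)
  assumes F: "one_mor B M C J F" and G: "one_mor C J X K G"
  shows "one_mor B M X K (jcomp B X G F)"
proof -
  obtain F' p G' q where eq: "F = (F', p)" "G = (G', q)" by (metis surj_pair)
  interpret F: pointed_functor B M C J F' p using F by (simp add: eq one_mor_iff)
  interpret G: pointed_functor C J X K G' q using G by (simp add: eq one_mor_iff)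
  let ?H = "fst (jcomp B X (G', q) (F', p))"
  have H: "strong_monoidal_functor B X ?H"
  proof (rule strong_monoidal_functorI)
    fix A A' E assume [simp]: "A \<in> Obj B" "A' \<in> Obj B" "E \<in> Obj B"
    let ?O = "\<lambda>A. ob_map F' A" and ?R = "\<lambda>f. ar_map F' f" and ?m = "\<lambda>A A'. mult F' (A, A')"
      and ?I = "\<lambda>A. Idt C (ob_map F' A)" and ?n = "\<lambda>A A'. mult G' (ob_map F' A, ob_map F' A')"
      and ?J = "\<lambda>A. Idt X (ob_map G' (ob_map F' A))"
    let ?L = "ar_map G' (?R (Assoc B A A' E)) \<cdot> ((ar_map G' (?m (A \<otimes>\<^bsub>B\<^esub> A') E) \<cdot> ?n (A \<otimes>\<^bsub>B\<^esub> A') E)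
         \<cdot> ((ar_map G' (?m A A') \<cdot> ?n A A') \<boxtimes> ?J E))"
    have "?L = ar_map G' (?R (Assoc B A A' E)) \<cdot> (ar_map G' (?m (A \<otimes>\<^bsub>B\<^esub> A') E) \<cdot> (?n (A \<otimes>\<^bsub>B\<^esub> A') E
        \<cdot> ((ar_map G' (?m A A') \<boxtimes> ar_map G' (?I E)) \<cdot> (?n A A' \<boxtimes> ?J E))))"
      by (simp add: G.cod.merge)
    also have "\<dots> = ar_map G' (?R (Assoc B A A' E) \<cdot>\<^bsub>C\<^esub> (?m (A \<otimes>\<^bsub>B\<^esub> A') E \<cdot>\<^bsub>C\<^esub> (?m A A' \<boxtimes>\<^bsub>C\<^esub> ?I E)))
        \<cdot> (mult G' (?O A \<otimes>\<^bsub>C\<^esub> ?O A', ?O E) \<cdot> (?n A A' \<boxtimes> ?J E))"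
      by (simp add: G.cod.reassoc4[OF G.mult_natural_rev] del: G.functor_idt)
    also have "\<dots> = ar_map G' (?m A (A' \<otimes>\<^bsub>B\<^esub> E)) \<cdot> (ar_map G' (?I A \<boxtimes>\<^bsub>C\<^esub> ?m A' E)
        \<cdot> (ar_map G' (Assoc C (?O A) (?O A') (?O E)) \<cdot> (mult G' (?O A \<otimes>\<^bsub>C\<^esub> ?O A', ?O E) \<cdot> (?n A A' \<boxtimes> ?J E))))"
      by (simp add: F.mult_assoc_right)
    also have "\<dots> = ar_map G' (?m A (A' \<otimes>\<^bsub>B\<^esub> E)) \<cdot> (ar_map G' (?I A \<boxtimes>\<^bsub>C\<^esub> ?m A' E)
        \<cdot> (mult G' (?O A, ?O A' \<otimes>\<^bsub>C\<^esub> ?O E) \<cdot> ((?J A \<boxtimes> ?n A' E)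
        \<cdot> Assoc X (ob_map G' (?O A)) (ob_map G' (?O A')) (ob_map G' (?O E)))))"
      by (simp add: G.mult_assoc_right)
    also have "\<dots> = ar_map G' (?m A (A' \<otimes>\<^bsub>B\<^esub> E)) \<cdot> (?n A (A' \<otimes>\<^bsub>B\<^esub> E) \<cdot> ((ar_map G' (?I A) \<boxtimes> ar_map G' (?m A' E))
        \<cdot> ((?J A \<boxtimes> ?n A' E)
        \<cdot> Assoc X (ob_map G' (?O A)) (ob_map G' (?O A')) (ob_map G' (?O E)))))"
      by (simp add: G.cod.reassoc4[OF G.mult_natural] del: G.functor_idt)
    also have "\<dots> = (ar_map G' (?m A (A' \<otimes>\<^bsub>B\<^esub> E)) \<cdot> ?n A (A' \<otimes>\<^bsub>B\<^esub> E)) \<cdot>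
        ((?J A \<boxtimes> (ar_map G' (?m A' E) \<cdot> ?n A' E))
        \<cdot> Assoc X (ob_map G' (?O A)) (ob_map G' (?O A')) (ob_map G' (?O E)))"
      by (simp add: G.cod.merge)
    finally show "ar_map ?H (Assoc B A A' E) \<cdot> (mult ?H (A \<otimes>\<^bsub>B\<^esub> A', E) \<cdot> (mult ?H (A, A') \<boxtimes> Idt X (ob_map ?H E)))
        = mult ?H (A, A' \<otimes>\<^bsub>B\<^esub> E) \<cdot> ((Idt X (ob_map ?H A) \<boxtimes> mult ?H (A', E))
            \<cdot> Assoc X (ob_map ?H A) (ob_map ?H A') (ob_map ?H E))"
      by (simp add: jcomp_Pair)
  next
    fix A assume [simp]: "A \<in> Obj B"
    let ?O = "\<lambda>A. ob_map F' A"
    have "ar_map G' (ar_map F' (LUnit B A)) \<cdot> ((ar_map G' (mult F' (\<I>\<^bsub>B\<^esub>, A)) \<cdot> mult G' (?O \<I>\<^bsub>B\<^esub>, ?O A))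
        \<cdot> ((ar_map G' (unit_map F') \<cdot> unit_map G') \<boxtimes> Idt X (ob_map G' (?O A))))
      = ar_map G' (ar_map F' (LUnit B A)) \<cdot> (ar_map G' (mult F' (\<I>\<^bsub>B\<^esub>, A)) \<cdot> (mult G' (?O \<I>\<^bsub>B\<^esub>, ?O A)
        \<cdot> ((ar_map G' (unit_map F') \<boxtimes> ar_map G' (Idt C (?O A))) \<cdot> (unit_map G' \<boxtimes> Idt X (ob_map G' (?O A))))))"
      by (simp add: G.cod.merge)
    also have "\<dots> = ar_map G' (ar_map F' (LUnit B A) \<cdot>\<^bsub>C\<^esub> (mult F' (\<I>\<^bsub>B\<^esub>, A) \<cdot>\<^bsub>C\<^esub> (unit_map F' \<boxtimes>\<^bsub>C\<^esub> Idt C (?O A))))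
        \<cdot> (mult G' (\<I>\<^bsub>C\<^esub>, ?O A) \<cdot> (unit_map G' \<boxtimes> Idt X (ob_map G' (?O A))))"
      by (simp add: G.cod.reassoc4[OF G.mult_natural_rev] del: G.functor_idt)
    also have "\<dots> = LUnit X (ob_map G' (?O A))"
      by (simp add: F.mult_lunit_right G.mult_lunit_right del: G.functor_comp)
    finally show "ar_map ?H (LUnit B A) \<cdot> (mult ?H (\<I>\<^bsub>B\<^esub>, A) \<cdot> (unit_map ?H \<boxtimes> Idt X (ob_map ?H A)))
        = LUnit X (ob_map ?H A)"
      by (simp add: jcomp_Pair)
    have "ar_map G' (ar_map F' (RUnit B A)) \<cdot> ((ar_map G' (mult F' (A, \<I>\<^bsub>B\<^esub>)) \<cdot> mult G' (?O A, ?O \<I>\<^bsub>B\<^esub>))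
        \<cdot> (Idt X (ob_map G' (?O A)) \<boxtimes> (ar_map G' (unit_map F') \<cdot> unit_map G')))
      = ar_map G' (ar_map F' (RUnit B A)) \<cdot> (ar_map G' (mult F' (A, \<I>\<^bsub>B\<^esub>)) \<cdot> (mult G' (?O A, ?O \<I>\<^bsub>B\<^esub>)
        \<cdot> ((ar_map G' (Idt C (?O A)) \<boxtimes> ar_map G' (unit_map F')) \<cdot> (Idt X (ob_map G' (?O A)) \<boxtimes> unit_map G'))))"
      by (simp add: G.cod.merge)
    also have "\<dots> = ar_map G' (ar_map F' (RUnit B A) \<cdot>\<^bsub>C\<^esub> (mult F' (A, \<I>\<^bsub>B\<^esub>) \<cdot>\<^bsub>C\<^esub> (Idt C (?O A) \<boxtimes>\<^bsub>C\<^esub> unit_map F')))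
        \<cdot> (mult G' (?O A, \<I>\<^bsub>C\<^esub>) \<cdot> (Idt X (ob_map G' (?O A)) \<boxtimes> unit_map G'))"
      by (simp add: G.cod.reassoc4[OF G.mult_natural_rev] del: G.functor_idt)
    also have "\<dots> = RUnit X (ob_map G' (?O A))"
      by (simp add: F.mult_runit_right G.mult_runit_right del: G.functor_comp)
    finally show "ar_map ?H (RUnit B A) \<cdot> (mult ?H (A, \<I>\<^bsub>B\<^esub>) \<cdot> (Idt X (ob_map ?H A) \<boxtimes> unit_map ?H))
        = RUnit X (ob_map ?H A)"
      by (simp add: jcomp_Pair)
  next
    fix f g assume [simp]: "f \<in> Arr B" "g \<in> Arr B"
    show "ar_map ?H (f \<boxtimes>\<^bsub>B\<^esub> g) \<cdot> mult ?H (Dom B f, Dom B g)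
        = mult ?H (Cod B f, Cod B g) \<cdot> (ar_map ?H f \<boxtimes> ar_map ?H g)"
    proof -
      have *: "ar_map G' (ar_map F' (f \<boxtimes>\<^bsub>B\<^esub> g)) \<cdot> ar_map G' (mult F' (Dom B f, Dom B g))
        = ar_map G' (mult F' (Cod B f, Cod B g)) \<cdot> ar_map G' (ar_map F' f \<boxtimes>\<^bsub>C\<^esub> ar_map F' g)"
        by (simp add: F.mult_natural flip: G.functor_comp)
      show ?thesis
        by (simp add: jcomp_Pair G.mult_natural G.cod.reassoc4[OF *])
    qed
  qed (auto simp: jcomp_Pair G.functor_iso intro!: G.cod.iso_comp F.dom.monoidal_category_axioms G.cod.monoidal_category_axioms)
  then interpret H: strong_monoidal_functor B X ?H .
  have "pointed_functor B M X K ?H (snd (jcomp B X (G', q) (F', p)))"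
    by unfold_locales (auto simp: jcomp_Pair G.functor_iso intro!: G.cod.iso_comp)
  then show ?thesis by (simp add: eq flip: one_mor_iff)
qed

lemma monfun_eqI:
  fixes F G :: "('o, 'm, 'p, 'q) monfun"
  assumes "ob_map F = ob_map G" "ar_map F = ar_map G" "mult F = mult G" "unit_map F = unit_map G"
  shows "F = G"
  using assms by simp

lemma one_mor_eqI:
  assumes "one_mor C J D K F" "one_mor C J D K G"
    "\<And>A. A \<in> Obj C \<Longrightarrow> ob_map (fst F) A = ob_map (fst G) A"
    "\<And>f. f \<in> Arr C \<Longrightarrow> ar_map (fst F) f = ar_map (fst G) f"
    "\<And>A B. \<lbrakk>A \<in> Obj C; B \<in> Obj C\<rbrakk> \<Longrightarrow> mult (fst F) (A, B) = mult (fst G) (A, B)"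
    "unit_map (fst F) = unit_map (fst G)" "snd F = snd G"
  shows "F = G"
proof (rule prod_eqI)
  have e: "ob_map (fst F) \<in> extensional (Obj C)" "ar_map (fst F) \<in> extensional (Arr C)"
     "mult (fst F) \<in> extensional (Obj C \<times> Obj C)" "ob_map (fst G) \<in> extensional (Obj C)"
     "ar_map (fst G) \<in> extensional (Arr C)" "mult (fst G) \<in> extensional (Obj C \<times> Obj C)"
    using assms(1,2) by (auto simp: one_mor_def split: prod.splits)
  show "fst F = fst G"
    by (rule monfun_eqI) (use assms e in \<open>auto intro!: extensionalityI\<close>)
qed fact

lemma jcomp_jcomp:
  assumes F: "one_mor B M C J F" and G: "one_mor C J D L G" and H: "one_mor D L X K H"
  shows "jcomp B X H (jcomp B D G F) = jcomp B X (jcomp C X H G) F"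
proof (rule one_mor_eqI)
  show "one_mor B M X K (jcomp B X H (jcomp B D G F))" "one_mor B M X K (jcomp B X (jcomp C X H G) F)"
    using assms by (blast intro: one_mor_jcomp)+
  obtain F' p G' q H' r where eq: "F = (F', p)" "G = (G', q)" "H = (H', r)" by (metis surj_pair)
  interpret F: pointed_functor B M C J F' p using F by (simp add: eq one_mor_iff)
  interpret G: pointed_functor C J D L G' q using G by (simp add: eq one_mor_iff)
  interpret H: pointed_functor D L X K H' r using H by (simp add: eq one_mor_iff)
  show "unit_map (fst (jcomp B X H (jcomp B D G F))) = unit_map (fst (jcomp B X (jcomp C X H G) F))"
    "snd (jcomp B X H (jcomp B D G F)) = snd (jcomp B X (jcomp C X H G) F)"
    "\<And>A. A \<in> Obj B \<Longrightarrow> ob_map (fst (jcomp B X H (jcomp B D G F))) A = ob_map (fst (jcomp B X (jcomp C X H G) F)) A"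
    "\<And>f. f \<in> Arr B \<Longrightarrow> ar_map (fst (jcomp B X H (jcomp B D G F))) f = ar_map (fst (jcomp B X (jcomp C X H G) F)) f"
    "\<And>A A'. \<lbrakk>A \<in> Obj B; A' \<in> Obj B\<rbrakk> \<Longrightarrow> mult (fst (jcomp B X H (jcomp B D G F))) (A, A')
        = mult (fst (jcomp B X (jcomp C X H G) F)) (A, A')"
    by (simp_all add: eq jcomp_Pair)
qed

lemma jid_Pair: "jid C J =
     (\<lparr>ob_map = (\<lambda>A \<in> Obj C. A), ar_map = (\<lambda>f \<in> Arr C. f),
       mult = (\<lambda>(A, B) \<in> Obj C \<times> Obj C. Idt C (A \<otimes>\<^bsub>C\<^esub> B)), unit_map = Idt C \<I>\<^bsub>C\<^esub>\<rparr>, Idt C J)"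
  by (simp add: jid_def)

lemma one_mor_jid:
  assumes "in_J C J"
  shows "one_mor C J C J (jid C J)"
proof -
  interpret C: monoidal_category C using assms by (simp add: in_J_def)
  have [simp]: "J \<in> Obj C" using assms by (simp add: in_J_def)
  interpret strong_monoidal_functor C C "fst (jid C J)"
    by (rule strong_monoidal_functorI) (auto simp: jid_Pair C.monoidal_category_axioms)
  have "pointed_functor C J C J (fst (jid C J)) (snd (jid C J))"
    by unfold_locales (auto simp: jid_Pair)
  then show ?thesis by (simp flip: one_mor_iff)
qed

lemma one_mor_in_J: "one_mor C J D K F \<Longrightarrow> in_J C J \<and> in_J D K"
  by (cases F) (simp add: one_mor_def)

lemma jcomp_jid:
  assumes G: "one_mor C J D K G"
  shows "jcomp C D G (jid C J) = G" "jcomp C D (jid D K) G = G"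
proof -
  obtain G' q where eq: "G = (G', q)" by (metis surj_pair)
  interpret G: pointed_functor C J D K G' q using G by (simp add: eq one_mor_iff)
  have o: "one_mor C J C J (jid C J)" "one_mor D K D K (jid D K)"
    using one_mor_in_J[OF G] by (auto intro: one_mor_jid)
  show "jcomp C D G (jid C J) = G"
    by (rule one_mor_eqI[OF one_mor_jcomp[OF o(1) G] G]) (auto simp: eq jid_Pair jcomp_Pair)
  show "jcomp C D (jid D K) G = G"
    by (rule one_mor_eqI[OF one_mor_jcomp[OF G o(2)] G]) (auto simp: eq jid_Pair jcomp_Pair)
qed

lemma two_mor_precompose:
  fixes X (structure)
  assumes F: "one_mor B M C J F" and s: "two_mor C J X K G G' s"
  shows "two_mor B M X K (jcomp B X G F) (jcomp B X G' F) (\<lambda>A \<in> Obj B. s (ob_map (fst F) A))"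
proof -
  obtain f p g q g' q' where eq: "F = (f, p)" "G = (g, q)" "G' = (g', q')" by (metis surj_pair)
  interpret F: pointed_functor B M C J f p using F by (simp add: eq one_mor_iff)
  interpret s: pointed_transformation C J X K g q g' q' s using s by (simp add: eq two_mor_iff)
  have "one_mor B M X K (jcomp B X G F)" "one_mor B M X K (jcomp B X G' F)"
    using F two_mor_one_mor[OF s] by (blast intro: one_mor_jcomp)+
  then have p: "pointed_functor B M X K (fst (jcomp B X G F)) (snd (jcomp B X G F))"
    "pointed_functor B M X K (fst (jcomp B X G' F)) (snd (jcomp B X G' F))"
    by (simp_all flip: one_mor_iff)
  interpret GF: pointed_functor B M X K "fst (jcomp B X G F)" "snd (jcomp B X G F)" by (fact p)
  interpret GF': pointed_functor B M X K "fst (jcomp B X G' F)" "snd (jcomp B X G' F)" by (fact p)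
  have "two_mor B M X K (fst (jcomp B X G F), snd (jcomp B X G F)) (fst (jcomp B X G' F), snd (jcomp B X G' F))
      (\<lambda>A \<in> Obj B. s (ob_map (fst F) A))"
    unfolding two_mor_iff
  proof
    fix h A assume [simp]: "h \<in> Arr B" "Dom B h = A"
    have [simp]: "A \<in> Obj B" using F.dom.dom_in_obj[of h] by simp
    show "ar_map (fst (jcomp B X G' F)) h \<cdot> (\<lambda>A \<in> Obj B. s (ob_map (fst F) A)) A
      = (\<lambda>A \<in> Obj B. s (ob_map (fst F) A)) (Cod B h) \<cdot> ar_map (fst (jcomp B X G F)) h"
      by (simp add: eq jcomp_Pair s.natural)
  next
    fix A A' assume [simp]: "A \<in> Obj B" "A' \<in> Obj B"
    show "(\<lambda>A \<in> Obj B. s (ob_map (fst F) A)) (A \<otimes>\<^bsub>B\<^esub> A') \<cdot> mult (fst (jcomp B X G F)) (A, A')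
      = mult (fst (jcomp B X G' F)) (A, A') \<cdot> ((\<lambda>A \<in> Obj B. s (ob_map (fst F) A)) A \<boxtimes> (\<lambda>A \<in> Obj B. s (ob_map (fst F) A)) A')"
      by (simp add: eq jcomp_Pair s.F.cod.reassoc4[OF s.natural_rev] s.monoidal)
  next
    show "(\<lambda>A \<in> Obj B. s (ob_map (fst F) A)) \<I>\<^bsub>B\<^esub> \<cdot> unit_map (fst (jcomp B X G F)) = unit_map (fst (jcomp B X G' F))"
      by (simp add: eq jcomp_Pair s.F.cod.reassoc4[OF s.natural_rev] s.unital)
    show "snd (jcomp B X G' F) \<cdot> (\<lambda>A \<in> Obj B. s (ob_map (fst F) A)) M = snd (jcomp B X G F)"
      by (simp add: eq jcomp_Pair s.natural s.F.cod.reassoc[OF s.pointed])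
  qed (auto simp: eq jcomp_Pair)
  then show ?thesis by simp
qed

lemma two_mor_postcompose:
  fixes X (structure)
  assumes s: "two_mor B M C J F F' s" and G: "one_mor C J X K G"
  shows "two_mor B M X K (jcomp B X G F) (jcomp B X G F') (\<lambda>A \<in> Obj B. ar_map (fst G) (s A))"
proof -
  obtain f p g q f' p' where eq: "F = (f, p)" "G = (g, q)" "F' = (f', p')" by (metis surj_pair)
  interpret G: pointed_functor C J X K g q using G by (simp add: eq one_mor_iff)
  interpret s: pointed_transformation B M C J f p f' p' s using s by (simp add: eq two_mor_iff)
  have "one_mor B M X K (jcomp B X G F)" "one_mor B M X K (jcomp B X G F')"
    using G two_mor_one_mor[OF s] by (blast intro: one_mor_jcomp)+
  then have p: "pointed_functor B M X K (fst (jcomp B X G F)) (snd (jcomp B X G F))"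
    "pointed_functor B M X K (fst (jcomp B X G F')) (snd (jcomp B X G F'))"
    by (simp_all flip: one_mor_iff)
  interpret GF: pointed_functor B M X K "fst (jcomp B X G F)" "snd (jcomp B X G F)" by (fact p)
  interpret GF': pointed_functor B M X K "fst (jcomp B X G F')" "snd (jcomp B X G F')" by (fact p)
  have "two_mor B M X K (fst (jcomp B X G F), snd (jcomp B X G F)) (fst (jcomp B X G F'), snd (jcomp B X G F'))
      (\<lambda>A \<in> Obj B. ar_map (fst G) (s A))"
    unfolding two_mor_iff
  proof
    fix h A assume [simp]: "h \<in> Arr B" "Dom B h = A"
    have [simp]: "A \<in> Obj B" using s.F.dom.dom_in_obj[of h] by simp
    show "ar_map (fst (jcomp B X G F')) h \<cdot> (\<lambda>A \<in> Obj B. ar_map (fst G) (s A)) A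
      = (\<lambda>A \<in> Obj B. ar_map (fst G) (s A)) (Cod B h) \<cdot> ar_map (fst (jcomp B X G F)) h"
      by (simp add: eq jcomp_Pair s.natural flip: G.functor_comp)
  next
    fix A A' assume [simp]: "A \<in> Obj B" "A' \<in> Obj B"
    have *: "ar_map g (s (A \<otimes>\<^bsub>B\<^esub> A')) \<cdot> ar_map g (mult f (A, A')) = ar_map g (mult f' (A, A')) \<cdot> ar_map g (s A \<boxtimes>\<^bsub>C\<^esub> s A')"
      by (simp add: s.monoidal flip: G.functor_comp)
    show "(\<lambda>A \<in> Obj B. ar_map (fst G) (s A)) (A \<otimes>\<^bsub>B\<^esub> A') \<cdot> mult (fst (jcomp B X G F)) (A, A')
      = mult (fst (jcomp B X G F')) (A, A') \<cdot> ((\<lambda>A \<in> Obj B. ar_map (fst G) (s A)) A \<boxtimes> (\<lambda>A \<in> Obj B. ar_map (fst G) (s A)) A')"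
      by (simp add: eq jcomp_Pair G.cod.reassoc4[OF *] G.mult_natural)
  next
    have *: "ar_map g (s \<I>\<^bsub>B\<^esub>) \<cdot> ar_map g (unit_map f) = ar_map g (unit_map f')"
      by (simp add: s.unital flip: G.functor_comp)
    show "(\<lambda>A \<in> Obj B. ar_map (fst G) (s A)) \<I>\<^bsub>B\<^esub> \<cdot> unit_map (fst (jcomp B X G F)) = unit_map (fst (jcomp B X G F'))"
      by (simp add: eq jcomp_Pair G.cod.reassoc[OF *])
    have "ar_map g p' \<cdot> ar_map g (s M) = ar_map g p"
      by (simp add: s.pointed flip: G.functor_comp)
    then show "snd (jcomp B X G F') \<cdot> (\<lambda>A \<in> Obj B. ar_map (fst G) (s A)) M = snd (jcomp B X G F)"
      by (simp add: eq jcomp_Pair)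
  qed (auto simp: eq jcomp_Pair)
  then show ?thesis by simp
qed

lemma isomorphic_postcompose:
  assumes "isomorphic (jhom B M C J) F F'" and G: "one_mor C J X K G"
  shows "isomorphic (jhom B M X K) (jcomp B X G F) (jcomp B X G F')"
proof -
  obtain s where s: "two_mor B M C J F F' s" "\<And>A. A \<in> Obj B \<Longrightarrow> is_iso C (s A)"
    using assms(1) by (rule isomorphic_jhomE) blast
  interpret G: pointed_functor C J X K "fst G" "snd G" using G by (simp flip: one_mor_iff)
  show ?thesis
    by (rule isomorphic_jhomI[OF two_mor_postcompose[OF s(1) G]]) (simp add: s(2) G.functor_iso)
qed

section \<open>Equivalences and coproducts\<close>

definition fully_faithful ::
  "('o, 'm, 'y) cat_scheme \<Rightarrow> ('p, 'q, 'z) cat_scheme \<Rightarrow> ('o, 'm, 'p, 'q, 'w) cfun_scheme \<Rightarrow> bool" where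
  "fully_faithful C D T \<longleftrightarrow> (\<forall>A \<in> Obj C. \<forall>B \<in> Obj C. \<forall>g \<in> Hom D (ob_map T A) (ob_map T B).
     \<exists>!f. f \<in> Hom C A B \<and> ar_map T f = g)"

lemma nat_iso_isomorphic:
  assumes "nat_iso C D F G s" "A \<in> Obj C"
  shows "isomorphic D (ob_map F A) (ob_map G A)"
  using assms unfolding nat_iso_def nat_trans_def isomorphic_def by blast

lemma equivalence_functor_es:
  fixes C :: "('o, 'm, 'y) cat_scheme" and D :: "('p, 'q, 'z) cat_scheme"
  assumes "equivalence_functor C D T" "d \<in> Obj D"
  obtains c where "c \<in> Obj C" "isomorphic D (ob_map T c) d"
proof -
  obtain G :: "('p, 'q, 'o, 'm) cfun" and t where G: "is_functor D C G" and t: "nat_iso D D (comp_cfun T G) id_cfun t"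
    using assms(1) unfolding equivalence_functor_def by blast
  interpret G: is_functor D C G by fact
  show ?thesis
    using that[of "ob_map G d"] nat_iso_isomorphic[OF t assms(2)] assms(2)
    by (simp add: comp_cfun_def id_cfun_def)
qed

lemma equivalence_functor_reflects:
  fixes C :: "('o, 'm, 'y) cat_scheme" and D :: "('p, 'q, 'z) cat_scheme"
  assumes "equivalence_functor C D T" "isomorphic D (ob_map T A) (ob_map T B)" "A \<in> Obj C" "B \<in> Obj C"
  shows "isomorphic C A B"
proof -
  obtain G :: "('p, 'q, 'o, 'm) cfun" and s where G: "is_functor D C G" and s: "nat_iso C C (comp_cfun G T) id_cfun s"
    using assms(1) unfolding equivalence_functor_def by blast
  interpret G: is_functor D C G by fact
  have "isomorphic C (ob_map G (ob_map T A)) A" "isomorphic C (ob_map G (ob_map T B)) B"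
    using nat_iso_isomorphic[OF s] assms(3,4) by (auto simp: comp_cfun_def id_cfun_def)
  moreover have "isomorphic C (ob_map G (ob_map T A)) (ob_map G (ob_map T B))"
    using G.functor_isomorphic assms(2) by blast
  ultimately show ?thesis
    by (meson G.cod.isomorphic_sym G.cod.isomorphic_trans)
qed

lemma equivalence_functorI:
  assumes T: "is_functor C D T" and ff: "fully_faithful C D T"
    and es: "\<And>d. d \<in> Obj D \<Longrightarrow> \<exists>c \<in> Obj C. isomorphic D (ob_map T c) d"
  shows "equivalence_functor C D T"
proof -
  interpret T: is_functor C D T by fact
  define lift where "lift A B g = (THE f. f \<in> Hom C A B \<and> ar_map T f = g)" for A B g
  have lift: "lift A B g \<in> Arr C" "Dom C (lift A B g) = A" "Cod C (lift A B g) = B" "ar_map T (lift A B g) = g"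
    if "A \<in> Obj C" "B \<in> Obj C" "g \<in> Arr D" "Dom D g = ob_map T A" "Cod D g = ob_map T B" for A B g
  proof -
    have "\<exists>!f. f \<in> Hom C A B \<and> ar_map T f = g"
      using ff that by (simp add: fully_faithful_def)
    then have "lift A B g \<in> Hom C A B \<and> ar_map T (lift A B g) = g"
      unfolding lift_def by (rule theI')
    then show "lift A B g \<in> Arr C" "Dom C (lift A B g) = A" "Cod C (lift A B g) = B" "ar_map T (lift A B g) = g"
      by auto
  qed
  have faithful: "f = f'" if "ar_map T f = ar_map T f'" "f \<in> Arr C" "f' \<in> Arr C" "Dom C f' = Dom C f" "Cod C f' = Cod C f" for f f'
  proof -
    have "\<exists>!h. h \<in> Hom C (Dom C f) (Cod C f) \<and> ar_map T h = ar_map T f"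
      using ff that by (simp add: fully_faithful_def)
    then show ?thesis using that by auto
  qed
  have "\<forall>d. \<exists>c e. d \<in> Obj D \<longrightarrow> c \<in> Obj C \<and> is_iso D e \<and> Dom D e = ob_map T c \<and> Cod D e = d"
    using es unfolding isomorphic_def in_Hom Bex_def by blast
  then obtain go ep where go [simp]: "\<And>d. d \<in> Obj D \<Longrightarrow> go d \<in> Obj C"
    and ep [simp]: "\<And>d. d \<in> Obj D \<Longrightarrow> is_iso D (ep d)" "\<And>d. d \<in> Obj D \<Longrightarrow> Dom D (ep d) = ob_map T (go d)"
      "\<And>d. d \<in> Obj D \<Longrightarrow> Cod D (ep d) = d"
    unfolding choice_iff by blast
  have ep_arr [simp]: "\<And>d. d \<in> Obj D \<Longrightarrow> ep d \<in> Arr D" by (rule iso_arr, rule ep(1))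
  define ga where "ga g = lift (go (Dom D g)) (go (Cod D g)) (inv_arr D (ep (Cod D g)) \<cdot>\<^bsub>D\<^esub> (g \<cdot>\<^bsub>D\<^esub> ep (Dom D g)))" for g
  have ga [simp]: "ga g \<in> Arr C" "Dom C (ga g) = go (Dom D g)" "Cod C (ga g) = go (Cod D g)"
    "ar_map T (ga g) = inv_arr D (ep (Cod D g)) \<cdot>\<^bsub>D\<^esub> (g \<cdot>\<^bsub>D\<^esub> ep (Dom D g))" if "g \<in> Arr D" for g
    using that lift[of "go (Dom D g)" "go (Cod D g)" "inv_arr D (ep (Cod D g)) \<cdot>\<^bsub>D\<^esub> (g \<cdot>\<^bsub>D\<^esub> ep (Dom D g))"]
    by (simp_all add: ga_def)
  define G where "G = \<lparr>ob_map = go, ar_map = ga\<rparr>"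
  have G: "is_functor D C G"
    by unfold_locales (auto simp: G_def intro!: faithful)
  define un where "un c = lift (go (ob_map T c)) c (ep (ob_map T c))" for c
  have un [simp]: "un c \<in> Arr C" "Dom C (un c) = go (ob_map T c)" "Cod C (un c) = c" "ar_map T (un c) = ep (ob_map T c)"
    if "c \<in> Obj C" for c
    using that lift[of "go (ob_map T c)" c "ep (ob_map T c)"] by (simp_all add: un_def)
  have iso: "is_iso C (un c)" if c: "c \<in> Obj C" for c
  proof -
    note l = lift[of c "go (ob_map T c)" "inv_arr D (ep (ob_map T c))"]
    have "inverse_arrs C (un c) (lift c (go (ob_map T c)) (inv_arr D (ep (ob_map T c))))"
      using c l by (intro T.dom.inverse_arrsI faithful) auto
    then show ?thesis unfolding is_iso_def ..
  qed
  have "nat_iso C C (comp_cfun G T) id_cfun un"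
    unfolding nat_iso_def nat_trans_def using iso
    by (auto simp: comp_cfun_def id_cfun_def G_def intro!: faithful)
  moreover have "nat_iso D D (comp_cfun T G) id_cfun ep"
    unfolding nat_iso_def nat_trans_def
    by (auto simp: comp_cfun_def id_cfun_def G_def)
  ultimately show ?thesis
    unfolding equivalence_functor_def using T G by blast
qed

lemma prod_cat_simps [simp]:
  "Obj (prod_cat C D) = Obj C \<times> Obj D" "Arr (prod_cat C D) = Arr C \<times> Arr D"
  "Dom (prod_cat C D) (f, g) = (Dom C f, Dom D g)" "Cod (prod_cat C D) (f, g) = (Cod C f, Cod D g)"
  "Idt (prod_cat C D) (A, B) = (Idt C A, Idt D B)"
  "Comp (prod_cat C D) (f', g') (f, g) = (f' \<cdot>\<^bsub>C\<^esub> f, g' \<cdot>\<^bsub>D\<^esub> g)"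
  by (simp_all add: prod_cat_def)

lemma category_prod_cat:
  assumes "category C" "category D"
  shows "category (prod_cat C D)"
proof -
  interpret C: category C by fact
  interpret D: category D by fact
  show ?thesis by unfold_locales (auto)
qed

lemma isomorphic_prod_cat:
  assumes "category C" "category D"
  shows "isomorphic (prod_cat C D) (A, B) (A', B') \<longleftrightarrow> isomorphic C A A' \<and> isomorphic D B B'"
proof -
  have "inverse_arrs (prod_cat C D) (f, f') (g, g') \<longleftrightarrow> inverse_arrs C f g \<and> inverse_arrs D f' g'" for f f' g g'
    by (auto simp: inverse_arrs_def)
  then have "is_iso (prod_cat C D) (f, g) \<longleftrightarrow> is_iso C f \<and> is_iso D g" for f g
    by (auto simp: is_iso_def)
  then show ?thesis by (auto simp: isomorphic_def Bex_def)
qed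

lemma jrestrict_simps [simp]:
  "ob_map (jrestrict D E X i k) F = (jcomp D X F i, jcomp E X F k)"
  "ar_map (jrestrict D E X i k) (F, G, s) =
    ((jcomp D X F i, jcomp D X G i, \<lambda>A \<in> Obj D. s (ob_map (fst i) A)),
     (jcomp E X F k, jcomp E X G k, \<lambda>A \<in> Obj E. s (ob_map (fst k) A)))"
  by (simp_all add: jrestrict_def jwhisker_def)

lemma one_mor_ob_map: "\<lbrakk>one_mor C J D K F; A \<in> Obj C\<rbrakk> \<Longrightarrow> ob_map (fst F) A \<in> Obj D"
  by (cases F) (auto simp: one_mor_def strong_monoidal_functor_def is_functor.ob_map_obj)

lemma is_functor_jrestrict:
  assumes i: "one_mor D M P L i" and k: "one_mor E N P L k"
  shows "is_functor (jhom P L X K) (prod_cat (jhom D M X K) (jhom E N X K)) (jrestrict D E X i k)"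
proof -
  interpret category "jhom P L X K" by (rule category_jhom)
  interpret p: category "prod_cat (jhom D M X K) (jhom E N X K)" by (intro category_prod_cat category_jhom)
  note [simp] = one_mor_ob_map[OF i] one_mor_ob_map[OF k]
  show ?thesis
  proof
    fix F assume "F \<in> Obj (jhom P L X K)"
    then show "ob_map (jrestrict D E X i k) F \<in> Obj (prod_cat (jhom D M X K) (jhom E N X K))"
      by (simp add: one_mor_jcomp[OF i] one_mor_jcomp[OF k])
    show "ar_map (jrestrict D E X i k) (Idt (jhom P L X K) F)
      = Idt (prod_cat (jhom D M X K) (jhom E N X K)) (ob_map (jrestrict D E X i k) F)"
      by (auto intro!: restrict_ext)
  next
    fix f A B assume "f \<in> Hom (jhom P L X K) A B"
    then show "ar_map (jrestrict D E X i k) f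
        \<in> Hom (prod_cat (jhom D M X K) (jhom E N X K)) (ob_map (jrestrict D E X i k) A) (ob_map (jrestrict D E X i k) B)"
      using two_mor_precompose[OF i] two_mor_precompose[OF k] by auto
  next
    fix f g A B E' assume "f \<in> Hom (jhom P L X K) A B" "g \<in> Hom (jhom P L X K) B E'"
    then show "ar_map (jrestrict D E X i k) (g \<cdot>\<^bsub>jhom P L X K\<^esub> f)
      = ar_map (jrestrict D E X i k) g \<cdot>\<^bsub>prod_cat (jhom D M X K) (jhom E N X K)\<^esub> ar_map (jrestrict D E X i k) f"
      by (auto intro!: restrict_ext)
  qed
qed

text \<open>Restriction of 2-morphisms along an equivalence \<open>E\<close> with quasi-inverse \<open>G\<close> is faithful because every
  object is isomorphic to one in the image of \<open>E\<close>; it is full because it is inverse, up to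
  conjugation, to the faithful restriction along \<open>G\<close>.\<close>

lemma equivalence_restrict_faithful:
  assumes v: "two_mor C J C J (jcomp C C E G) (jid C J) v" "\<And>c. c \<in> Obj C \<Longrightarrow> is_iso C (v c)"
    and E: "one_mor B M C J E" and G: "one_mor C J B M G"
    and s: "two_mor C J X K F F' s" and t: "two_mor C J X K F F' t"
    and eq: "\<And>b. b \<in> Obj B \<Longrightarrow> s (ob_map (fst E) b) = t (ob_map (fst E) b)"
  shows "s = t"
proof (rule two_mor_ext[OF s t])
  fix c assume c [simp]: "c \<in> Obj C"
  obtain f p f' p' where FF: "F = (f, p)" "F' = (f', p')" by (metis surj_pair)
  interpret s: pointed_transformation C J X K f p f' p' s using s by (simp add: FF two_mor_iff)
  interpret t: pointed_transformation C J X K f p f' p' t using t by (simp add: FF two_mor_iff)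
  note [simp] = one_mor_ob_map[OF E] one_mor_ob_map[OF G]
  let ?c = "ob_map (fst E) (ob_map (fst G) c)"
  have v' [simp]: "v c \<in> Arr C" "Dom C (v c) = ?c" "Cod C (v c) = c" "is_iso C (v c)"
    using two_mor_component[OF v(1) c] v(2) by (simp_all add: jid_Pair)
  have "s c \<cdot>\<^bsub>X\<^esub> ar_map f (v c) = t c \<cdot>\<^bsub>X\<^esub> ar_map f (v c)"
    by (simp add: s.natural_rev t.natural_rev eq)
  then show "s c = t c"
    by (rule s.F.cod.iso_cancel_right[rotated]) (auto simp: s.F.functor_iso)
qed

lemma equivalence_restrict_full:
  assumes v: "two_mor C J C J (jcomp C C E G) (jid C J) v" "\<And>c. c \<in> Obj C \<Longrightarrow> is_iso C (v c)"
    and u: "two_mor B M B M (jcomp B B G E) (jid B M) u" "\<And>c. c \<in> Obj B \<Longrightarrow> is_iso B (u c)"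
    and E: "one_mor B M C J E" and G: "one_mor C J B M G"
    and F: "one_mor C J X K F" and F': "one_mor C J X K F'"
    and r: "two_mor B M X K (jcomp B X F E) (jcomp B X F' E) r"
  obtains s where "two_mor C J X K F F' s" "(\<lambda>b \<in> Obj B. s (ob_map (fst E) b)) = r"
proof -
  note [simp] = one_mor_ob_map[OF E] one_mor_ob_map[OF G]
  obtain f p f' p' where FF: "F = (f, p)" "F' = (f', p')" by (metis surj_pair)
  interpret F: pointed_functor C J X K f p using F by (simp add: FF one_mor_iff)
  interpret F': pointed_functor C J X K f' p' using F' by (simp add: FF one_mor_iff)
  have v' [simp]: "v c \<in> Arr C" "Dom C (v c) = ob_map (fst E) (ob_map (fst G) c)" "Cod C (v c) = c" "is_iso C (v c)"
    if "c \<in> Obj C" for c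
    using two_mor_component[OF v(1) that] v(2) that by (simp_all add: jid_Pair)
  have r' [simp]: "r b \<in> Arr X" "Dom X (r b) = ob_map f (ob_map (fst E) b)" "Cod X (r b) = ob_map f' (ob_map (fst E) b)"
    if "b \<in> Obj B" for b
    using two_mor_component[OF r that] that by (simp_all add: FF)
  have 1: "two_mor C J X K (jcomp C X F (jcomp C C E G)) F (\<lambda>c \<in> Obj C. ar_map f (v c))"
    using two_mor_postcompose[OF v(1) F] jcomp_jid(1)[OF F] by (simp add: FF)
  have 2: "two_mor C J X K (jcomp C X F' (jcomp C C E G)) F' (\<lambda>c \<in> Obj C. ar_map f' (v c))"
    using two_mor_postcompose[OF v(1) F'] jcomp_jid(1)[OF F'] by (simp add: FF)
  have 3: "two_mor C J X K (jcomp C X F (jcomp C C E G)) (jcomp C X F' (jcomp C C E G))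
      (\<lambda>c \<in> Obj C. r (ob_map (fst G) c))"
    using two_mor_precompose[OF G r] by (simp add: jcomp_jcomp[OF G E F] jcomp_jcomp[OF G E F'])
  note 4 = two_mor_comp[OF two_mor_comp[OF two_mor_iso_inverse[OF 1] 3] 2]
  let ?s = "\<lambda>c \<in> Obj C. ar_map f' (v c) \<cdot>\<^bsub>X\<^esub> (r (ob_map (fst G) c) \<cdot>\<^bsub>X\<^esub> inv_arr X (ar_map f (v c)))"
  have s: "two_mor C J X K F F' ?s"
  proof -
    have "two_mor C J X K F F' (\<lambda>A\<in>Obj C. (\<lambda>c\<in>Obj C. ar_map f' (v c)) A \<cdot>\<^bsub>X\<^esub>
        (\<lambda>A\<in>Obj C. (\<lambda>c\<in>Obj C. r (ob_map (fst G) c)) A \<cdot>\<^bsub>X\<^esub>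
          (\<lambda>A\<in>Obj C. inv_arr X ((\<lambda>c\<in>Obj C. ar_map f (v c)) A)) A) A)"
      by (rule 4) (simp add: F.functor_iso)
    also have "(\<lambda>A\<in>Obj C. (\<lambda>c\<in>Obj C. ar_map f' (v c)) A \<cdot>\<^bsub>X\<^esub>
        (\<lambda>A\<in>Obj C. (\<lambda>c\<in>Obj C. r (ob_map (fst G) c)) A \<cdot>\<^bsub>X\<^esub>
          (\<lambda>A\<in>Obj C. inv_arr X ((\<lambda>c\<in>Obj C. ar_map f (v c)) A)) A) A) = ?s"
      by (rule restrict_ext) simp
    finally show ?thesis .
  qed
  interpret s: pointed_transformation C J X K f p f' p' ?s using s by (simp add: FF two_mor_iff)
  have "(\<lambda>b \<in> Obj B. ?s (ob_map (fst E) b)) = r"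
  proof (rule equivalence_restrict_faithful[OF u G E two_mor_precompose[OF E s] r])
    fix c assume [simp]: "c \<in> Obj C"
    let ?c = "ob_map (fst E) (ob_map (fst G) c)"
    have "ar_map f' (v c) \<cdot>\<^bsub>X\<^esub> ?s ?c = ?s c \<cdot>\<^bsub>X\<^esub> ar_map f (v c)"
      using s.natural[of "v c" ?c] by (simp del: restrict_apply)
    also have "\<dots> = ar_map f' (v c) \<cdot>\<^bsub>X\<^esub> r (ob_map (fst G) c)"
      by (simp add: F.functor_iso(1))
    finally have "?s ?c = r (ob_map (fst G) c)"
      by (rule F.cod.iso_cancel_left[rotated]) (simp_all add: F'.functor_iso s.component del: restrict_apply)
    then show "(\<lambda>b \<in> Obj B. ?s (ob_map (fst E) b)) (ob_map (fst G) c) = r (ob_map (fst G) c)"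
      by (simp del: restrict_apply add: restrict_apply'[of "ob_map (fst G) c"])
  qed auto
  with s show ?thesis by (rule that)
qed

lemma coproduct_unique:
  fixes D :: "('o, 'm) moncat" and E :: "('a, 'b) moncat" and P :: "('p, 'q) moncat" and Q :: "('r, 's) moncat"
  assumes P: "jcoproduct TYPE(('p, 'q) moncat) D M E N P L i k" "jcoproduct TYPE(('r, 's) moncat) D M E N P L i k"
    and Q: "jcoproduct TYPE(('p, 'q) moncat) D M E N Q R i' k'" "jcoproduct TYPE(('r, 's) moncat) D M E N Q R i' k'"
  shows "jequiv Q R P L"
proof -
  note [simp] = isomorphic_prod_cat[OF category_jhom category_jhom]
  have one: "one_mor D M P L i" "one_mor E N P L k" "one_mor D M Q R i'" "one_mor E N Q R k'"
    using P(1) Q(1) by (auto simp: jcoproduct_def)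
  have J: "in_J P L" "in_J Q R" using one by (auto dest: one_mor_in_J)
  have PP: "equivalence_functor (jhom P L P L) (prod_cat (jhom D M P L) (jhom E N P L)) (jrestrict D E P i k)"
    and PQ: "equivalence_functor (jhom P L Q R) (prod_cat (jhom D M Q R) (jhom E N Q R)) (jrestrict D E Q i k)"
    and QP: "equivalence_functor (jhom Q R P L) (prod_cat (jhom D M P L) (jhom E N P L)) (jrestrict D E P i' k')"
    and QQ: "equivalence_functor (jhom Q R Q R) (prod_cat (jhom D M Q R) (jhom E N Q R)) (jrestrict D E Q i' k')"
    using P Q J by (auto simp: jcoproduct_def)
  obtain F where F: "one_mor P L Q R F" "isomorphic (jhom D M Q R) (jcomp D Q F i) i'"
    "isomorphic (jhom E N Q R) (jcomp E Q F k) k'"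
    using one by - (rule equivalence_functor_es[OF PQ, of "(i', k')"]; simp)
  obtain G where G: "one_mor Q R P L G" "isomorphic (jhom D M P L) (jcomp D P G i') i"
    "isomorphic (jhom E N P L) (jcomp E P G k') k"
    using one by - (rule equivalence_functor_es[OF QP, of "(i, k)"]; simp)
  note tr = category.isomorphic_trans[OF category_jhom]
  have "isomorphic (jhom P L P L) (jcomp P P G F) (jid P L)"
    using tr[OF isomorphic_postcompose[OF F(2) G(1)] G(2)] tr[OF isomorphic_postcompose[OF F(3) G(1)] G(3)]
      one_mor_jid[OF J(1)] one_mor_jcomp[OF F(1) G(1)]
    by (intro equivalence_functor_reflects[OF PP])
      (simp_all add: jcomp_jcomp[OF one(1) F(1) G(1)] jcomp_jcomp[OF one(2) F(1) G(1)]
        jcomp_jid(2)[OF one(1)] jcomp_jid(2)[OF one(2)])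
  moreover have "isomorphic (jhom Q R Q R) (jcomp Q Q F G) (jid Q R)"
    using tr[OF isomorphic_postcompose[OF G(2) F(1)] F(2)] tr[OF isomorphic_postcompose[OF G(3) F(1)] F(3)]
      one_mor_jid[OF J(2)] one_mor_jcomp[OF G(1) F(1)]
    by (intro equivalence_functor_reflects[OF QQ])
      (simp_all add: jcomp_jcomp[OF one(3) G(1) F(1)] jcomp_jcomp[OF one(4) G(1) F(1)]
        jcomp_jid(2)[OF one(3)] jcomp_jid(2)[OF one(4)])
  ultimately show ?thesis
    unfolding jequiv_def jequiv_via_def using F(1) G(1) by blast
qed

section \<open>Restriction along the inclusion is fully faithful\<close>

fun word_component ::
  "('o, 'm) moncat \<Rightarrow> ('p, 'q) moncat \<Rightarrow> ('o list \<Rightarrow> 'o list \<Rightarrow> 'q) \<Rightarrow> ('o list \<Rightarrow> 'o list \<Rightarrow> 'q) \<Rightarrow>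
   ('o \<Rightarrow> 'q) \<Rightarrow> 'q \<Rightarrow> 'o list \<Rightarrow> 'q" where
  "word_component C X m m' t d [] = undefined"
| "word_component C X m m' t d [a] = t a"
| "word_component C X m m' t d (a # b # U) =
     star X m m' [a] [a] (t a) (dten C (Jdual C) (b # U)) (dten C (Jdual C) (b # U))
       (star X m m' (Jdual C) (Jdual C) d (b # U) (b # U) (word_component C X m m' t d (b # U)))"

context dual_adjunction
begin

sublocale A: strict_monoidal_category "adjoin_dual C J"
  by (rule strict_monoidal_adjoin_dual)

declare adjoin_dual_simps [simp del]

lemma adjoin_dual_obj_simps [simp]: "Obj A = dverts C" "TenO A = dten C" "Unit A = dunit C"
  by (simp_all add: adjoin_dual_simps)

lemma Dom_Cod_dclass [simp]: "Dom A (dclass C J U es V) = U" "Cod A (dclass C J U es V) = V"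
  by (simp_all add: adjoin_dual_simps)

definition prim_class :: "'m prim \<Rightarrow> ('o, 'm) darr" where
  "prim_class p = dclass C J (prim_src C J p) [prim_edge C p] (prim_tgt C J p)"

lemma prim_class_arr [simp]:
  assumes "set_prim p \<subseteq> Arr C"
  shows "prim_class p \<in> Arr A" "Dom A (prim_class p) = prim_src C J p" "Cod A (prim_class p) = prim_tgt C J p"
  using assms by (auto simp: prim_class_def intro!: dclass_arr)

lemma eps_eta_prim_class: "eps = prim_class Eps" "eta = prim_class Eta"
  by (simp_all add: eps_def eta_def prim_class_def)

lemma eps_eta_arr [simp]:
  "eps \<in> Arr A" "Dom A eps = [J] \<star> Jdual C" "Cod A eps = dunit C"
  "eta \<in> Arr A" "Dom A eta = dunit C" "Cod A eta = Jdual C \<star> [J]"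
  by (simp_all add: eps_eta_prim_class del: dten_singleton dten_Cons)

lemma edge_class:
  assumes "(U, p, V) \<in> dedges C"
  shows "dclass C J (edge_src C J (U, p, V)) [(U, p, V)] (edge_tgt C J (U, p, V))
    = Idt A U \<boxtimes>\<^bsub>A\<^esub> (prim_class p \<boxtimes>\<^bsub>A\<^esub> Idt A V)"
proof -
  have [simp]: "U \<in> dverts C" "V \<in> dverts C" "set_prim p \<subseteq> Arr C" using assms by (auto simp: dedges_iff)
  have p: "dpath C J (prim_src C J p) [prim_edge C p] (prim_tgt C J p)" by simp
  have V: "dpath C J V [] V" "dpath C J U [] U" by simp_all
  show ?thesis
    by (simp add: adjoin_dual_simps prim_class_def dclass_ten[OF p V(1)]
        dclass_ten[OF V(2) dpath_whisk_right[OF \<open>V \<in> dverts C\<close> p, simplified whisk_path_simps]])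
      (simp add: edge_src_def edge_tgt_def prim_edge_def whisk_def)
qed

lemma dclass_Cons:
  assumes "dpath C J U (a # es) V"
  shows "dclass C J U (a # es) V
    = dclass C J (edge_tgt C J a) es V \<cdot>\<^bsub>A\<^esub> dclass C J (edge_src C J a) [a] (edge_tgt C J a)"
  using assms by (subst adjoin_dual_simps, subst dclass_comp) auto

lemma adjoin_dual_arr_induct [consumes 1, case_names idt comp ten eps eta bar]:
  assumes f: "f \<in> Arr A"
    and idt: "\<And>U. U \<in> dverts C \<Longrightarrow> P (Idt A U)"
    and comp: "\<And>f g. \<lbrakk>f \<in> Arr A; g \<in> Arr A; Dom A g = Cod A f; P f; P g\<rbrakk> \<Longrightarrow> P (g \<cdot>\<^bsub>A\<^esub> f)"
    and ten: "\<And>f g. \<lbrakk>f \<in> Arr A; g \<in> Arr A; P f; P g\<rbrakk> \<Longrightarrow> P (f \<boxtimes>\<^bsub>A\<^esub> g)"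
    and eps: "P eps" and eta: "P eta" and bar: "\<And>g. g \<in> Arr C \<Longrightarrow> P (prim_class (Bar g))"
  shows "P f"
proof -
  have edge: "P (dclass C J (edge_src C J a) [a] (edge_tgt C J a))" if "a \<in> dedges C" for a
  proof -
    obtain U p V where a: "a = (U, p, V)" by (cases a) auto
    have [simp]: "U \<in> dverts C" "V \<in> dverts C" "set_prim p \<subseteq> Arr C" using that by (auto simp: a dedges_iff)
    have "P (prim_class p)"
      using \<open>set_prim p \<subseteq> Arr C\<close> eps eta bar by (cases p) (auto simp: eps_eta_prim_class)
    then show ?thesis using that by (simp add: a edge_class ten idt)
  qed
  have path: "P (dclass C J U es V)" if "dpath C J U es V" for U es V
    using that
  proof (induction es arbitrary: U)
    case Nil
    then show ?case using idt by (auto simp: adjoin_dual_simps)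
  next
    case (Cons a es)
    then have "P (dclass C J (edge_tgt C J a) es V \<cdot>\<^bsub>A\<^esub> dclass C J (edge_src C J a) [a] (edge_tgt C J a))"
      by (intro comp edge) (auto intro!: dclass_arr)
    then show ?case using dclass_Cons[OF Cons.prems] by simp
  qed
  show ?thesis using f path by (auto elim!: adjoin_dual_arrE)
qed

definition incl :: "('o, 'm, 'o list, ('o, 'm) darr) jmor" where
  "incl = (\<lparr>ob_map = (\<lambda>a \<in> Obj C. [a]), ar_map = (\<lambda>f \<in> Arr C. prim_class (Bar f)),
      mult = (\<lambda>(a, b) \<in> Obj C \<times> Obj C. Idt A [a \<otimes> b]), unit_map = Idt A (dunit C)\<rparr>, Idt A [J])"

lemma bar_comp:
  assumes "f \<in> Arr C" "g \<in> Arr C" "Dom C g = Cod C f"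
  shows "prim_class (Bar (g \<cdot> f)) = prim_class (Bar g) \<cdot>\<^bsub>A\<^esub> prim_class (Bar f)"
proof -
  have "dpath C J [Dom C f] [prim_edge C (Bar f)] [Cod C f]" "dpath C J [Dom C g] [prim_edge C (Bar g)] [Cod C g]"
    using assms by simp_all
  moreover have "base_rel C J [Dom C f] [prim_edge C (Bar (g \<cdot> f))] [prim_edge C (Bar f), prim_edge C (Bar g)] [Cod C g]"
    using assms by (intro base_rel.bar_comp) auto
  ultimately show ?thesis
    using assms by (simp add: prim_class_def adjoin_dual_simps dclass_comp dclass_eqI[OF dcong.base] del: dpath.simps)
qed

lemma bar_idt: "a \<in> Obj C \<Longrightarrow> prim_class (Bar (Idt C a)) = Idt A [a]"
  using dclass_eqI[OF dcong.base[OF base_rel.bar_idt]] by (simp add: prim_class_def adjoin_dual_simps)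

lemma bar_ten:
  assumes [simp]: "f \<in> Arr C" "g \<in> Arr C"
  shows "prim_class (Bar (f \<boxtimes> g)) = prim_class (Bar f) \<boxtimes>\<^bsub>A\<^esub> prim_class (Bar g)"
proof -
  have *: "prim_class (Bar (Idt C E \<boxtimes> h \<boxtimes> Idt C F)) = Idt A [E] \<boxtimes>\<^bsub>A\<^esub> (prim_class (Bar h) \<boxtimes>\<^bsub>A\<^esub> Idt A [F])"
    if [simp]: "E \<in> Obj C" "F \<in> Obj C" "h \<in> Arr C" for E F h
  proof -
    have "base_rel C J [E \<otimes> Dom C h \<otimes> F] [prim_edge C (Bar (Idt C E \<boxtimes> h \<boxtimes> Idt C F))]
       [whisk C [E] (prim_edge C (Bar h)) [F]] [E \<otimes> Cod C h \<otimes> F]"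
      by (intro base_rel.bar_whisk) auto
    note r = dclass_eqI[OF dcong.base[OF this]]
    have w: "whisk C [E] (prim_edge C (Bar h)) [F] = ([E], Bar h, [F])"
      by (simp add: whisk_def prim_edge_def)
    have "([E], Bar h, [F]) \<in> dedges C" by (simp add: dedges_iff)
    from edge_class[OF this] show ?thesis
      using r by (simp add: prim_class_def w edge_src_def edge_tgt_def)
  qed
  have 1: "prim_class (Bar (Idt C E \<boxtimes> h)) = Idt A [E] \<boxtimes>\<^bsub>A\<^esub> prim_class (Bar h)" if "E \<in> Obj C" "h \<in> Arr C" for E h
    using *[of E \<I> h] that A.strict_runit_arr[of "prim_class (Bar h)"] by (simp add: dunit_def)
  have 2: "prim_class (Bar (h \<boxtimes> Idt C F)) = prim_class (Bar h) \<boxtimes>\<^bsub>A\<^esub> Idt A [F]" if "F \<in> Obj C" "h \<in> Arr C" for F h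
    using *[of \<I> F h] that A.strict_lunit_arr[of "prim_class (Bar h) \<boxtimes>\<^bsub>A\<^esub> Idt A [F]"] by (simp add: dunit_def)
  have "prim_class (Bar (f \<boxtimes> g)) = prim_class (Bar ((Idt C (Cod C f) \<boxtimes> g) \<cdot> (f \<boxtimes> Idt C (Dom C g))))"
    by (simp add: merge)
  also have "\<dots> = (Idt A [Cod C f] \<boxtimes>\<^bsub>A\<^esub> prim_class (Bar g)) \<cdot>\<^bsub>A\<^esub> (prim_class (Bar f) \<boxtimes>\<^bsub>A\<^esub> Idt A [Dom C g])"
    by (simp add: bar_comp 1 2)
  also have "\<dots> = prim_class (Bar f) \<boxtimes>\<^bsub>A\<^esub> prim_class (Bar g)"
    by (simp add: A.merge)
  finally show ?thesis .
qed

lemma one_mor_incl: "one_mor C J A [J] incl"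
proof -
  have d: "dunit C = [\<I>]" by (simp add: dunit_def)
  interpret strong_monoidal_functor C A "fst incl"
    by (rule strong_monoidal_functorI)
      (auto simp: incl_def bar_comp bar_idt bar_ten d monoidal_category_axioms A.monoidal_category_axioms)
  have "pointed_functor C J A [J] (fst incl) (snd incl)"
    by unfold_locales (auto simp: incl_def)
  then show ?thesis by (simp flip: one_mor_iff)
qed

lemma incl_simps [simp]:
  "a \<in> Obj C \<Longrightarrow> ob_map (fst incl) a = [a]" "f \<in> Arr C \<Longrightarrow> ar_map (fst incl) f = prim_class (Bar f)"
  "\<lbrakk>a \<in> Obj C; b \<in> Obj C\<rbrakk> \<Longrightarrow> mult (fst incl) (a, b) = Idt A [a \<otimes> b]"
  "unit_map (fst incl) = Idt A (dunit C)" "snd incl = Idt A [J]"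
  by (simp_all add: incl_def)

lemma functor_rep:
  assumes "strong_monoidal_functor A X f"
  shows "strict_source A X f"
    "monoid_rep X (dverts C) (dten C) (dunit C) (ob_map f) (\<lambda>U V. mult f (U, V)) (unit_map f)"
proof -
  show s: "strict_source A X f"
    using assms A.strict_monoidal_category_axioms by (simp add: strict_source_def)
  interpret s: strict_source A X f by fact
  show "monoid_rep X (dverts C) (dten C) (dunit C) (ob_map f) (\<lambda>U V. mult f (U, V)) (unit_map f)"
    using s.rep.monoid_rep_axioms by simp
qed

lemma transformation_counit:
  assumes "two_mor A [J] X K (f, p) (f', p') r"
  shows "(inv_arr X (unit_map f') \<cdot>\<^bsub>X\<^esub> (ar_map f' eps \<cdot>\<^bsub>X\<^esub> mult f' ([J], Jdual C))) \<cdot>\<^bsub>X\<^esub> (r [J] \<boxtimes>\<^bsub>X\<^esub> r (Jdual C))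
    = inv_arr X (unit_map f) \<cdot>\<^bsub>X\<^esub> (ar_map f eps \<cdot>\<^bsub>X\<^esub> mult f ([J], Jdual C))"
proof -
  interpret r: pointed_transformation A "[J]" X K f p f' p' r using assms by (simp add: two_mor_iff)
  have [simp]: "ob_map f U \<in> Obj X" "ob_map f' U \<in> Obj X" "r U \<in> Arr X" "Dom X (r U) = ob_map f U"
      "Cod X (r U) = ob_map f' U" if "U \<in> dverts C" for U
    using that r.F.functor_obj[of U] r.G.functor_obj[of U] r.component[of U] by simp_all
  have m: "mult f ([J], Jdual C) \<in> Arr X" "Dom X (mult f ([J], Jdual C)) = ob_map f [J] \<otimes>\<^bsub>X\<^esub> ob_map f (Jdual C)"
      "Cod X (mult f ([J], Jdual C)) = ob_map f ([J] \<star> Jdual C)"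
      "mult f' ([J], Jdual C) \<in> Arr X" "Dom X (mult f' ([J], Jdual C)) = ob_map f' [J] \<otimes>\<^bsub>X\<^esub> ob_map f' (Jdual C)"
      "Cod X (mult f' ([J], Jdual C)) = ob_map f' ([J] \<star> Jdual C)"
    using r.F.mult_arr[of "[J]" "Jdual C"] r.G.mult_arr[of "[J]" "Jdual C"]
    by (simp_all del: dten_singleton dten_Cons)
  have u: "inv_arr X (unit_map f') \<cdot>\<^bsub>X\<^esub> r (dunit C) = inv_arr X (unit_map f)"
  proof -
    have "r (dunit C) = unit_map f' \<cdot>\<^bsub>X\<^esub> inv_arr X (unit_map f)"
      using r.unital by (intro r.F.cod.iso_move_right) (auto simp: r.F.unit_arr[simplified])
    then show ?thesis using r.F.unit_arr r.G.unit_arr by simp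
  qed
  have mon: "r ([J] \<star> Jdual C) \<cdot>\<^bsub>X\<^esub> mult f ([J], Jdual C) = mult f' ([J], Jdual C) \<cdot>\<^bsub>X\<^esub> (r [J] \<boxtimes>\<^bsub>X\<^esub> r (Jdual C))"
    using r.monoidal[of "[J]" "Jdual C"] by (simp del: dten_singleton dten_Cons)
  have nat: "ar_map f' eps \<cdot>\<^bsub>X\<^esub> r ([J] \<star> Jdual C) = r (dunit C) \<cdot>\<^bsub>X\<^esub> ar_map f eps"
    using r.natural[of eps] by (simp del: dten_singleton dten_Cons)
  show ?thesis
    using m r.F.unit_arr r.G.unit_arr
    by (simp add: mon[symmetric] r.F.cod.reassoc4[OF nat] r.F.cod.reassoc[OF u] del: dten_singleton dten_Cons)
qed

lemma transformation_star:
  assumes r: "two_mor A [J] X K (f, p) (f', p') r" and [simp]: "U \<in> dverts C" "V \<in> dverts C"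
  shows "r (U \<star> V) = star X (\<lambda>U V. mult f (U, V)) (\<lambda>U V. mult f' (U, V)) U U (r U) V V (r V)"
proof -
  interpret r: pointed_transformation A "[J]" X K f p f' p' r using r by (simp add: two_mor_iff)
  interpret R: monoid_rep2 X "dverts C" "dten C" "dunit C" "ob_map f" "\<lambda>U V. mult f (U, V)" "unit_map f"
      "ob_map f'" "\<lambda>U V. mult f' (U, V)" "unit_map f'"
    by (intro monoid_rep2I functor_rep r.F.strong_monoidal_functor_axioms r.G.strong_monoidal_functor_axioms)
  show ?thesis
    using r.monoidal[of U V] r.component by (intro R.star_eqI) auto
qed

lemma incl_restrict_faithful:
  assumes r: "two_mor A [J] X K G G' r" and s: "two_mor A [J] X K G G' s"
    and eq: "\<And>c. c \<in> Obj C \<Longrightarrow> r [c] = s [c]"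
  shows "r = s"
proof (rule two_mor_ext[OF r s])
  obtain f p f' p' where G: "G = (f, p)" "G' = (f', p')" by (metis surj_pair)
  note r = r[unfolded G] and s = s[unfolded G]
  interpret r: pointed_transformation A "[J]" X K f p f' p' r using r by (simp add: two_mor_iff)
  interpret s: pointed_transformation A "[J]" X K f p f' p' s using s by (simp add: two_mor_iff)
  interpret f': strict_source A X f' by (intro functor_rep r.G.strong_monoidal_functor_axioms)
  have d: "r (Jdual C) = s (Jdual C)"
    by (rule r.F.cod.mate_unique[OF f'.preserves_dual[OF is_right_dual_adjoin_dual] r.J_iso])
      (use r.component s.component transformation_counit[OF r] transformation_counit[OF s] eq in auto)
  have "r U = s U" if "U \<in> dverts C" for U using that
  proof (induction U rule: dverts_induct)
    case (Cons a U)
    then show ?case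
      by (simp only: Cons_eq_dten) (simp add: transformation_star[OF r] transformation_star[OF s] d eq del: dten_singleton dten_Cons)
  qed (rule eq)
  then show "\<And>U. U \<in> Obj A \<Longrightarrow> r U = s U" by simp
qed

end

locale word_transformation = dual_adjunction C J + monoid_rep2 X "dverts C" "dten C" "dunit C" F mu u F' mu' u'
  for C :: "('o, 'm) moncat" and J :: 'o and X :: "('p, 'q) moncat" (structure) and F mu u F' mu' u' +
  fixes t :: "'o \<Rightarrow> 'q" and d :: 'q
  assumes t_arr [simp]: "a \<in> Obj C \<Longrightarrow> t a \<in> Arr X" "a \<in> Obj C \<Longrightarrow> Dom X (t a) = F [a]"
      "a \<in> Obj C \<Longrightarrow> Cod X (t a) = F' [a]"
    and d_arr [simp]: "d \<in> Arr X" "Dom X d = F (Jdual C)" "Cod X d = F' (Jdual C)"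
    and t_ten: "\<lbrakk>a \<in> Obj C; b \<in> Obj C\<rbrakk> \<Longrightarrow> t (a \<otimes>\<^bsub>C\<^esub> b) = star X mu mu' [a] [a] (t a) [b] [b] (t b)"
    and t_unit: "t \<I>\<^bsub>C\<^esub> = u' \<cdot> inv_arr X u"
begin

abbreviation w :: "'o list \<Rightarrow> 'q" where "w \<equiv> word_component C X mu mu' t d"

lemma w_Cons: "U \<in> dverts C \<Longrightarrow> w (a # U) = star X mu mu' [a] [a] (t a) (Jdual C \<star> U) (Jdual C \<star> U)
    (star X mu mu' (Jdual C) (Jdual C) d U U (w U))"
  by (cases U) auto

lemma w_arr [simp]:
  assumes "U \<in> dverts C"
  shows "w U \<in> Arr X" "Dom X (w U) = F U" "Cod X (w U) = F' U"
proof -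
  have "w U \<in> Arr X \<and> Dom X (w U) = F U \<and> Cod X (w U) = F' U" using assms
  proof (induction U rule: dverts_induct)
    case (Cons a U)
    then show ?case unfolding w_Cons[OF Cons(2)] unfolding Cons_eq_dten[OF Cons(1,2)]
      by (simp del: dten_singleton dten_Cons)
  qed simp
  then show "w U \<in> Arr X" "Dom X (w U) = F U" "Cod X (w U) = F' U" by simp_all
qed

lemma w_ten:
  assumes "U \<in> dverts C" and V [simp]: "V \<in> dverts C"
  shows "w (U \<star> V) = star X mu mu' U U (w U) V V (w V)"
  using assms(1)
proof (induction U rule: dverts_induct)
  case (single a)
  note [simp] = single
  show ?case using V
  proof (cases rule: dverts_cases)
    case (single b)
    then show ?thesis by (simp add: t_ten)
  next
    case (Cons b V')
    then show ?thesis
      using star_assoc[of "[a]" "[a]" "[b]" "[b]" "Jdual C \<star> V'" "Jdual C \<star> V'" "t a" "t b"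
        "star X mu mu' (Jdual C) (Jdual C) d V' V' (w V')"]
      by (simp add: w_Cons t_ten Cons_eq_dten[symmetric] del: dten_Cons)
  qed
next
  case (Cons a U)
  have ne: "U \<noteq> []" using Cons(2) by auto
  note [simp] = Cons(1,2)
  have "w ((a # U) \<star> V) = w (a # (U \<star> V))" using ne by simp
  also have "\<dots> = star X mu mu' [a] [a] (t a) (Jdual C \<star> U \<star> V) (Jdual C \<star> U \<star> V)
      (star X mu mu' (Jdual C) (Jdual C) d (U \<star> V) (U \<star> V) (star X mu mu' U U (w U) V V (w V)))"
    by (simp add: w_Cons Cons.IH)
  also have "\<dots> = star X mu mu' [a] [a] (t a) ((Jdual C \<star> U) \<star> V) ((Jdual C \<star> U) \<star> V)
      (star X mu mu' (Jdual C \<star> U) (Jdual C \<star> U) (star X mu mu' (Jdual C) (Jdual C) d U U (w U)) V V (w V))"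
    by (simp add: star_assoc[of "Jdual C" "Jdual C" U U V V])
  also have "\<dots> = star X mu mu' ([a] \<star> Jdual C \<star> U) ([a] \<star> Jdual C \<star> U) (star X mu mu' [a] [a] (t a) (Jdual C \<star> U) (Jdual C \<star> U)
      (star X mu mu' (Jdual C) (Jdual C) d U U (w U))) V V (w V)"
    by (simp add: star_assoc[of "[a]" "[a]" "Jdual C \<star> U" "Jdual C \<star> U" V V] del: dten_singleton dten_Cons dten_assoc)
  also have "\<dots> = star X mu mu' (a # U) (a # U) (w (a # U)) V V (w V)"
    unfolding w_Cons[OF Cons(2)] unfolding Cons_eq_dten[OF Cons(1,2)] ..
  finally show ?case .
qed

lemma w_Jdual: "w (Jdual C) = d"
proof -
  have "w (Jdual C) = star X mu mu' (dunit C) (dunit C) (u' \<cdot> inv_arr X u) (Jdual C \<star> dunit C) (Jdual C \<star> dunit C)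
    (star X mu mu' (Jdual C) (Jdual C) d (dunit C) (dunit C) (u' \<cdot> inv_arr X u))"
    by (simp add: Jdual_def dunit_def t_unit)
  then show ?thesis by (simp add: star_unit_left star_unit_right)
qed

end

context dual_adjunction
begin

lemma incl_restrict_full:
  assumes G: "one_mor A [J] X K G" and G': "one_mor A [J] X K G'"
    and t: "two_mor C J X K (jcomp C X G incl) (jcomp C X G' incl) t"
  obtains r where "two_mor A [J] X K G G' r" "(\<lambda>c \<in> Obj C. r (ob_map (fst incl) c)) = t"
proof -
  obtain f p f' p' where eq: "G = (f, p)" "G' = (f', p')" by (metis surj_pair)
  interpret f: pointed_functor A "[J]" X K f p using G by (simp add: eq one_mor_iff)
  interpret f': pointed_functor A "[J]" X K f' p' using G' by (simp add: eq one_mor_iff)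
  interpret t: pointed_transformation C J X K "fst (jcomp C X G incl)" "snd (jcomp C X G incl)"
      "fst (jcomp C X G' incl)" "snd (jcomp C X G' incl)" t
    using t by (simp flip: two_mor_iff)
  interpret fs: strict_source A X f by (intro functor_rep f.strong_monoidal_functor_axioms)
  interpret fs': strict_source A X f' by (intro functor_rep f'.strong_monoidal_functor_axioms)
  let ?m = "\<lambda>U V. mult f (U, V)" and ?m' = "\<lambda>U V. mult f' (U, V)"
  have rep: "monoid_rep X (dverts C) (dten C) (dunit C) (ob_map f) ?m (unit_map f)"
    "monoid_rep X (dverts C) (dten C) (dunit C) (ob_map f') ?m' (unit_map f')"
    by (intro functor_rep f.strong_monoidal_functor_axioms f'.strong_monoidal_functor_axioms)+
  interpret R: monoid_rep2 X "dverts C" "dten C" "dunit C" "ob_map f" ?m "unit_map f" "ob_map f'" ?m' "unit_map f'"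
    by (intro monoid_rep2I rep)
  have incl: "incl = (fst incl, snd incl)" by (rule prod.collapse[symmetric])
  note jc = jcomp_Pair[of C X _ _ "fst incl" "snd incl", folded incl]
  have t_arr: "t a \<in> Arr X" "Dom X (t a) = ob_map f [a]" "Cod X (t a) = ob_map f' [a]" if "a \<in> Obj C" for a
    using that t.component[of a] by (simp_all add: eq)
  have t_ten: "t (a \<otimes> b) = star X ?m ?m' [a] [a] (t a) [b] [b] (t b)" if "a \<in> Obj C" "b \<in> Obj C" for a b
    using that t.monoidal[of a b] t_arr
    by (intro R.star_eqI) (simp_all add: eq jc)
  have t_unit: "t \<I> = unit_map f' \<cdot>\<^bsub>X\<^esub> inv_arr X (unit_map f)"
    using t.unital t_arr[of \<I>] by (intro f.cod.iso_move_right) (simp_all add: eq jc dunit_def)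
  have tJ: "p' \<cdot>\<^bsub>X\<^esub> t J = p"
    using t.pointed t_arr[of J] f.p_arr f'.p_arr by (simp add: eq jc)
  have t_bar: "ar_map f' (prim_class (Bar g)) \<cdot>\<^bsub>X\<^esub> t (Dom C g) = t (Cod C g) \<cdot>\<^bsub>X\<^esub> ar_map f (prim_class (Bar g))"
    if "g \<in> Arr C" for g
    using that t.natural[of g "Dom C g"] by (simp add: eq jc)
  let ?e = "inv_arr X (unit_map f) \<cdot>\<^bsub>X\<^esub> (ar_map f eps \<cdot>\<^bsub>X\<^esub> ?m [J] (Jdual C))"
  let ?h = "inv_arr X (?m (Jdual C) [J]) \<cdot>\<^bsub>X\<^esub> (ar_map f eta \<cdot>\<^bsub>X\<^esub> unit_map f)"
  let ?e' = "inv_arr X (unit_map f') \<cdot>\<^bsub>X\<^esub> (ar_map f' eps \<cdot>\<^bsub>X\<^esub> ?m' [J] (Jdual C))"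
  let ?h' = "inv_arr X (?m' (Jdual C) [J]) \<cdot>\<^bsub>X\<^esub> (ar_map f' eta \<cdot>\<^bsub>X\<^esub> unit_map f')"
  have "is_iso X (t J)" using t.J_iso .
  then obtain d where d: "d \<in> Hom X (ob_map f (Jdual C)) (ob_map f' (Jdual C))"
    "?e' \<cdot>\<^bsub>X\<^esub> (t J \<boxtimes>\<^bsub>X\<^esub> d) = ?e" "(d \<boxtimes>\<^bsub>X\<^esub> t J) \<cdot>\<^bsub>X\<^esub> ?h = ?h'"
    using f.cod.mate_exists[OF fs.preserves_dual[OF is_right_dual_adjoin_dual]
        fs'.preserves_dual[OF is_right_dual_adjoin_dual], of "t J"] t_arr[of J] by auto
  interpret w: word_transformation C J X "ob_map f" ?m "unit_map f" "ob_map f'" ?m' "unit_map f'" t d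
    by unfold_locales (use d t_arr t_ten t_unit in auto)
  note [simp] = d(1)[simplified] t_arr eq
  have [simp]: "[J] \<in> dverts C" by simp
  have wJ: "w.w ([J] \<star> Jdual C) \<cdot>\<^bsub>X\<^esub> ?m [J] (Jdual C) = ?m' [J] (Jdual C) \<cdot>\<^bsub>X\<^esub> (t J \<boxtimes>\<^bsub>X\<^esub> d)"
    "w.w (Jdual C \<star> [J]) \<cdot>\<^bsub>X\<^esub> ?m (Jdual C) [J] = ?m' (Jdual C) [J] \<cdot>\<^bsub>X\<^esub> (d \<boxtimes>\<^bsub>X\<^esub> t J)"
    by (simp_all add: w.w_ten w.w_Jdual R.star_mu del: dten_singleton dten_Cons)
  have wu: "w.w (dunit C) = unit_map f' \<cdot>\<^bsub>X\<^esub> inv_arr X (unit_map f)" by (simp add: dunit_def t_unit)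
  have nat: "ar_map f' g \<cdot>\<^bsub>X\<^esub> w.w (Dom A g) = w.w (Cod A g) \<cdot>\<^bsub>X\<^esub> ar_map f g" if "g \<in> Arr A" for g
    using that
  proof (induction g rule: adjoin_dual_arr_induct)
    case (idt U)
    then show ?case using f.functor_idt[of U] f'.functor_idt[of U] by simp
  next
    case (comp g h)
    have [simp]: "Dom A g \<in> dverts C" "Cod A g \<in> dverts C" "Cod A h \<in> dverts C"
      using A.dom_in_obj[OF comp(1)] A.cod_in_obj[OF comp(1)] A.cod_in_obj[OF comp(2)] by auto
    show ?case using comp f.cod.reassoc4[OF comp(5)] by simp
  next
    case (ten g h)
    have [simp]: "Dom A g \<in> dverts C" "Cod A g \<in> dverts C" "Dom A h \<in> dverts C" "Cod A h \<in> dverts C"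
      using A.dom_in_obj[OF ten(1)] A.cod_in_obj[OF ten(1)] A.dom_in_obj[OF ten(2)] A.cod_in_obj[OF ten(2)] by auto
    show ?case using ten
      by (simp add: fs.functor_ten fs'.functor_ten w.w_ten star_comp[OF rep(1,1,2)] star_comp[OF rep(1,2,2)])
  next
    case eps
    have "ar_map f' eps \<cdot>\<^bsub>X\<^esub> w.w ([J] \<star> Jdual C) = w.w (dunit C) \<cdot>\<^bsub>X\<^esub> ar_map f eps"
    proof -
      have "(ar_map f' eps \<cdot>\<^bsub>X\<^esub> w.w ([J] \<star> Jdual C)) \<cdot>\<^bsub>X\<^esub> ?m [J] (Jdual C)
          = ar_map f' eps \<cdot>\<^bsub>X\<^esub> (?m' [J] (Jdual C) \<cdot>\<^bsub>X\<^esub> (t J \<boxtimes>\<^bsub>X\<^esub> d))"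
        by (simp add: wJ del: dten_singleton dten_Cons)
      also have "\<dots> = unit_map f' \<cdot>\<^bsub>X\<^esub> (?e' \<cdot>\<^bsub>X\<^esub> (t J \<boxtimes>\<^bsub>X\<^esub> d))"
        by (simp del: dten_singleton dten_Cons)
      also have "\<dots> = (w.w (dunit C) \<cdot>\<^bsub>X\<^esub> ar_map f eps) \<cdot>\<^bsub>X\<^esub> ?m [J] (Jdual C)"
        unfolding d(2) wu by (simp del: dten_singleton dten_Cons)
      finally show ?thesis
        by (rule f.cod.iso_cancel_right[rotated]) (simp_all del: dten_singleton dten_Cons)
    qed
    then show ?case by (simp del: dten_singleton dten_Cons)
  next
    case eta
    have "ar_map f' eta \<cdot>\<^bsub>X\<^esub> w.w (dunit C) = w.w (Jdual C \<star> [J]) \<cdot>\<^bsub>X\<^esub> ar_map f eta"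
    proof -
      have "(ar_map f' eta \<cdot>\<^bsub>X\<^esub> w.w (dunit C)) \<cdot>\<^bsub>X\<^esub> unit_map f = ?m' (Jdual C) [J] \<cdot>\<^bsub>X\<^esub> ?h'"
        unfolding wu by (simp del: dten_singleton dten_Cons)
      also have "\<dots> = (?m' (Jdual C) [J] \<cdot>\<^bsub>X\<^esub> (d \<boxtimes>\<^bsub>X\<^esub> t J)) \<cdot>\<^bsub>X\<^esub> ?h"
        unfolding d(3)[symmetric] by (simp del: dten_singleton dten_Cons)
      also have "\<dots> = (w.w (Jdual C \<star> [J]) \<cdot>\<^bsub>X\<^esub> ar_map f eta) \<cdot>\<^bsub>X\<^esub> unit_map f"
        unfolding wJ(2)[symmetric] by (simp del: dten_singleton dten_Cons)
      finally show ?thesis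
        by (rule f.cod.iso_cancel_right[rotated]) (simp_all del: dten_singleton dten_Cons)
    qed
    then show ?case by (simp del: dten_singleton dten_Cons)
  next
    case (bar g)
    then show ?case using t_bar[of g] by simp
  qed
  have "two_mor A [J] X K (f, p) (f', p') (\<lambda>U \<in> dverts C. w.w U)"
    unfolding two_mor_iff
  proof
    fix g U assume g: "g \<in> Arr A" "Dom A g = U"
    then have "U \<in> dverts C" "Cod A g \<in> dverts C"
      using A.dom_in_obj[of g] A.cod_in_obj[of g] by auto
    then show "ar_map f' g \<cdot>\<^bsub>X\<^esub> (\<lambda>U \<in> dverts C. w.w U) U = (\<lambda>U \<in> dverts C. w.w U) (Cod A g) \<cdot>\<^bsub>X\<^esub> ar_map f g"
      using nat[of g] g by simp
  qed (auto simp: w.w_ten R.star_mu wu tJ)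
  moreover have "(\<lambda>c \<in> Obj C. (\<lambda>U \<in> dverts C. w.w U) (ob_map (fst incl) c)) = t"
  proof (rule extensionalityI[of _ "Obj C"])
    show "t \<in> extensional (Obj C)" by (rule t.s_ext)
  qed auto
  ultimately show ?thesis using that by (simp add: eq)
qed

end

section \<open>Extension along the inclusion\<close>

context monoidal_category
begin

lemma mult_step_left:
  assumes [simp]: "P \<in> Obj C" "U \<in> Obj C" "V \<in> Obj C" "W \<in> Obj C"
    "m \<in> Arr C" "Dom C m = U \<otimes> V" "Cod C m = T" "m' \<in> Arr C" "Dom C m' = T \<otimes> W" "Cod C m' = R"
    "n \<in> Arr C" "Dom C n = V \<otimes> W" "Cod C n = S" "n' \<in> Arr C" "Dom C n' = U \<otimes> S" "Cod C n' = R"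
    and eq: "m' \<cdot> (m \<boxtimes> Idt C W) = n' \<cdot> ((Idt C U \<boxtimes> n) \<cdot> Assoc C U V W)"
  shows "((Idt C P \<boxtimes> m') \<cdot> Assoc C P T W) \<cdot> (((Idt C P \<boxtimes> m) \<cdot> Assoc C P U V) \<boxtimes> Idt C W)
    = ((Idt C P \<boxtimes> n') \<cdot> Assoc C P U S) \<cdot> ((Idt C (P \<otimes> U) \<boxtimes> n) \<cdot> Assoc C (P \<otimes> U) V W)"
proof -
  have [simp]: "T \<in> Obj C" "S \<in> Obj C" using cod_in_obj[of m] cod_in_obj[of n] by simp_all
  have "((Idt C P \<boxtimes> m') \<cdot> Assoc C P T W) \<cdot> (((Idt C P \<boxtimes> m) \<cdot> Assoc C P U V) \<boxtimes> Idt C W)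
    = (Idt C P \<boxtimes> m') \<cdot> (Assoc C P T W \<cdot> (((Idt C P \<boxtimes> m) \<boxtimes> Idt C W) \<cdot> (Assoc C P U V \<boxtimes> Idt C W)))"
    by (simp add: merge)
  also have "\<dots> = (Idt C P \<boxtimes> m') \<cdot> ((Idt C P \<boxtimes> (m \<boxtimes> Idt C W)) \<cdot> (Assoc C P (U \<otimes> V) W \<cdot> (Assoc C P U V \<boxtimes> Idt C W)))"
    by (simp add: reassoc4[OF assoc_natural_rev])
  also have "\<dots> = (Idt C P \<boxtimes> n') \<cdot> ((Idt C P \<boxtimes> (Idt C U \<boxtimes> n)) \<cdot> ((Idt C P \<boxtimes> Assoc C U V W)
      \<cdot> (Assoc C P (U \<otimes> V) W \<cdot> (Assoc C P U V \<boxtimes> Idt C W))))"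
    by (simp add: eq merge)
  also have "\<dots> = (Idt C P \<boxtimes> n') \<cdot> ((Idt C P \<boxtimes> (Idt C U \<boxtimes> n)) \<cdot> (Assoc C P U (V \<otimes> W) \<cdot> Assoc C (P \<otimes> U) V W))"
    using pentagon[of P U V W] by simp
  also have "\<dots> = (Idt C P \<boxtimes> n') \<cdot> (Assoc C P U S \<cdot> (((Idt C P \<boxtimes> Idt C U) \<boxtimes> n) \<cdot> Assoc C (P \<otimes> U) V W))"
    by (simp add: reassoc4[OF assoc_natural] del: ten_idt_idt)
  finally show ?thesis by simp
qed

lemma mult_step_middle:
  assumes [simp]: "A \<in> Obj C" "B \<in> Obj C" "Q \<in> Obj C" "W \<in> Obj C"
    "m \<in> Arr C" "Dom C m = A \<otimes> B" "Cod C m = D" "z \<in> Arr C" "Dom C z = Q \<otimes> W" "Cod C z = R"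
  shows "((Idt C D \<boxtimes> z) \<cdot> Assoc C D Q W) \<cdot> (((m \<boxtimes> Idt C Q) \<cdot> inv_arr C (Assoc C A B Q)) \<boxtimes> Idt C W)
    = ((m \<boxtimes> Idt C R) \<cdot> inv_arr C (Assoc C A B R))
      \<cdot> ((Idt C A \<boxtimes> ((Idt C B \<boxtimes> z) \<cdot> Assoc C B Q W)) \<cdot> Assoc C A (B \<otimes> Q) W)"
proof -
  have [simp]: "D \<in> Obj C" "R \<in> Obj C" using cod_in_obj[of m] cod_in_obj[of z] by simp_all
  have pent: "inv_arr C (Assoc C A B (Q \<otimes> W)) \<cdot> ((Idt C A \<boxtimes> Assoc C B Q W) \<cdot> Assoc C A (B \<otimes> Q) W)
    = Assoc C (A \<otimes> B) Q W \<cdot> (inv_arr C (Assoc C A B Q) \<boxtimes> Idt C W)"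
  proof -
    have "((Idt C A \<boxtimes> Assoc C B Q W) \<cdot> Assoc C A (B \<otimes> Q) W) \<cdot> (Assoc C A B Q \<boxtimes> Idt C W)
        = Assoc C A B (Q \<otimes> W) \<cdot> Assoc C (A \<otimes> B) Q W"
      using pentagon[of A B Q W] by simp
    then have "(Idt C A \<boxtimes> Assoc C B Q W) \<cdot> Assoc C A (B \<otimes> Q) W
        = (Assoc C A B (Q \<otimes> W) \<cdot> Assoc C (A \<otimes> B) Q W) \<cdot> inv_arr C (Assoc C A B Q \<boxtimes> Idt C W)"
      by (rule iso_move_right[rotated]) (auto simp: iso_ten)
    then show ?thesis by (simp add: iso_ten)
  qed
  have "((Idt C D \<boxtimes> z) \<cdot> Assoc C D Q W) \<cdot> (((m \<boxtimes> Idt C Q) \<cdot> inv_arr C (Assoc C A B Q)) \<boxtimes> Idt C W)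
    = (Idt C D \<boxtimes> z) \<cdot> (Assoc C D Q W \<cdot> (((m \<boxtimes> Idt C Q) \<boxtimes> Idt C W) \<cdot> (inv_arr C (Assoc C A B Q) \<boxtimes> Idt C W)))"
    by (simp add: merge)
  also have "\<dots> = (Idt C D \<boxtimes> z) \<cdot> ((m \<boxtimes> (Idt C Q \<boxtimes> Idt C W)) \<cdot> (Assoc C (A \<otimes> B) Q W
      \<cdot> (inv_arr C (Assoc C A B Q) \<boxtimes> Idt C W)))"
    by (simp add: reassoc4[OF assoc_natural_rev] del: ten_idt_idt)
  also have "\<dots> = (m \<boxtimes> Idt C R) \<cdot> (((Idt C A \<boxtimes> Idt C B) \<boxtimes> z) \<cdot> (inv_arr C (Assoc C A B (Q \<otimes> W))
      \<cdot> ((Idt C A \<boxtimes> Assoc C B Q W) \<cdot> Assoc C A (B \<otimes> Q) W)))"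
    unfolding pent by (simp add: merge)
  also have "\<dots> = (m \<boxtimes> Idt C R) \<cdot> (inv_arr C (Assoc C A B R) \<cdot> ((Idt C A \<boxtimes> (Idt C B \<boxtimes> z))
      \<cdot> ((Idt C A \<boxtimes> Assoc C B Q W) \<cdot> Assoc C A (B \<otimes> Q) W)))"
    by (simp add: reassoc4[OF assoc_inv_natural] del: ten_idt_idt)
  finally show ?thesis by (simp add: merge)
qed

lemma mult_step_right:
  assumes [simp]: "A \<in> Obj C" "B \<in> Obj C" "G \<in> Obj C" "Q \<in> Obj C"
    "m \<in> Arr C" "Dom C m = A \<otimes> B" "Cod C m = D" "m' \<in> Arr C" "Dom C m' = D \<otimes> G" "Cod C m' = R"
    "n \<in> Arr C" "Dom C n = B \<otimes> G" "Cod C n = E" "n' \<in> Arr C" "Dom C n' = A \<otimes> E" "Cod C n' = R"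
    and eq: "m' \<cdot> (m \<boxtimes> Idt C G) = n' \<cdot> ((Idt C A \<boxtimes> n) \<cdot> Assoc C A B G)"
  shows "((m' \<boxtimes> Idt C Q) \<cdot> inv_arr C (Assoc C D G Q)) \<cdot> (m \<boxtimes> Idt C (G \<otimes> Q))
    = ((n' \<boxtimes> Idt C Q) \<cdot> inv_arr C (Assoc C A E Q))
      \<cdot> ((Idt C A \<boxtimes> ((n \<boxtimes> Idt C Q) \<cdot> inv_arr C (Assoc C B G Q))) \<cdot> Assoc C A B (G \<otimes> Q))"
proof -
  have [simp]: "D \<in> Obj C" "E \<in> Obj C" using cod_in_obj[of m] cod_in_obj[of n] by simp_all
  have pent: "(Assoc C A B G \<boxtimes> Idt C Q) \<cdot> inv_arr C (Assoc C (A \<otimes> B) G Q)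
    = inv_arr C (Assoc C A (B \<otimes> G) Q) \<cdot> ((Idt C A \<boxtimes> inv_arr C (Assoc C B G Q)) \<cdot> Assoc C A B (G \<otimes> Q))"
  proof -
    have "((Idt C A \<boxtimes> Assoc C B G Q) \<cdot> Assoc C A (B \<otimes> G) Q) \<cdot> (Assoc C A B G \<boxtimes> Idt C Q)
        = Assoc C A B (G \<otimes> Q) \<cdot> Assoc C (A \<otimes> B) G Q"
      using pentagon[of A B G Q] by simp
    then have "Assoc C A B G \<boxtimes> Idt C Q = inv_arr C ((Idt C A \<boxtimes> Assoc C B G Q) \<cdot> Assoc C A (B \<otimes> G) Q)
        \<cdot> (Assoc C A B (G \<otimes> Q) \<cdot> Assoc C (A \<otimes> B) G Q)"
      by (rule iso_move_left[rotated]) (auto simp: iso_ten iso_comp)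
    then show ?thesis by (simp add: iso_ten iso_comp)
  qed
  have "((m' \<boxtimes> Idt C Q) \<cdot> inv_arr C (Assoc C D G Q)) \<cdot> (m \<boxtimes> Idt C (G \<otimes> Q))
    = (m' \<boxtimes> Idt C Q) \<cdot> (inv_arr C (Assoc C D G Q) \<cdot> (m \<boxtimes> (Idt C G \<boxtimes> Idt C Q)))"
    by simp
  also have "\<dots> = (m' \<boxtimes> Idt C Q) \<cdot> (((m \<boxtimes> Idt C G) \<boxtimes> Idt C Q) \<cdot> inv_arr C (Assoc C (A \<otimes> B) G Q))"
    by (simp add: assoc_inv_natural_rev del: ten_idt_idt)
  also have "\<dots> = (n' \<boxtimes> Idt C Q) \<cdot> (((Idt C A \<boxtimes> n) \<boxtimes> Idt C Q) \<cdot> ((Assoc C A B G \<boxtimes> Idt C Q)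
      \<cdot> inv_arr C (Assoc C (A \<otimes> B) G Q)))"
    by (simp add: merge eq)
  also have "\<dots> = (n' \<boxtimes> Idt C Q) \<cdot> (inv_arr C (Assoc C A E Q) \<cdot> ((Idt C A \<boxtimes> (n \<boxtimes> Idt C Q))
      \<cdot> ((Idt C A \<boxtimes> inv_arr C (Assoc C B G Q)) \<cdot> Assoc C A B (G \<otimes> Q))))"
    unfolding pent by (simp add: reassoc4[OF assoc_inv_natural])
  finally show ?thesis by (simp add: merge)
qed

end

fun word_ob :: "('p, 'q) moncat \<Rightarrow> ('o \<Rightarrow> 'p) \<Rightarrow> 'p \<Rightarrow> 'o list \<Rightarrow> 'p" where
  "word_ob X H Y [] = undefined"
| "word_ob X H Y [a] = H a"
| "word_ob X H Y (a # b # U) = H a \<otimes>\<^bsub>X\<^esub> (Y \<otimes>\<^bsub>X\<^esub> word_ob X H Y (b # U))"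

fun word_mult :: "('p, 'q) moncat \<Rightarrow> ('o \<Rightarrow> 'p) \<Rightarrow> ('o \<Rightarrow> 'o \<Rightarrow> 'q) \<Rightarrow> 'p \<Rightarrow> 'o list \<Rightarrow> 'o list \<Rightarrow> 'q" where
  "word_mult X H m Y [a] [b] = m a b"
| "word_mult X H m Y [a] (b # c # V) = (m a b \<boxtimes>\<^bsub>X\<^esub> Idt X (Y \<otimes>\<^bsub>X\<^esub> word_ob X H Y (c # V)))
     \<cdot>\<^bsub>X\<^esub> inv_arr X (Assoc X (H a) (H b) (Y \<otimes>\<^bsub>X\<^esub> word_ob X H Y (c # V)))"
| "word_mult X H m Y (a # b # U) V =
     (Idt X (H a) \<boxtimes>\<^bsub>X\<^esub> ((Idt X Y \<boxtimes>\<^bsub>X\<^esub> word_mult X H m Y (b # U) V)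
        \<cdot>\<^bsub>X\<^esub> Assoc X Y (word_ob X H Y (b # U)) (word_ob X H Y V)))
     \<cdot>\<^bsub>X\<^esub> Assoc X (H a) (Y \<otimes>\<^bsub>X\<^esub> word_ob X H Y (b # U)) (word_ob X H Y V)"
| "word_mult X H m Y _ _ = undefined"

locale dual_extension = dual_adjunction C J + H: strict_source C X H
  for C :: "('o, 'm) moncat" and J :: 'o and X :: "('p, 'q) moncat" (structure) and H :: "('o, 'm, 'p, 'q) monfun" +
  fixes Y :: 'p and e h :: 'q
  assumes dual: "is_right_dual X (ob_map H J) Y e h"
begin

lemma Y_obj [simp]: "Y \<in> Obj X"
  using H.cod.is_right_dual_arr[OF dual] by simp

abbreviation ob :: "'o list \<Rightarrow> 'p" where "ob \<equiv> word_ob X (ob_map H) Y"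
abbreviation mu :: "'o list \<Rightarrow> 'o list \<Rightarrow> 'q" where "mu \<equiv> word_mult X (ob_map H) H.mu Y"

lemma ob_Cons: "U \<in> dverts C \<Longrightarrow> ob (a # U) = ob_map H a \<otimes> (Y \<otimes> ob U)"
  by (cases U) auto

lemma mu_single_Cons: "V \<in> dverts C \<Longrightarrow> mu [a] (b # V) = (H.mu a b \<boxtimes> Idt X (Y \<otimes> ob V))
     \<cdot> inv_arr X (Assoc X (ob_map H a) (ob_map H b) (Y \<otimes> ob V))"
  by (cases V) auto

lemma mu_Cons: "U \<in> dverts C \<Longrightarrow> mu (a # U) V =
     (Idt X (ob_map H a) \<boxtimes> ((Idt X Y \<boxtimes> mu U V) \<cdot> Assoc X Y (ob U) (ob V)))
     \<cdot> Assoc X (ob_map H a) (Y \<otimes> ob U) (ob V)"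
  by (cases U) auto

lemma ob_obj [simp]: "U \<in> dverts C \<Longrightarrow> ob U \<in> Obj X"
  by (induction U rule: dverts_induct) (simp_all add: ob_Cons)

lemma dten_Cons_dverts: "U \<in> dverts C \<Longrightarrow> (a # U) \<star> V = a # (U \<star> V)"
  by (rule dten_Cons) auto

lemma mu_arr_iso:
  assumes "U \<in> dverts C" and V [simp]: "V \<in> dverts C"
  shows "mu U V \<in> Arr X \<and> Dom X (mu U V) = ob U \<otimes> ob V \<and> Cod X (mu U V) = ob (U \<star> V) \<and> is_iso X (mu U V)"
  using assms(1)
proof (induction U rule: dverts_induct)
  case (single a)
  note [simp] = single
  show ?case using V
  proof (cases rule: dverts_cases)
    case (Cons b V')
    then show ?thesis by (simp add: mu_single_Cons ob_Cons H.cod.iso_ten H.cod.iso_comp)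
  qed simp
next
  case (Cons a U)
  then show ?case
    by (simp add: mu_Cons ob_Cons dten_Cons_dverts H.cod.iso_ten H.cod.iso_comp)
qed

lemma mu_arr [simp]:
  assumes "U \<in> dverts C" "V \<in> dverts C"
  shows "mu U V \<in> Arr X" "Dom X (mu U V) = ob U \<otimes> ob V" "Cod X (mu U V) = ob (U \<star> V)" "is_iso X (mu U V)"
  using mu_arr_iso[OF assms] by simp_all

lemma mu_coherence:
  assumes "U \<in> dverts C" and V [simp]: "V \<in> dverts C" and W [simp]: "W \<in> dverts C"
  shows "mu (U \<star> V) W \<cdot> (mu U V \<boxtimes> Idt X (ob W))
    = mu U (V \<star> W) \<cdot> ((Idt X (ob U) \<boxtimes> mu V W) \<cdot> Assoc X (ob U) (ob V) (ob W))"
  using assms(1)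
proof (induction U rule: dverts_induct)
  case (single a)
  note [simp] = single
  show ?case using V
  proof (cases rule: dverts_cases)
    case (single b)
    note [simp] = single
    show ?thesis using W
    proof (cases rule: dverts_cases)
      case (single c)
      then show ?thesis using H.rep.mu_assoc[of a b c] by simp
    next
      case (Cons c W')
      note [simp] = Cons
      show ?thesis
        using H.cod.mult_step_right[OF _ _ _ _ _ _ _ _ _ _ _ _ _ _ _ _ H.rep.mu_assoc[of a b c], of "Y \<otimes> ob W'"]
        by (simp add: mu_single_Cons ob_Cons del: H.cod.comp_assoc_right)
    qed
  next
    case (Cons b V')
    note [simp] = Cons
    show ?thesis
      using H.cod.mult_step_middle[of "ob_map H a" "ob_map H b" "Y \<otimes> ob V'" "ob W" "H.mu a b" _
          "(Idt X Y \<boxtimes> mu V' W) \<cdot> Assoc X Y (ob V') (ob W)" "Y \<otimes> ob (V' \<star> W)"]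
      by (simp add: mu_single_Cons mu_Cons ob_Cons dten_Cons_dverts del: H.cod.comp_assoc_right)
  qed
next
  case (Cons a U)
  note [simp] = Cons(1,2)
  have 1: "((Idt X Y \<boxtimes> mu (U \<star> V) W) \<cdot> Assoc X Y (ob (U \<star> V)) (ob W))
      \<cdot> (((Idt X Y \<boxtimes> mu U V) \<cdot> Assoc X Y (ob U) (ob V)) \<boxtimes> Idt X (ob W))
    = ((Idt X Y \<boxtimes> mu U (V \<star> W)) \<cdot> Assoc X Y (ob U) (ob (V \<star> W)))
      \<cdot> ((Idt X (Y \<otimes> ob U) \<boxtimes> mu V W) \<cdot> Assoc X (Y \<otimes> ob U) (ob V) (ob W))"
    by (rule H.cod.mult_step_left[OF _ _ _ _ _ _ _ _ _ _ _ _ _ _ _ _ Cons(3)]) simp_all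
  show ?case
    using H.cod.mult_step_left[OF _ _ _ _ _ _ _ _ _ _ _ _ _ _ _ _ 1, of "ob_map H a"]
    by (simp add: mu_Cons ob_Cons dten_Cons_dverts del: H.cod.comp_assoc_right)
qed

sublocale rep: monoid_rep X "dverts C" "dten C" "dunit C" ob mu "unit_map H"
proof
  fix U assume U: "U \<in> dverts C"
  show "mu (dunit C) U \<cdot> (unit_map H \<boxtimes> Idt X (ob U)) = LUnit X (ob U)"
    using U
  proof (cases rule: dverts_cases)
    case (single b)
    then show ?thesis using H.rep.mu_lunit[of b] by (simp add: dunit_def)
  next
    case (Cons b V)
    note [simp] = Cons
    let ?Q = "Y \<otimes> ob V"
    have "mu (dunit C) U \<cdot> (unit_map H \<boxtimes> Idt X (ob U))
      = (H.mu \<I>\<^bsub>C\<^esub> b \<boxtimes> Idt X ?Q) \<cdot> (inv_arr X (Assoc X (ob_map H \<I>\<^bsub>C\<^esub>) (ob_map H b) ?Q)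
          \<cdot> (unit_map H \<boxtimes> (Idt X (ob_map H b) \<boxtimes> Idt X ?Q)))"
      by (simp add: dunit_def mu_single_Cons ob_Cons)
    also have "\<dots> = (H.mu \<I>\<^bsub>C\<^esub> b \<boxtimes> Idt X ?Q) \<cdot> (((unit_map H \<boxtimes> Idt X (ob_map H b)) \<boxtimes> Idt X ?Q)
          \<cdot> inv_arr X (Assoc X \<I> (ob_map H b) ?Q))"
      by (simp add: H.cod.assoc_inv_natural_rev del: H.cod.ten_idt_idt)
    also have "\<dots> = (LUnit X (ob_map H b) \<boxtimes> Idt X ?Q) \<cdot> inv_arr X (Assoc X \<I> (ob_map H b) ?Q)"
      using H.rep.mu_lunit[of b] by (simp add: H.cod.merge)
    also have "\<dots> = LUnit X (ob U)"
      by (simp add: ob_Cons flip: H.cod.lunit_ten)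
    finally show ?thesis .
  qed
  show "mu U (dunit C) \<cdot> (Idt X (ob U) \<boxtimes> unit_map H) = RUnit X (ob U)"
    using U
  proof (induction U rule: dverts_induct)
    case (single a)
    then show ?case using H.rep.mu_runit[of a] by (simp add: dunit_def)
  next
    case (Cons a U)
    note [simp] = Cons(1,2)
    have o [simp]: "ob (dunit C) = ob_map H \<I>\<^bsub>C\<^esub>" by (simp add: dunit_def)
    let ?x = "(Idt X Y \<boxtimes> mu U (dunit C)) \<cdot> Assoc X Y (ob U) (ob_map H \<I>\<^bsub>C\<^esub>)"
    have "?x \<cdot> ((Idt X Y \<boxtimes> Idt X (ob U)) \<boxtimes> unit_map H)
        = (Idt X Y \<boxtimes> mu U (dunit C)) \<cdot> ((Idt X Y \<boxtimes> (Idt X (ob U) \<boxtimes> unit_map H)) \<cdot> Assoc X Y (ob U) \<I>)"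
      by (simp add: H.cod.assoc_natural_rev del: H.cod.ten_idt_idt)
    also have "\<dots> = RUnit X (Y \<otimes> ob U)"
      using Cons(3) by (simp add: H.cod.merge H.cod.runit_ten)
    finally have x: "?x \<cdot> (Idt X (Y \<otimes> ob U) \<boxtimes> unit_map H) = RUnit X (Y \<otimes> ob U)"
      by (simp del: H.cod.comp_assoc_right)
    have "mu (a # U) (dunit C) \<cdot> (Idt X (ob (a # U)) \<boxtimes> unit_map H)
      = (Idt X (ob_map H a) \<boxtimes> ?x) \<cdot> (Assoc X (ob_map H a) (Y \<otimes> ob U) (ob_map H \<I>\<^bsub>C\<^esub>)
        \<cdot> ((Idt X (ob_map H a) \<boxtimes> Idt X (Y \<otimes> ob U)) \<boxtimes> unit_map H))"
      by (simp add: mu_Cons ob_Cons)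
    also have "\<dots> = (Idt X (ob_map H a) \<boxtimes> ?x) \<cdot> ((Idt X (ob_map H a) \<boxtimes> (Idt X (Y \<otimes> ob U) \<boxtimes> unit_map H))
        \<cdot> Assoc X (ob_map H a) (Y \<otimes> ob U) \<I>)"
      by (simp add: H.cod.assoc_natural_rev del: H.cod.ten_idt_idt)
    also have "\<dots> = (Idt X (ob_map H a) \<boxtimes> (?x \<cdot> (Idt X (Y \<otimes> ob U) \<boxtimes> unit_map H)))
        \<cdot> Assoc X (ob_map H a) (Y \<otimes> ob U) \<I>"
      by (simp add: H.cod.merge)
    also have "\<dots> = RUnit X (ob (a # U))"
      unfolding x by (simp add: H.cod.runit_ten ob_Cons)
    finally show ?case .
  qed
qed (simp_all add: mu_coherence, simp_all add: dunit_def)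

lemma ob_dunit: "ob (dunit C) = ob_map H \<I>\<^bsub>C\<^esub>"
  by (simp add: dunit_def)

lemma ob_single [simp]: "ob [a] = ob_map H a"
  by simp

definition Jdual_iso :: 'q where
  "Jdual_iso = RUnit X Y \<cdot> (LUnit X (Y \<otimes> \<I>)
     \<cdot> (inv_arr X (unit_map H) \<boxtimes> (Idt X Y \<boxtimes> inv_arr X (unit_map H))))"

lemma Jdual_iso [simp]: "is_iso X Jdual_iso" "Jdual_iso \<in> Arr X" "Dom X Jdual_iso = ob (Jdual C)" "Cod X Jdual_iso = Y"
proof -
  show "is_iso X Jdual_iso" by (simp add: Jdual_iso_def H.cod.iso_comp H.cod.iso_ten)
  then show "Jdual_iso \<in> Arr X" by (rule iso_arr)
qed (simp_all add: Jdual_iso_def Jdual_def)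

abbreviation counit :: 'q where "counit \<equiv> e \<cdot> (Idt X (ob_map H J) \<boxtimes> Jdual_iso)"
abbreviation unit' :: 'q where "unit' \<equiv> (inv_arr X Jdual_iso \<boxtimes> Idt X (ob_map H J)) \<cdot> h"

lemma dual': "is_right_dual X (ob [J]) (ob (Jdual C)) counit unit'"
  using H.cod.is_right_dual_transport[OF dual, of "Idt X (ob_map H J)" "ob_map H J" Jdual_iso "ob (Jdual C)"] by simp

fun prim_arr :: "'m prim \<Rightarrow> 'q" where
  "prim_arr Eps = unit_map H \<cdot> (counit \<cdot> inv_arr X (mu [J] (Jdual C)))"
| "prim_arr Eta = mu (Jdual C) [J] \<cdot> (unit' \<cdot> inv_arr X (unit_map H))"
| "prim_arr (Bar f) = ar_map H f"

declare dten_singleton [simp del] dten_Cons [simp del] word_ob.simps [simp del]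

lemma prim_arr [simp]:
  assumes "set_prim p \<subseteq> Arr C"
  shows "prim_arr p \<in> Arr X" "Dom X (prim_arr p) = ob (prim_src C J p)" "Cod X (prim_arr p) = ob (prim_tgt C J p)"
proof -
  note [simp] = H.cod.is_right_dual_arr[OF dual]
  have "prim_arr p \<in> Arr X \<and> Dom X (prim_arr p) = ob (prim_src C J p) \<and> Cod X (prim_arr p) = ob (prim_tgt C J p)"
    using assms ob_dunit by (cases p) simp_all
  then show "prim_arr p \<in> Arr X" "Dom X (prim_arr p) = ob (prim_src C J p)" "Cod X (prim_arr p) = ob (prim_tgt C J p)"
    by simp_all
qed

lemma prim_triangles:
  "star X mu mu ([J] \<star> Jdual C) (dunit C) (prim_arr Eps) [J] [J] (Idt X (ob [J]))
    \<cdot> star X mu mu [J] [J] (Idt X (ob [J])) (dunit C) (Jdual C \<star> [J]) (prim_arr Eta) = Idt X (ob [J])"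
  "star X mu mu (Jdual C) (Jdual C) (Idt X (ob (Jdual C))) ([J] \<star> Jdual C) (dunit C) (prim_arr Eps)
    \<cdot> star X mu mu (dunit C) (Jdual C \<star> [J]) (prim_arr Eta) (Jdual C) (Jdual C) (Idt X (ob (Jdual C))) = Idt X (ob (Jdual C))"
proof -
  note [simp] = H.cod.is_right_dual_arr[OF dual'] H.cod.is_right_dual_arr[OF dual]
  have "inv_arr X (unit_map H) \<cdot> (prim_arr Eps \<cdot> mu [J] (Jdual C)) = counit"
    "inv_arr X (mu (Jdual C) [J]) \<cdot> (prim_arr Eta \<cdot> unit_map H) = unit'"
    by simp_all
  then show "star X mu mu ([J] \<star> Jdual C) (dunit C) (prim_arr Eps) [J] [J] (Idt X (ob [J]))
    \<cdot> star X mu mu [J] [J] (Idt X (ob [J])) (dunit C) (Jdual C \<star> [J]) (prim_arr Eta) = Idt X (ob [J])"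
  "star X mu mu (Jdual C) (Jdual C) (Idt X (ob (Jdual C))) ([J] \<star> Jdual C) (dunit C) (prim_arr Eps)
    \<cdot> star X mu mu (dunit C) (Jdual C \<star> [J]) (prim_arr Eta) (Jdual C) (Jdual C) (Idt X (ob (Jdual C))) = Idt X (ob (Jdual C))"
    using dual' rep.is_right_dual_star[of "[J]" "Jdual C" "prim_arr Eps" "prim_arr Eta"]
    by (simp_all del: prim_arr.simps ob_single add: prim_arr)
qed

definition edge_arr :: "('o, 'm) dedge \<Rightarrow> 'q" where
  "edge_arr = (\<lambda>(U, p, V). star X mu mu U U (Idt X (ob U)) (prim_src C J p \<star> V) (prim_tgt C J p \<star> V)
     (star X mu mu (prim_src C J p) (prim_tgt C J p) (prim_arr p) V V (Idt X (ob V))))"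

lemma edge_arr [simp]:
  assumes "a \<in> dedges C"
  shows "edge_arr a \<in> Arr X" "Dom X (edge_arr a) = ob (edge_src C J a)" "Cod X (edge_arr a) = ob (edge_tgt C J a)"
proof -
  have "edge_arr a \<in> Arr X \<and> Dom X (edge_arr a) = ob (edge_src C J a) \<and> Cod X (edge_arr a) = ob (edge_tgt C J a)"
    using assms by (cases a) (simp add: edge_arr_def dedges_iff edge_src_def edge_tgt_def)
  then show "edge_arr a \<in> Arr X" "Dom X (edge_arr a) = ob (edge_src C J a)" "Cod X (edge_arr a) = ob (edge_tgt C J a)"
    by simp_all
qed

lemma edge_arr_whisk:
  assumes "a \<in> dedges C" and [simp]: "T \<in> dverts C" "W \<in> dverts C"
  shows "edge_arr (whisk C T a W) = star X mu mu T T (Idt X (ob T)) (edge_src C J a \<star> W) (edge_tgt C J a \<star> W)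
    (star X mu mu (edge_src C J a) (edge_tgt C J a) (edge_arr a) W W (Idt X (ob W)))"
proof -
  obtain U p V where a: "a = (U, p, V)" by (cases a) auto
  have [simp]: "U \<in> dverts C" "V \<in> dverts C" "set_prim p \<subseteq> Arr C" using assms(1) by (auto simp: a dedges_iff)
  let ?s = "prim_src C J p" and ?t = "prim_tgt C J p"
  let ?x = "star X mu mu ?s ?t (prim_arr p) V V (Idt X (ob V))"
  have "star X mu mu (U \<star> ?s \<star> V) (U \<star> ?t \<star> V) (star X mu mu U U (Idt X (ob U)) (?s \<star> V) (?t \<star> V) ?x) W W (Idt X (ob W))
      = star X mu mu U U (Idt X (ob U)) (?s \<star> V \<star> W) (?t \<star> V \<star> W)
          (star X mu mu ?s ?t (prim_arr p) (V \<star> W) (V \<star> W) (Idt X (ob (V \<star> W))))"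
    using rep.self.star_assoc[of U U "?s \<star> V" "?t \<star> V" W W "Idt X (ob U)" ?x "Idt X (ob W)"]
      rep.self.star_assoc[of ?s ?t V V W W "prim_arr p" "Idt X (ob V)" "Idt X (ob W)"]
    by simp
  then show ?thesis
    using rep.self.star_assoc[of T T U U "?s \<star> V \<star> W" "?t \<star> V \<star> W" "Idt X (ob T)" "Idt X (ob U)"
        "star X mu mu ?s ?t (prim_arr p) (V \<star> W) (V \<star> W) (Idt X (ob (V \<star> W)))"]
    by (simp add: a whisk_def edge_arr_def edge_src_def edge_tgt_def)
qed

lemma edge_arr_prim [simp]: "set_prim p \<subseteq> Arr C \<Longrightarrow> edge_arr (prim_edge C p) = prim_arr p"
  by (simp add: prim_edge_def edge_arr_def)

fun path_arr :: "'o list \<Rightarrow> ('o, 'm) dedge list \<Rightarrow> 'q" where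
  "path_arr U [] = Idt X (ob U)"
| "path_arr U (a # es) = path_arr (edge_tgt C J a) es \<cdot> edge_arr a"

lemma path_arr [simp]:
  "dpath C J U es V \<Longrightarrow> path_arr U es \<in> Arr X"
  "dpath C J U es V \<Longrightarrow> Dom X (path_arr U es) = ob U"
  "dpath C J U es V \<Longrightarrow> Cod X (path_arr U es) = ob V"
proof -
  have "path_arr U es \<in> Arr X \<and> Dom X (path_arr U es) = ob U \<and> Cod X (path_arr U es) = ob V" if "dpath C J U es V"
    using that by (induction es arbitrary: U) auto
  then show "dpath C J U es V \<Longrightarrow> path_arr U es \<in> Arr X"
    "dpath C J U es V \<Longrightarrow> Dom X (path_arr U es) = ob U" "dpath C J U es V \<Longrightarrow> Cod X (path_arr U es) = ob V" by auto
qed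

lemma path_arr_append:
  assumes fs: "dpath C J V fs W"
  shows "dpath C J U es V \<Longrightarrow> path_arr U (es @ fs) = path_arr V fs \<cdot> path_arr U es"
proof (induction es arbitrary: U)
  case Nil
  then show ?case using fs by simp
next
  case (Cons a es)
  then have "dpath C J (edge_tgt C J a) es V" "a \<in> dedges C" by simp_all
  then show ?case using Cons.IH path_arr[OF fs] path_arr[of "edge_tgt C J a" es V] by simp
qed

lemmas star_comp_self = star_comp[OF rep.monoid_rep_axioms rep.monoid_rep_axioms rep.monoid_rep_axioms]

lemma path_arr_whisk:
  assumes [simp]: "T \<in> dverts C" "W \<in> dverts C"
  shows "dpath C J U es V \<Longrightarrow> path_arr (T \<star> U \<star> W) (whisk_path C T es W)
    = star X mu mu T T (Idt X (ob T)) (U \<star> W) (V \<star> W) (star X mu mu U V (path_arr U es) W W (Idt X (ob W)))"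
proof (induction es arbitrary: U)
  case Nil
  then show ?case by auto
next
  case (Cons a es)
  have [simp]: "dpath C J (edge_tgt C J a) es V" "a \<in> dedges C" "edge_src C J a = U" "V \<in> dverts C" "U \<in> dverts C"
    using Cons.prems dpath_in by auto
  note [simp] = path_arr[OF \<open>dpath C J (edge_tgt C J a) es V\<close>]
  show ?case
    by (simp add: edge_arr_whisk Cons.IH star_comp_self)
qed

lemma path_arr_whisk_left:
  assumes [simp]: "T \<in> dverts C" "dpath C J U es V"
  shows "path_arr (T \<star> U) (whisk_path C T es (dunit C)) = star X mu mu T T (Idt X (ob T)) U V (path_arr U es)"
  using path_arr_whisk[of T "dunit C" U es V] dpath_in[OF assms(2)] path_arr[OF assms(2)] by simp

lemma path_arr_whisk_right:
  assumes [simp]: "T \<in> dverts C" "dpath C J U es V"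
  shows "path_arr (U \<star> T) (whisk_path C (dunit C) es T) = star X mu mu U V (path_arr U es) T T (Idt X (ob T))"
  using path_arr_whisk[of "dunit C" T U es V] dpath_in[OF assms(2)] path_arr[OF assms(2)] by simp

lemma edge_arr_whisk_left:
  assumes "a \<in> dedges C" "T \<in> dverts C"
  shows "edge_arr (whisk C T a (dunit C)) = star X mu mu T T (Idt X (ob T)) (edge_src C J a) (edge_tgt C J a) (edge_arr a)"
  using assms by (simp add: edge_arr_whisk)

lemma edge_arr_whisk_right:
  assumes "a \<in> dedges C" "T \<in> dverts C"
  shows "edge_arr (whisk C (dunit C) a T) = star X mu mu (edge_src C J a) (edge_tgt C J a) (edge_arr a) T T (Idt X (ob T))"
  using assms by (simp add: edge_arr_whisk)

lemma star_single: "star X mu mu [a] [a'] x [b] [b'] y = star X H.mu H.mu a a' x b b' y"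
  by (simp add: star_def)

lemma path_arr_base_rel: "base_rel C J U es es' V \<Longrightarrow> path_arr U es = path_arr U es'"
proof (induction rule: base_rel.induct)
  case (bar_whisk E F f A B)
  then have [simp]: "E \<in> Obj C" "F \<in> Obj C" "f \<in> Arr C" "Dom C f = A" "Cod C f = B" "A \<in> Obj C" "B \<in> Obj C" by auto
  have d: "[a] \<star> [b] = [a \<otimes>\<^bsub>C\<^esub> b]" for a b by (simp add: dten_singleton)
  show ?case
    by (simp add: edge_arr_whisk H.functor_ten d star_single)
next
  case (bar_idt A)
  then show ?case by simp
next
  case (bar_comp f A B g D)
  then show ?case by auto
next
  case (interchange a b U V W Z)
  then have [simp]: "edge_src C J a = U" "edge_tgt C J a = V" "edge_src C J b = W" "edge_tgt C J b = Z" by simp_all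
  note [simp] = interchange(1,2)
  have [simp]: "U \<in> dverts C" "V \<in> dverts C" "W \<in> dverts C" "Z \<in> dverts C"
    using edge_in[OF interchange(1)] edge_in[OF interchange(2)] by simp_all
  show ?case
    by (simp add: edge_arr_whisk_left edge_arr_whisk_right star_comp_self)
next
  case triangle_J
  show ?case
    using prim_triangles(1)
    by (simp add: edge_arr_whisk_left edge_arr_whisk_right del: prim_arr.simps)
next
  case triangle_Jdual
  show ?case
    using prim_triangles(2)
    by (simp add: edge_arr_whisk_left edge_arr_whisk_right del: prim_arr.simps)
qed

lemma path_arr_dcong: "dcong C J U es es' V \<Longrightarrow> path_arr U es = path_arr U es'"
proof (induction rule: dcong.induct)
  case (whisker U es es' V Y Z)
  have [simp]: "U \<in> dverts C" "V \<in> dverts C" "dpath C J U es V" "dpath C J U es' V" "Y \<in> dverts C" "Z \<in> dverts C"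
    using base_rel_dpath[OF whisker(1)] dpath_in whisker(2,3) by auto
  show ?case
    using path_arr_whisk[of Y Z U es V] path_arr_whisk[of Y Z U es' V] path_arr_base_rel[OF whisker(1)]
    by simp
next
  case (append U es es' V fs fs' W)
  have "dpath C J U es V" "dpath C J U es' V" "dpath C J V fs W" "dpath C J V fs' W"
    using dcong_dpath append(1,2) by auto
  then show ?case using append(3,4) by (simp add: path_arr_append)
qed (simp_all add: path_arr_base_rel)

definition ext_arr :: "('o, 'm) darr \<Rightarrow> 'q" where
  "ext_arr g = path_arr (fst g) (SOME es. es \<in> snd (snd g))"

lemma ext_arr_dclass [simp]:
  assumes "dpath C J U es V"
  shows "ext_arr (dclass C J U es V) = path_arr U es"
proof -
  have "\<exists>es'. dcong C J U es es' V" using dcong.refl[OF assms] by blast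
  then have "dcong C J U es (SOME es'. dcong C J U es es' V) V" by (rule someI_ex)
  then show ?thesis using path_arr_dcong by (simp add: ext_arr_def dclass_def)
qed

definition extension :: "('o list, ('o, 'm) darr, 'p, 'q) monfun" where
  "extension = \<lparr>ob_map = (\<lambda>U \<in> dverts C. ob U), ar_map = (\<lambda>g \<in> Arr A. ext_arr g),
     mult = (\<lambda>(U, V) \<in> dverts C \<times> dverts C. mu U V), unit_map = unit_map H\<rparr>"

lemma ext_arr_idt: "U \<in> dverts C \<Longrightarrow> ext_arr (Idt A U) = Idt X (ob U)"
  by (simp add: adjoin_dual_simps)

lemma ext_arr_ten:
  assumes "f \<in> Arr A" "g \<in> Arr A"
  shows "ext_arr (f \<boxtimes>\<^bsub>A\<^esub> g) = star X mu mu (Dom A f) (Cod A f) (ext_arr f) (Dom A g) (Cod A g) (ext_arr g)"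
proof -
  obtain U es V W fs Z where *: "f = dclass C J U es V" "dpath C J U es V" "g = dclass C J W fs Z" "dpath C J W fs Z"
    using assms by (auto elim!: adjoin_dual_arrE)
  have [simp]: "U \<in> dverts C" "V \<in> dverts C" "W \<in> dverts C" "Z \<in> dverts C"
    using dpath_in[OF *(2)] dpath_in[OF *(4)] by auto
  have p: "dpath C J (U \<star> W) (whisk_path C (dunit C) es W) (V \<star> W)" "dpath C J (V \<star> W) (whisk_path C V fs (dunit C)) (V \<star> Z)"
    using * by (auto intro: dpath_whisk_left dpath_whisk_right)
  then have "dpath C J (U \<star> W) (whisk_path C (dunit C) es W @ whisk_path C V fs (dunit C)) (V \<star> Z)"
    unfolding dpath_append by blast
  then show ?thesis
    using * p by (simp add: adjoin_dual_simps(5) dclass_ten path_arr_append[OF p(2,1)] path_arr_whisk_left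
        path_arr_whisk_right star_comp_self)
qed

lemma strong_monoidal_extension: "strong_monoidal_functor A X extension"
proof (rule strong_monoidal_functorI)
  show "monoidal_category A" "monoidal_category X"
    using A.monoidal_category_axioms H.cod.monoidal_category_axioms .
next
  fix f assume f: "f \<in> Arr A"
  then obtain U es V where "f = dclass C J U es V" "dpath C J U es V" "U \<in> dverts C" "V \<in> dverts C"
    by (auto elim!: adjoin_dual_arrE)
  then show "ar_map extension f \<in> Hom X (ob_map extension (Dom A f)) (ob_map extension (Cod A f))"
    using f by (simp add: extension_def)
next
  fix f g assume fg: "f \<in> Arr A" "g \<in> Arr A" "Dom A g = Cod A f"
  then obtain U es V fs W where *: "f = dclass C J U es V" "dpath C J U es V" "g = dclass C J V fs W" "dpath C J V fs W"
    by (auto elim!: adjoin_dual_arrE)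
  moreover from this have "dpath C J U (es @ fs) W" by (auto simp: dpath_append)
  ultimately show "ar_map extension (g \<cdot>\<^bsub>A\<^esub> f) = ar_map extension g \<cdot> ar_map extension f"
    by (simp add: extension_def adjoin_dual_simps(3) dclass_comp path_arr_append)
next
  fix f g assume [simp]: "f \<in> Arr A" "g \<in> Arr A"
  have arr: "ext_arr f \<in> Arr X \<and> Dom X (ext_arr f) = ob (Dom A f) \<and> Cod X (ext_arr f) = ob (Cod A f)
      \<and> Dom A f \<in> dverts C \<and> Cod A f \<in> dverts C" if "f \<in> Arr A" for f
    using that by (auto elim!: adjoin_dual_arrE)
  show "ar_map extension (f \<boxtimes>\<^bsub>A\<^esub> g) \<cdot> mult extension (Dom A f, Dom A g)
    = mult extension (Cod A f, Cod A g) \<cdot> (ar_map extension f \<boxtimes> ar_map extension g)"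
    using arr[of f] arr[of g] rep.self.star_mu[of "Dom A f" "Cod A f" "Dom A g" "Cod A g" "ext_arr f" "ext_arr g"]
    by (simp add: extension_def ext_arr_ten)
next
  fix U V W assume "U \<in> Obj A" "V \<in> Obj A" "W \<in> Obj A"
  then show "ar_map extension (Assoc A U V W) \<cdot> (mult extension (U \<otimes>\<^bsub>A\<^esub> V, W) \<cdot> (mult extension (U, V) \<boxtimes> Idt X (ob_map extension W)))
    = mult extension (U, V \<otimes>\<^bsub>A\<^esub> W) \<cdot> ((Idt X (ob_map extension U) \<boxtimes> mult extension (V, W))
        \<cdot> Assoc X (ob_map extension U) (ob_map extension V) (ob_map extension W))"
    using rep.mu_assoc[of U V W] by (simp add: extension_def ext_arr_idt)
next
  fix U assume "U \<in> Obj A"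
  then show "ar_map extension (LUnit A U) \<cdot> (mult extension (\<I>\<^bsub>A\<^esub>, U) \<cdot> (unit_map extension \<boxtimes> Idt X (ob_map extension U)))
      = LUnit X (ob_map extension U)"
    "ar_map extension (RUnit A U) \<cdot> (mult extension (U, \<I>\<^bsub>A\<^esub>) \<cdot> (Idt X (ob_map extension U) \<boxtimes> unit_map extension))
      = RUnit X (ob_map extension U)"
    using rep.mu_lunit[of U] rep.mu_runit[of U] by (simp_all add: extension_def ext_arr_idt)
qed (simp_all add: extension_def ext_arr_idt ob_dunit)

end

context dual_adjunction
begin

lemma extension_along_incl:
  assumes H: "one_mor C J X K H" and K: "has_right_dual X K"
  obtains F where "one_mor A [J] X K F" "jcomp C X F incl = H"
proof -
  obtain h p where eq: "H = (h, p)" by (cases H)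
  interpret h: pointed_functor C J X K h p using H by (simp add: eq one_mor_iff)
  obtain Y e n where d: "is_right_dual X K Y e n" using K by (auto simp: has_right_dual_def)
  note [simp] = h.cod.is_right_dual_arr[OF d]
  obtain e' n' where "is_right_dual X (ob_map h J) Y e' n'"
    using h.cod.is_right_dual_transport[OF d, of p "ob_map h J" "Idt X Y" Y] by auto
  then interpret E: dual_extension C J X h Y e' n' by unfold_locales
  interpret F: strong_monoidal_functor A X E.extension by (rule E.strong_monoidal_extension)
  have "pointed_functor A [J] X K E.extension p"
    by unfold_locales (simp_all add: E.extension_def)
  then have F: "one_mor A [J] X K (E.extension, p)" by (simp add: one_mor_iff)
  have incl: "incl = (fst incl, snd incl)" by (rule prod.collapse[symmetric])
  have [simp]: "[\<I>] = dunit C" by (simp add: dunit_def)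
  have bar: "E.ext_arr (prim_class (Bar f)) = ar_map h f" if "f \<in> Arr C" for f
    using that by (simp add: prim_class_def)
  have d1: "[a] \<star> [b] = [a \<otimes> b]" for a b by (rule dten_singleton)
  have "jcomp C X (E.extension, p) incl = H"
    by (rule one_mor_eqI[OF one_mor_jcomp[OF one_mor_incl F] H])
      (simp_all add: eq jcomp_Pair[of C X _ _ "fst incl" "snd incl", folded incl] E.extension_def E.ext_arr_idt bar d1
        E.rep.u_arr[simplified])
  with F show ?thesis by (rule that)
qed

end

section \<open>The universal property\<close>

lemma nat_cat_simps [simp]:
  "Obj nat_cat = UNIV" "Arr nat_cat = UNIV" "Dom nat_cat n = n" "Cod nat_cat n = n" "Idt nat_cat n = n"
  "Comp nat_cat n m = m" "TenO nat_cat = (+)" "TenA nat_cat = (+)" "Unit nat_cat = 0"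
  "Assoc nat_cat k m n = k + m + n" "LUnit nat_cat n = n" "RUnit nat_cat n = n"
  by (simp_all add: nat_cat_def)

lemma strict_monoidal_nat_cat: "strict_monoidal_category nat_cat"
proof (rule strict_monoidal_categoryI)
  show "category nat_cat" by unfold_locales auto
qed auto

lemma dual_adjunction_nat_cat: "dual_adjunction nat_cat 1"
  by (simp add: dual_adjunction_def dual_adjunction_axioms_def strict_monoidal_nat_cat)

lemma one_mor_nat_exists:
  assumes "strict_monoidal_category D" "K \<in> Obj D"
  obtains H :: "(nat, nat, 'p, 'q) jmor" where "one_mor nat_cat 1 D K H"
proof -
  interpret D: strict_monoidal_category D by fact
  interpret N: strict_monoidal_category nat_cat by (rule strict_monoidal_nat_cat)
  note [simp] = assms(2)
  define pow where "pow n = ((\<lambda>A. K \<otimes>\<^bsub>D\<^esub> A) ^^ n) \<I>\<^bsub>D\<^esub>" for n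
  have pow_in [simp]: "pow n \<in> Obj D" for n by (induction n) (simp_all add: pow_def)
  have pow_add: "pow m \<otimes>\<^bsub>D\<^esub> pow n = pow (m + n)" for m n
  proof (induction m)
    case 0
    have "pow 0 = \<I>\<^bsub>D\<^esub>" by (simp add: pow_def)
    then show ?case by simp
  next
    case (Suc m)
    have "pow (Suc k) = K \<otimes>\<^bsub>D\<^esub> pow k" for k by (simp add: pow_def)
    then show ?case using Suc by simp
  qed
  have pow01: "pow 0 = \<I>\<^bsub>D\<^esub>" "pow (Suc 0) = K" by (simp_all add: pow_def)
  define F where "F = \<lparr>ob_map = pow, ar_map = (\<lambda>n. Idt D (pow n)), mult = (\<lambda>(m, n). Idt D (pow (m + n))),
     unit_map = Idt D \<I>\<^bsub>D\<^esub>\<rparr>"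
  interpret F: strong_monoidal_functor nat_cat D F
    by (rule strong_monoidal_functorI)
      (use pow_add pow01 in \<open>simp_all add: F_def N.monoidal_category_axioms D.monoidal_category_axioms add.assoc\<close>)
  have "pointed_functor nat_cat 1 D K F (Idt D K)"
    by unfold_locales (auto simp: F_def pow01 extensional_def)
  then show ?thesis using that by (simp flip: one_mor_iff)
qed

lemma nat_functor_rep:
  assumes "strong_monoidal_functor nat_cat X f"
  shows "monoid_rep X UNIV (+) 0 (ob_map f) (\<lambda>m n. mult f (m, n)) (unit_map f)"
proof -
  interpret s: strict_source nat_cat X f
    using assms strict_monoidal_nat_cat by (simp add: strict_source_def)
  show ?thesis using s.rep.monoid_rep_axioms by simp
qed

lemma nat_two_mor_unique:
  assumes s: "two_mor nat_cat 1 X K G G' s" and t: "two_mor nat_cat 1 X K G G' t"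
  shows "s = t"
proof (rule two_mor_ext[OF s t])
  obtain f p f' p' where eq: "G = (f, p)" "G' = (f', p')" by (metis surj_pair)
  interpret s: pointed_transformation nat_cat 1 X K f p f' p' s using s by (simp add: eq two_mor_iff)
  interpret t: pointed_transformation nat_cat 1 X K f p f' p' t using t by (simp add: eq two_mor_iff)
  have 0: "s 0 = t 0"
    by (rule s.F.cod.iso_cancel_right[of "unit_map f"])
      (use s.unital t.unital s.F.unit_arr s.component[of 0] t.component[of 0] in simp_all)
  have 1: "s 1 = t 1"
    by (rule s.F.cod.iso_cancel_left[of p'])
      (use s.pointed t.pointed s.component[of 1] t.component[of 1] s.G.p_arr in simp_all)
  have "s n = t n" for n
  proof (induction n)
    case (Suc n)
    show ?case
      by (rule s.F.cod.iso_cancel_right[of "mult f (1, n)"])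
        (use s.monoidal[of 1 n] t.monoidal[of 1 n] Suc 1 s.F.mult_arr[of 1 n] s.component[of "Suc n"] t.component[of "Suc n"]
         in simp_all)
  qed (rule 0)
  then show "\<And>n. s n = t n" .
qed

lemma nat_two_mor_exists:
  assumes G: "one_mor nat_cat 1 X K G" and G': "one_mor nat_cat 1 X K G'"
  obtains s where "two_mor nat_cat 1 X K G G' s"
proof -
  obtain f p f' p' where eq: "G = (f, p)" "G' = (f', p')" by (metis surj_pair)
  interpret f: pointed_functor nat_cat 1 X K f p using G by (simp add: eq one_mor_iff)
  interpret f': pointed_functor nat_cat 1 X K f' p' using G' by (simp add: eq one_mor_iff)
  let ?m = "\<lambda>m n. mult f (m, n)" and ?m' = "\<lambda>m n. mult f' (m, n)"
  interpret R: monoid_rep2 X UNIV "(+)" 0 "ob_map f" ?m "unit_map f" "ob_map f'" ?m' "unit_map f'"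
    by (intro monoid_rep2I nat_functor_rep f.strong_monoidal_functor_axioms f'.strong_monoidal_functor_axioms)
  note [simp] = f.p_arr[simplified] f'.p_arr[simplified]
  let ?t = "inv_arr X p' \<cdot>\<^bsub>X\<^esub> p" and ?u = "unit_map f' \<cdot>\<^bsub>X\<^esub> inv_arr X (unit_map f)"
  define r where "r = rec_nat ?u (\<lambda>n x. star X ?m ?m' 1 1 ?t n n x)"
  have r0: "r 0 = ?u" and rSuc: "r (Suc n) = star X ?m ?m' 1 1 ?t n n (r n)" for n by (simp_all add: r_def)
  have r [simp]: "r n \<in> Arr X \<and> Dom X (r n) = ob_map f n \<and> Cod X (r n) = ob_map f' n" for n
    by (induction n) (simp_all add: r0 rSuc)
  have r1: "r 1 = ?t"
    using R.star_unit_right[of 1 1 ?t] by (simp add: rSuc r0)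
  have add: "r (m + n) = star X ?m ?m' m m (r m) n n (r n)" for m n
  proof (induction m)
    case 0
    show ?case using R.star_unit_left[of n n "r n"] by (simp add: r0)
  next
    case (Suc m)
    then show ?case using R.star_assoc[of 1 1 m m n n ?t "r m" "r n"] by (simp add: rSuc)
  qed
  have "two_mor nat_cat 1 X K (f, p) (f', p') r"
    unfolding two_mor_iff
  proof
    fix n A :: nat assume "n \<in> Arr nat_cat" "Dom nat_cat n = A"
    then show "ar_map f' n \<cdot>\<^bsub>X\<^esub> r A = r (Cod nat_cat n) \<cdot>\<^bsub>X\<^esub> ar_map f n"
      using f.functor_idt[of n] f'.functor_idt[of n] f.functor_obj[of n] f'.functor_obj[of n] by simp
  qed (use r0 r1 in \<open>auto simp: add R.star_mu extensional_def\<close>)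
  then show ?thesis using that by (simp add: eq)
qed

lemma one_mor_preserves_dual:
  assumes F: "one_mor D M X K F" and "strict_monoidal_category D" and d: "has_right_dual D M"
  shows "has_right_dual X K"
proof -
  obtain f p where eq: "F = (f, p)" by (cases F)
  interpret f: pointed_functor D M X K f p using F by (simp add: eq one_mor_iff)
  interpret s: strict_source D X f
    using assms(2) f.strong_monoidal_functor_axioms by (simp add: strict_source_def)
  obtain Y e h where d: "is_right_dual D M Y e h" using d by (auto simp: has_right_dual_def)
  have "ob_map f Y \<in> Obj X" using f.dom.is_right_dual_arr[OF d] by simp
  then show ?thesis
    using f.cod.is_right_dual_transport[OF s.preserves_dual[OF d], of "inv_arr X p" K "Idt X (ob_map f Y)" "ob_map f Y"]
    unfolding has_right_dual_def by auto
qed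

context dual_adjunction
begin

lemma in_Jdual_adjoin_dual: "in_Jdual A [J]"
  unfolding in_Jdual_def in_J_def has_right_dual_def
  using is_right_dual_adjoin_dual A.monoidal_category_axioms by (intro conjI exI) auto

end

abbreviation (input) free_dual :: "(nat list, (nat, nat) darr) moncat" where "free_dual \<equiv> adjoin_dual nat_cat 1"

interpretation N: dual_adjunction nat_cat 1
  by (rule dual_adjunction_nat_cat)

lemma free_dual_two_mor_unique:
  assumes s: "two_mor free_dual [1] X K G G' s" and t: "two_mor free_dual [1] X K G G' t"
  shows "s = t"
proof (rule N.incl_restrict_faithful[OF s t])
  fix c :: nat
  have "(\<lambda>a \<in> Obj nat_cat. s (ob_map (fst N.incl) a)) = (\<lambda>a \<in> Obj nat_cat. t (ob_map (fst N.incl) a))"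
    by (rule nat_two_mor_unique[OF two_mor_precompose[OF N.one_mor_incl s] two_mor_precompose[OF N.one_mor_incl t]])
  from fun_cong[OF this, of c] show "s [c] = t [c]" using N.incl_simps(1)[of c] by simp
qed

lemma free_dual_isomorphic:
  assumes G: "one_mor free_dual [1] X K G" and G': "one_mor free_dual [1] X K G'"
  shows "isomorphic (jhom free_dual [1] X K) G G'"
proof -
  have ex: "\<exists>s. two_mor free_dual [1] X K G G' s"
    if G: "one_mor free_dual [1] X K G" and G': "one_mor free_dual [1] X K G'" for G G'
    using nat_two_mor_exists[OF one_mor_jcomp[OF N.one_mor_incl G] one_mor_jcomp[OF N.one_mor_incl G']]
      N.incl_restrict_full[OF G G'] by metis
  obtain s t where s: "two_mor free_dual [1] X K G G' s" and t: "two_mor free_dual [1] X K G' G t"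
    using ex[OF G G'] ex[OF G' G] by blast
  have "inverse_arrs (jhom free_dual [1] X K) (G, G', s) (G', G, t)"
    using s t free_dual_two_mor_unique[OF two_mor_comp[OF s t] two_mor_idt[OF G]]
      free_dual_two_mor_unique[OF two_mor_comp[OF t s] two_mor_idt[OF G']]
    by (simp add: inverse_arrs_def)
  then have "is_iso (jhom free_dual [1] X K) (G, G', s)"
    unfolding is_iso_def by blast
  then show ?thesis
    by (rule category.isomorphicI[OF category_jhom]) simp_all
qed

context dual_adjunction
begin

lemma jcoproduct_adjoin_dual:
  assumes i: "one_mor free_dual [1] A [J] i" and eq: "jequiv_via C0 J0 C J E Q"
  shows "jcoproduct TYPE(('x, 'y) moncat) free_dual [1] C0 J0 A [J] i (jcomp C0 A incl E)"
proof -
  let ?k = "jcomp C0 A incl E"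
  have E: "one_mor C0 J0 C J E" and Q: "one_mor C J C0 J0 Q" using eq by (auto simp: jequiv_via_def)
  have iso: "isomorphic (jhom C0 J0 C0 J0) (jcomp C0 C0 Q E) (jid C0 J0)"
    "isomorphic (jhom C J C J) (jcomp C C E Q) (jid C J)"
    using eq by (auto simp: jequiv_via_def)
  obtain u where u: "two_mor C0 J0 C0 J0 (jcomp C0 C0 Q E) (jid C0 J0) u" "\<And>c. c \<in> Obj C0 \<Longrightarrow> is_iso C0 (u c)"
    using iso(1) by (rule isomorphic_jhomE) blast
  obtain v where v: "two_mor C J C J (jcomp C C E Q) (jid C J) v" "\<And>c. c \<in> Obj C \<Longrightarrow> is_iso C (v c)"
    using iso(2) by (rule isomorphic_jhomE) blast
  have k: "one_mor C0 J0 A [J] ?k" by (rule one_mor_jcomp[OF E one_mor_incl])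
  have ob_k: "ob_map (fst ?k) b = ob_map (fst incl) (ob_map (fst E) b)" if "b \<in> Obj C0" for b
    using that by simp
  have E_obj: "ob_map (fst E) b \<in> Obj C" if "b \<in> Obj C0" for b
    using one_mor_ob_map[OF E that] .
  have "equivalence_functor (jhom A [J] X K) (prod_cat (jhom free_dual [1] X K) (jhom C0 J0 X K))
      (jrestrict free_dual C0 X i ?k)" if X: "in_J X K" for X :: "('x, 'y) moncat" and K
  proof (rule equivalence_functorI[OF is_functor_jrestrict[OF i k]])
    have k_comp: "jcomp C0 X F ?k = jcomp C0 X (jcomp C X F incl) E" if "one_mor A [J] X K F" for F
      using jcomp_jcomp[OF E one_mor_incl that] .
    show "fully_faithful (jhom A [J] X K) (prod_cat (jhom free_dual [1] X K) (jhom C0 J0 X K))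
        (jrestrict free_dual C0 X i ?k)"
      unfolding fully_faithful_def
    proof (intro ballI)
      fix F G g
      assume "F \<in> Obj (jhom A [J] X K)" "G \<in> Obj (jhom A [J] X K)"
        and "g \<in> Hom (prod_cat (jhom free_dual [1] X K) (jhom C0 J0 X K))
          (ob_map (jrestrict free_dual C0 X i ?k) F) (ob_map (jrestrict free_dual C0 X i ?k) G)"
      then obtain s t where F: "one_mor A [J] X K F" and G: "one_mor A [J] X K G"
        and g: "g = ((jcomp free_dual X F i, jcomp free_dual X G i, s), (jcomp C0 X F ?k, jcomp C0 X G ?k, t))"
        and s: "two_mor free_dual [1] X K (jcomp free_dual X F i) (jcomp free_dual X G i) s"
        and t: "two_mor C0 J0 X K (jcomp C0 X F ?k) (jcomp C0 X G ?k) t"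
        by (cases g) auto
      note Fi = one_mor_jcomp[OF one_mor_incl F] and Gi = one_mor_jcomp[OF one_mor_incl G]
      obtain t' where t': "two_mor C J X K (jcomp C X F incl) (jcomp C X G incl) t'"
        "(\<lambda>b \<in> Obj C0. t' (ob_map (fst E) b)) = t"
        using equivalence_restrict_full[OF v u E Q Fi Gi] t unfolding k_comp[OF F] k_comp[OF G] by blast
      obtain r where r: "two_mor A [J] X K F G r" "(\<lambda>c \<in> Obj C. r (ob_map (fst incl) c)) = t'"
        using incl_restrict_full[OF F G t'(1)] by blast
      have r_i: "(\<lambda>a \<in> Obj free_dual. r (ob_map (fst i) a)) = s"
        by (rule free_dual_two_mor_unique[OF two_mor_precompose[OF i r(1)] s])
      have r_k: "(\<lambda>b \<in> Obj C0. r (ob_map (fst ?k) b)) = t"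
        unfolding t'(2)[symmetric] r(2)[symmetric] by (rule restrict_ext) (simp add: E_obj)
      have unique: "r' = r" if r': "two_mor A [J] X K F G r'" and eq: "(\<lambda>b \<in> Obj C0. r' (ob_map (fst ?k) b)) = t" for r'
      proof (rule incl_restrict_faithful[OF r' r(1)])
        have "(\<lambda>c \<in> Obj C. r' (ob_map (fst incl) c)) = (\<lambda>c \<in> Obj C. r (ob_map (fst incl) c))"
        proof (rule equivalence_restrict_faithful[OF v E Q two_mor_precompose[OF one_mor_incl r']
              two_mor_precompose[OF one_mor_incl r(1)]])
          fix b assume "b \<in> Obj C0"
          then show "(\<lambda>c \<in> Obj C. r' (ob_map (fst incl) c)) (ob_map (fst E) b)
              = (\<lambda>c \<in> Obj C. r (ob_map (fst incl) c)) (ob_map (fst E) b)"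
            using fun_cong[OF eq, of b] fun_cong[OF r_k, of b] by (simp add: E_obj)
        qed
        then show "r' [c] = r [c]" if "c \<in> Obj C" for c
          using that by (metis (no_types, lifting) incl_simps(1) restrict_apply')
      qed
      show "\<exists>!f. f \<in> Hom (jhom A [J] X K) F G \<and> ar_map (jrestrict free_dual C0 X i ?k) f = g"
      proof (rule ex1I[of _ "(F, G, r)"])
        show "(F, G, r) \<in> Hom (jhom A [J] X K) F G \<and> ar_map (jrestrict free_dual C0 X i ?k) (F, G, r) = g"
          using r(1) r_i r_k by (simp add: g)
      next
        fix f assume f: "f \<in> Hom (jhom A [J] X K) F G \<and> ar_map (jrestrict free_dual C0 X i ?k) f = g"
        then obtain r' where "f = (F, G, r')" "two_mor A [J] X K F G r'" by auto
        with f unique[of r'] show "f = (F, G, r)" by (simp add: g)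
      qed
    qed
  next
    fix d assume "d \<in> Obj (prod_cat (jhom free_dual [1] X K) (jhom C0 J0 X K))"
    then obtain G H where d: "d = (G, H)" and G: "one_mor free_dual [1] X K G" and H: "one_mor C0 J0 X K H"
      by (cases d) auto
    have "has_right_dual X K"
      using one_mor_preserves_dual[OF G N.strict_monoidal_adjoin_dual] N.in_Jdual_adjoin_dual
      by (simp add: in_Jdual_def)
    then obtain F where F: "one_mor A [J] X K F" "jcomp C X F incl = jcomp C X H Q"
      using extension_along_incl[OF one_mor_jcomp[OF Q H]] by blast
    have "isomorphic (jhom C0 J0 X K) (jcomp C0 X H (jcomp C0 C0 Q E)) (jcomp C0 X H (jid C0 J0))"
      by (rule isomorphic_postcompose[OF iso(1) H])
    then have "isomorphic (jhom C0 J0 X K) (jcomp C0 X F ?k) H"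
      by (simp add: jcomp_jid(1)[OF H] jcomp_jcomp[OF E one_mor_incl F(1)] jcomp_jcomp[OF E Q H] F(2))
    moreover have "isomorphic (jhom free_dual [1] X K) (jcomp free_dual X F i) G"
      by (rule free_dual_isomorphic[OF one_mor_jcomp[OF i F(1)] G])
    ultimately have "isomorphic (prod_cat (jhom free_dual [1] X K) (jhom C0 J0 X K))
        (ob_map (jrestrict free_dual C0 X i ?k) F) d"
      by (simp add: d isomorphic_prod_cat[OF category_jhom category_jhom])
    then show "\<exists>c \<in> Obj (jhom A [J] X K). isomorphic (prod_cat (jhom free_dual [1] X K) (jhom C0 J0 X K))
        (ob_map (jrestrict free_dual C0 X i ?k) c) d"
      using F(1) by (intro bexI[of _ F]) simp_all
  qed
  then show ?thesis
    unfolding jcoproduct_def using i k by blast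
qed

lemma free_dual_functor_exists:
  obtains i where "one_mor free_dual [1] A [J] i"
proof -
  have J: "[J] \<in> Obj A" and d: "has_right_dual A [J]"
    using in_Jdual_adjoin_dual by (auto simp: in_Jdual_def in_J_def)
  obtain H :: "(nat, nat, 'o list, ('o, 'm) darr) jmor" where H: "one_mor nat_cat 1 A [J] H"
    by (rule one_mor_nat_exists[OF strict_monoidal_adjoin_dual J])
  show ?thesis
    by (rule N.extension_along_incl[OF H d]) (rule that)
qed

end

theorem proposition20:
  fixes C0 :: "('u, 'v) moncat" and J0 :: 'u
    and C :: "('o, 'm) moncat" and J :: 'o
  assumes "in_J C0 J0"
    and "in_J C J" and "strict_monoidal_category C" and "jequiv C0 J0 C J"
  shows "(\<forall>(P :: ('p, 'q) moncat) L i k.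
            jcoproduct TYPE(('p, 'q) moncat) (adjoin_dual nat_cat 1) [1] C0 J0 P L i k \<and>
            jcoproduct TYPE(('o list, ('o, 'm) darr) moncat) (adjoin_dual nat_cat 1) [1] C0 J0 P L i k
            \<longrightarrow> jequiv_dual (adjoin_dual C J) [J] P L) \<and>
         (\<exists>i k. jcoproduct TYPE(('x, 'y) moncat)
                  (adjoin_dual nat_cat 1) [1] C0 J0 (adjoin_dual C J) [J] i k)"
proof -
  interpret dual_adjunction C J
    using assms(2,3) by (simp add: dual_adjunction_def dual_adjunction_axioms_def in_J_def)
  obtain i where i: "one_mor free_dual [1] A [J] i" by (rule free_dual_functor_exists)
  obtain E Q where E: "jequiv_via C0 J0 C J E Q" using assms(4) by (auto simp: jequiv_def)
  have "jequiv_dual A [J] P L"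
    if P: "jcoproduct TYPE(('p, 'q) moncat) free_dual [1] C0 J0 P L i' k'"
      "jcoproduct TYPE(('o list, ('o, 'm) darr) moncat) free_dual [1] C0 J0 P L i' k'"
    for P :: "('p, 'q) moncat" and L i' k'
  proof -
    have eq: "jequiv A [J] P L"
      by (rule coproduct_unique[OF P jcoproduct_adjoin_dual[OF i E] jcoproduct_adjoin_dual[OF i E]])
    then obtain F where F: "one_mor A [J] P L F" by (auto simp: jequiv_def jequiv_via_def)
    have "has_right_dual P L"
      using one_mor_preserves_dual[OF F strict_monoidal_adjoin_dual] in_Jdual_adjoin_dual
      by (simp add: in_Jdual_def)
    then show ?thesis
      using eq one_mor_in_J[OF F] in_Jdual_adjoin_dual by (simp add: jequiv_dual_def in_Jdual_def)
  qed
  moreover have "jcoproduct TYPE(('x, 'y) moncat) free_dual [1] C0 J0 A [J] i (jcomp C0 A incl E)"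
    by (rule jcoproduct_adjoin_dual[OF i E])
  ultimately show ?thesis by blast
qed

end
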